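(* Let $1<k\le n$ be integers. The poset $\mathrm{Poset}(\mathrm{PF}_{n,k})$ is locally self-dual; that is, every interval $[\sigma,\tau]$ (with $\sigma\le\tau$) in $\mathrm{Poset}(\mathrm{PF}_{n,k})$ is isomorphic to its own order dual.
   Context: Write $[n]=\{1,\dots,n\}$. A parking function of length $n$ is an $n$-tuple $(a_1,\dots,a_n)$ of positive integers whose weakly increasing rearrangement $b_1\le\dots\le b_n$ satisfies $b_i\le i$ for all $i$; $\mathrm{PF}_n$ is the set of these. For $1<k\le n$, $\mathrm{PF}_{n,k}$ is the set of $a\in\mathrm{PF}_n$ such that $k$ is not an entry of $a$ but each of $k+1,\dots,n$ is an entry of $a$. $\mathrm{NC}_m$ is the lattice of noncrossing partitions of $[m]$ (partitions for which, placing $1,\dots,m$ in clockwise order on a circle, the convex hulls of the blocks are pairwise disjoint), ordered by refinement, with the finer partition being smaller. Each covering relation $\sigma<\tau$ in $\mathrm{NC}_{n+1}$ merges two blocks $B_1,B_2$ of $\sigma$ into one block $B=B_1\cup B_2$ of $\tau$; name them so that $\min B\in B_1$, and label the covering relation by the largest element of $B_1$ that is less than every element of $B_2$. Reading the labels of a maximal chain of $\mathrm{NC}_{n+1}$ from bottom to top gives a parking function of length $n$, and this is a (known) bijection from maximal chains of $\mathrm{NC}_{n+1}$ to $\mathrm{PF}_n$. $\mathrm{Poset}(\mathrm{PF}_{n,k})$ is the poset whose Hasse diagram is the union of the maximal chains of $\mathrm{NC}_{n+1}$ corresponding to elements of $\mathrm{PF}_{n,k}$: its elements are the noncrossing partitions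 lying on at least one of these chains, and its order is the reflexive-transitive closure of the covering relations occurring in these chains (it need not be an induced subposet of $\mathrm{NC}_{n+1}$). *)

theory Defs
  imports "HOL-Analysis.Analysis" "HOL-Library.Disjoint_Sets"
begin

text \<open>Lists are indexed from 0, so \<open>sort a ! (i - 1)\<close> is the \<open>i\<close>-th smallest entry of \<open>a\<close>.\<close>

definition parking_functions :: "nat \<Rightarrow> nat list set" where
  "parking_functions n =
    {a. length a = n \<and> (\<forall>x\<in>set a. 0 < x) \<and> (\<forall>i\<in>{1..n}. sort a ! (i - 1) \<le> i)}"

definition PF :: "nat \<Rightarrow> nat \<Rightarrow> nat list set" where
  "PF n k = {a \<in> parking_functions n. k \<notin> set a \<and> {k+1..n} \<subseteq> set a}"

text \<open>The \<open>m\<close> points on the unit circle, in clockwise order.\<close>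

definition circle_point :: "nat \<Rightarrow> nat \<Rightarrow> complex" where
  "circle_point m i = cis (- (2 * pi * real i / real m))"

definition NC :: "nat \<Rightarrow> nat set set set" where
  "NC m = {\<sigma>. partition_on {1..m} \<sigma> \<and>
              disjoint_family_on (\<lambda>B. convex hull (circle_point m ` B)) \<sigma>}"

definition finer :: "nat \<Rightarrow> nat set set \<Rightarrow> nat set set \<Rightarrow> bool" where
  "finer m \<sigma> \<tau> \<longleftrightarrow> refines {1..m} \<sigma> \<tau> \<and> \<sigma> \<noteq> \<tau>"

text \<open>Maximal chains are listed from bottom to top; consecutive entries of such a list are
  the covering relations of the chain.\<close>

definition maximal_chains :: "nat \<Rightarrow> nat set set list set" where
  "maximal_chains m =
    {c. sorted_wrt (finer m) c \<and> pred_on.maxchain (NC m) (finer m) (set c)}"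

text \<open>The description is only meaningful for a covering relation, where the two merged blocks
  and hence the label are unique.\<close>

definition cover_label :: "nat set set \<Rightarrow> nat set set \<Rightarrow> nat" where
  "cover_label \<sigma> \<tau> = (THE l. \<exists>B1\<in>\<sigma>. \<exists>B2\<in>\<sigma>. B1 \<noteq> B2 \<and>
     \<tau> = insert (B1 \<union> B2) (\<sigma> - {B1, B2}) \<and> Min (B1 \<union> B2) \<in> B1 \<and>
     l = Max {x\<in>B1. \<forall>y\<in>B2. x < y})"

definition chain_labels :: "nat set set list \<Rightarrow> nat list" where
  "chain_labels c = map2 cover_label (butlast c) (tl c)"

definition PF_chains :: "nat \<Rightarrow> nat \<Rightarrow> nat set set list set" where
  "PF_chains n k = {c \<in> maximal_chains (n + 1). chain_labels c \<in> PF n k}"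

definition Poset_carrier :: "nat \<Rightarrow> nat \<Rightarrow> nat set set set" where
  "Poset_carrier n k = (\<Union>c\<in>PF_chains n k. set c)"

definition Poset_cover :: "nat \<Rightarrow> nat \<Rightarrow> nat set set \<Rightarrow> nat set set \<Rightarrow> bool" where
  "Poset_cover n k \<sigma> \<tau> \<longleftrightarrow>
    (\<exists>c\<in>PF_chains n k. \<exists>i. Suc i < length c \<and> c ! i = \<sigma> \<and> c ! Suc i = \<tau>)"

definition Poset_le :: "nat \<Rightarrow> nat \<Rightarrow> nat set set \<Rightarrow> nat set set \<Rightarrow> bool" where
  "Poset_le n k = (Poset_cover n k)\<^sup>*\<^sup>*"

definition interval :: "'a set \<Rightarrow> ('a \<Rightarrow> 'a \<Rightarrow> bool) \<Rightarrow> 'a \<Rightarrow> 'a \<Rightarrow> 'a set" where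
  "interval P le x y = {z\<in>P. le x z \<and> le z y}"

definition order_isomorphic ::
  "'a set \<Rightarrow> ('a \<Rightarrow> 'a \<Rightarrow> bool) \<Rightarrow> 'b set \<Rightarrow> ('b \<Rightarrow> 'b \<Rightarrow> bool) \<Rightarrow> bool" where
  "order_isomorphic A leA B leB \<longleftrightarrow>
    (\<exists>f. bij_betw f A B \<and> (\<forall>x\<in>A. \<forall>y\<in>A. leA x y \<longleftrightarrow> leB (f x) (f y)))"

definition locally_self_dual :: "'a set \<Rightarrow> ('a \<Rightarrow> 'a \<Rightarrow> bool) \<Rightarrow> bool" where
  "locally_self_dual P le \<longleftrightarrow>
    (\<forall>x\<in>P. \<forall>y\<in>P. le x y \<longrightarrow>
      order_isomorphic (interval P le x y) le (interval P le x y) (le\<inverse>\<inverse>))"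

end

theory Submission
  imports Defs "HOL-Combinatorics.Orbits"
begin

text \<open>A maximal chain has labels in \<open>PF n k\<close> iff every partition on it meets
  \<open>{k+1, \<dots>, n+1}\<close> in intervals, of which only the one containing \<open>k+1\<close> may be joined to
  points \<open>\<le> k\<close>, and no step has label \<open>k\<close>. Contracting \<open>{k+1, \<dots>, n+1}\<close> to the point \<open>k+1\<close>
  therefore identifies the poset with a product of a Boolean algebra and the case \<open>n = k\<close>.
  In that case, regard a noncrossing partition of \<open>[k+1]\<close> as the permutation with its blocks as cycles.
  Merging two blocks is right multiplication by a transposition, and the label is \<open>k\<close> iff this
  transposition is \<open>(k k+1)\<close>. Hence the chains in an interval \<open>[\<sigma>, \<tau>]\<close> are the minimal
  factorizations of \<open>\<sigma>\<inverse> \<tau>\<close> into transpositions other than \<open>(k k+1)\<close>. Choosing a reflection that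
  inverts \<open>\<sigma>\<inverse> \<tau>\<close> and preserves \<open>{k, k+1}\<close>, conjugating the factors and reversing their order gives the
  duality.\<close>

section \<open>Noncrossing partitions without geometry\<close>

text \<open>Forbidding the label \<open>k\<close> is a condition on covering steps, and a partition
  may stay in the poset although the step below it that refinement would allow is lost. So every
  argument concerns single steps and their reflexive-transitive closure, and the reversal of an
  interval has to send allowed steps to allowed steps; this is why the inverting reflection must
  preserve the pair of \<open>k\<close> and \<open>k+1\<close>. That the reflected chain stays among
  noncrossing partitions is not verified directly. It follows from counting cycles: multiplication
  by a transposition creates at most one new cycle, and the reflected chain from \<tau> to \<sigma>
  has exactly as many steps as \<sigma> has cycles more than \<tau>. Hence each of its factors must
  cut a cycle, and cutting a cycle of a noncrossing permutation in two leaves it noncrossing. The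
  Boolean factor records, independently for each \<open>j\<close> with \<open>k < j\<close> and
  \<open>j \<le> n\<close>, whether \<open>j\<close> and \<open>j+1\<close> share a block. On an
  interval it is reversed by the relative complement.\<close>

definition crossing :: "nat set \<Rightarrow> nat set \<Rightarrow> bool" where
  "crossing B C \<longleftrightarrow> (\<exists>a\<in>B. \<exists>c\<in>B. \<exists>b\<in>C. \<exists>d\<in>C. a < b \<and> b < c \<and> c < d)"

text \<open>\<open>crossing\<close> is directed: the first of the four points lies in its first
  argument. Quantifying over ordered pairs of blocks covers both directions.\<close>

definition noncrossing :: "nat set set \<Rightarrow> bool" where
  "noncrossing \<sigma> \<longleftrightarrow> (\<forall>B\<in>\<sigma>. \<forall>C\<in>\<sigma>. B \<noteq> C \<longrightarrow> \<not> crossing B C)"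

lemma inner_cis: "inner (cis a) (cis b) = cos (a - b)"
  by (simp add: inner_complex_def cos_diff)

text \<open>The line orthogonal to the direction of the midpoint of the arc separates the arc from
  the remaining points.\<close>

lemma disjoint_hulls_arc:
  assumes pq: "1 \<le> p" "p \<le> q" "q \<le> m" and X: "X \<subseteq> {p..q}" and Y: "Y \<subseteq> {1..m} - {p..q}"
  shows "convex hull (circle_point m ` X) \<inter> convex hull (circle_point m ` Y) = {}"
proof -
  define mid where "mid = (real p + real q) / 2"
  define u where "u = cis (- (2 * pi * mid / real m))"
  \<comment> \<open>\<open>h\<close> is half the angle of the arc, so both endpoints of the arc lie
    on the line \<open>inner u z = cos h\<close>.\<close>
  define h where "h = pi * (real q - real p) / real m"
  have m: "real m > 0" using pq by simp
  have inn: "inner u (circle_point m i) = cos (2 * pi * \<bar>real i - mid\<bar> / real m)" for i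
  proof -
    have "inner u (circle_point m i) = cos (2 * pi * (real i - mid) / real m)"
      unfolding u_def circle_point_def inner_cis by (simp add: algebra_simps diff_divide_distrib)
    also have "\<dots> = cos \<bar>2 * pi * (real i - mid) / real m\<bar>" by (simp only: cos_abs_real)
    finally show ?thesis by (simp add: abs_mult)
  qed
  have h: "0 \<le> h" "h \<le> pi"
  proof -
    have "pi * (real q - real p) \<le> pi * real m" using pq by (intro mult_left_mono) auto
    then show "h \<le> pi" unfolding h_def using m by (simp add: pos_divide_le_eq)
  qed (use pq in \<open>simp add: h_def\<close>)
  have in_arc: "cos h \<le> inner u (circle_point m i)" if "i \<in> {p..q}" for i
  proof -
    have "2 * \<bar>real i - mid\<bar> \<le> real q - real p"
      using that by (auto simp: mid_def abs_if field_simps)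
    then have "pi * (2 * \<bar>real i - mid\<bar>) \<le> pi * (real q - real p)"
      by (rule mult_left_mono) simp
    then have "2 * pi * \<bar>real i - mid\<bar> / real m \<le> h"
      unfolding h_def using m by (simp add: divide_right_mono mult_ac)
    then show ?thesis unfolding inn using h m by (intro cos_monotone_0_pi_le) auto
  qed
  have off_arc: "inner u (circle_point m i) < cos h" if "i \<in> {1..m} - {p..q}" for i
  proof -
    define d where "d = 2 * pi * \<bar>real i - mid\<bar> / real m"
    have "real q - real p < 2 * \<bar>real i - mid\<bar>"
      using that pq by (auto simp: mid_def abs_if field_simps)
    then have "pi * (real q - real p) < pi * (2 * \<bar>real i - mid\<bar>)" by simp
    then have d1: "h < d" unfolding h_def d_def using m by (simp add: divide_strict_right_mono mult_ac)
    \<comment> \<open>Going round the circle the other way, the point is also more than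
      \<open>h\<close> away from the midpoint; the bound is strict because all points lie in
      \<open>{1..m}\<close>.\<close>
    have "2 * \<bar>real i - mid\<bar> < 2 * real m - (real q - real p)"
      using that pq by (auto simp: mid_def abs_if field_simps)
    then have "pi * (2 * \<bar>real i - mid\<bar>) < pi * (2 * real m - (real q - real p))" by simp
    then have "d < pi * (2 * real m - (real q - real p)) / real m" unfolding d_def
      using m by (simp add: divide_strict_right_mono mult_ac)
    also have "\<dots> = 2 * pi - h" unfolding h_def using m by (simp add: field_simps)
    finally have d2: "d < 2 * pi - h" .
    show ?thesis
    proof (cases "d \<le> pi")
      case True
      then have "cos d < cos h" using d1 h by (intro cos_monotone_0_pi) auto
      then show ?thesis by (simp add: inn d_def)
    next
      case False
      then have "cos (2 * pi - d) < cos h" using d2 h by (intro cos_monotone_0_pi) auto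
      then show ?thesis by (simp add: inn d_def)
    qed
  qed
  have "convex hull (circle_point m ` X) \<subseteq> {z. inner u z \<ge> cos h}"
    using X in_arc by (intro hull_minimal convex_halfspace_ge) auto
  moreover have "convex hull (circle_point m ` Y) \<subseteq> {z. inner u z < cos h}"
    using Y off_arc by (intro hull_minimal convex_halfspace_lt) blast+
  ultimately show ?thesis by force
qed

text \<open>Let \<open>Y\<close> be the set whose least element comes second. A point of
  \<open>X\<close> strictly between \<open>Min Y\<close> and \<open>Max Y\<close> would form a
  crossing together with \<open>Min X\<close>, so the arc from \<open>Min Y\<close> to
  \<open>Max Y\<close> contains \<open>Y\<close> and avoids \<open>X\<close>.\<close>

lemma disjoint_hulls:
  assumes "X \<subseteq> {1..m}" "Y \<subseteq> {1..m}" "X \<inter> Y = {}" "\<not> crossing X Y" "\<not> crossing Y X"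
  shows "convex hull (circle_point m ` X) \<inter> convex hull (circle_point m ` Y) = {}"
proof -
  have *: "convex hull (circle_point m ` X) \<inter> convex hull (circle_point m ` Y) = {}"
    if "X \<subseteq> {1..m}" "Y \<subseteq> {1..m}" "X \<inter> Y = {}" "\<not> crossing X Y" "x \<in> X" "Y \<noteq> {}"
      "\<forall>y\<in>Y. x < y" for X Y x
  proof -
    have fin: "finite Y" using that(2) finite_subset by blast
    have Y: "Min Y \<in> Y" "Max Y \<in> Y" using fin that by auto
    have "z \<notin> {Min Y..Max Y}" if "z \<in> X" for z
    proof
      assume z: "z \<in> {Min Y..Max Y}"
      have "z \<noteq> Min Y" "z \<noteq> Max Y" using Y \<open>z \<in> X\<close> \<open>X \<inter> Y = {}\<close> by auto
      with z have "Min Y < z" "z < Max Y" by auto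
      then show False using Y \<open>z \<in> X\<close> \<open>x \<in> X\<close> \<open>\<forall>y\<in>Y. x < y\<close> \<open>\<not> crossing X Y\<close>
        unfolding crossing_def by blast
    qed
    then have "X \<subseteq> {1..m} - {Min Y..Max Y}" using that by blast
    moreover have "Y \<subseteq> {Min Y..Max Y}" using fin by auto
    moreover have "1 \<le> Min Y" "Min Y \<le> Max Y" "Max Y \<le> m" using Y that(2) fin by auto
    ultimately show ?thesis using disjoint_hulls_arc[of "Min Y" "Max Y" m Y X] by blast
  qed
  show ?thesis
  proof (cases "X = {} \<or> Y = {}")
    case False
    have fin: "finite X" "finite Y" using assms finite_subset by blast+
    have "Min X \<in> X" "Min Y \<in> Y" using fin False by auto
    then have "Min X \<noteq> Min Y" using assms(3) by auto
    then have "(\<forall>y\<in>Y. Min X < y) \<or> (\<forall>x\<in>X. Min Y < x)"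
      using fin by (meson Min_le less_le_trans linorder_neqE_nat)
    then show ?thesis using *[of X Y "Min X"] *[of Y X "Min Y"] assms False
      \<open>Min X \<in> X\<close> \<open>Min Y \<in> Y\<close> by blast
  qed auto
qed

text \<open>Distinct singletons cannot cross, so \<open>disjoint_hulls\<close> already separates
  distinct points without further trigonometry.\<close>

lemma circle_point_inj: "inj_on (circle_point m) {1..m}"
proof (rule inj_onI)
  fix i j assume ij: "i \<in> {1..m}" "j \<in> {1..m}" and eq: "circle_point m i = circle_point m j"
  show "i = j"
  proof (rule ccontr)
    assume "i \<noteq> j"
    then have "\<not> crossing {i} {j}" "\<not> crossing {j} {i}" "{i} \<inter> {j} = {}" by (auto simp: crossing_def)
    then have "convex hull (circle_point m ` {i}) \<inter> convex hull (circle_point m ` {j}) = {}"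
      using ij by (intro disjoint_hulls) auto
    then show False using eq by simp
  qed
qed

text \<open>By Radon's theorem the four points split into two sets whose convex hulls meet; every
  split other than \<open>{a, c}\<close> and \<open>{b, d}\<close> is noncrossing, hence excluded by
  \<open>disjoint_hulls\<close>.\<close>

lemma crossing_hulls_meet:
  assumes X: "X \<subseteq> {1..m}" and Y: "Y \<subseteq> {1..m}" and "crossing X Y"
  shows "convex hull (circle_point m ` X) \<inter> convex hull (circle_point m ` Y) \<noteq> {}"
proof -
  obtain a b c d where abcd: "a \<in> X" "c \<in> X" "b \<in> Y" "d \<in> Y" "a < b" "b < c" "c < d"
    using assms(3) unfolding crossing_def by blast
  let ?Q = "{a,b,c,d}"
  let ?P = "circle_point m"
  have Q: "?Q \<subseteq> {1..m}" using abcd X Y by auto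
  have inj: "inj_on ?P ?Q" using circle_point_inj Q by (rule inj_on_subset)
  have "card (?P ` ?Q) = card ?Q" by (rule card_image[OF inj])
  also have "\<dots> = 4" using abcd by auto
  \<comment> \<open>Four points in a real plane are two more than its dimension.\<close>
  finally have "affine_dependent (?P ` ?Q)" by (intro affine_dependent_biggerset) auto
  then obtain M N where MN: "M \<inter> N = {}" "M \<union> N = ?P ` ?Q" "convex hull M \<inter> convex hull N \<noteq> {}"
    using Radon_partition[of "?P ` ?Q"] by (metis finite.emptyI finite.insertI finite_imageI)
  define M' where "M' = {x\<in>?Q. ?P x \<in> M}"
  define N' where "N' = {x\<in>?Q. ?P x \<in> N}"
  have sub: "M \<subseteq> ?P ` ?Q" "N \<subseteq> ?P ` ?Q" using MN(2) by blast+
  have im: "M = ?P ` M'" "N = ?P ` N'" using sub unfolding M'_def N'_def by fast+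
  have "?P x \<in> M \<union> N" if "x \<in> ?Q" for x using that MN(2) by (metis imageI)
  then have dis: "M' \<inter> N' = {}" "M' \<union> N' = ?Q" using MN(1) unfolding M'_def N'_def by blast+
  have cr: "crossing M' N' \<or> crossing N' M'"
    using disjoint_hulls[of M' m N'] MN(3) dis Q unfolding im by blast
  have "{M', N'} = {{a,c},{b,d}}"
  proof -
    have *: "U = {a,c} \<and> V = {b,d}" if UV: "crossing U V" "U \<inter> V = {}" "U \<union> V = ?Q" for U V
    proof -
      obtain x y z w where xy: "x \<in> U" "z \<in> U" "y \<in> V" "w \<in> V" "x < y" "y < z" "z < w"
        using UV(1) unfolding crossing_def by blast
      then have "x \<in> ?Q" "y \<in> ?Q" "z \<in> ?Q" "w \<in> ?Q" using UV(3) by blast+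
      \<comment> \<open>Four increasing elements of a four-element set exhaust it in order; the
        following bounds force this one element at a time.\<close>
      moreover have "b \<le> y" using calculation(1,2) xy abcd by auto
      moreover have "c \<le> z" using calculation(3,5) xy abcd by auto
      moreover have "w = d" using calculation(4,6) xy abcd by auto
      moreover have "z = c" using calculation(3,6,7) xy abcd by auto
      moreover have "y = b" using calculation(2,5,8) xy abcd by auto
      moreover have "x = a" using calculation(1,9) xy abcd by auto
      ultimately have "x = a" "y = b" "z = c" "w = d" by auto
      then show ?thesis using xy UV by blast
    qed
    show ?thesis
    proof (cases "crossing M' N'")
      case True then show ?thesis using *[of M' N'] dis by auto
    next
      case False then show ?thesis using *[of N' M'] cr dis by auto
    qed
  qed
  then have "convex hull (?P ` {a,c}) \<inter> convex hull (?P ` {b,d}) \<noteq> {}"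
    using MN(3) unfolding im by (auto simp: doubleton_eq_iff)
  moreover have "convex hull (?P ` {a,c}) \<subseteq> convex hull (?P ` X)"
    "convex hull (?P ` {b,d}) \<subseteq> convex hull (?P ` Y)"
    using abcd by (auto intro!: hull_mono)
  ultimately show ?thesis by blast
qed

lemma NC_eq: "NC m = {\<sigma>. partition_on {1..m} \<sigma> \<and> noncrossing \<sigma>}"
proof -
  have "disjoint_family_on (\<lambda>B. convex hull (circle_point m ` B)) \<sigma> \<longleftrightarrow> noncrossing \<sigma>"
    if \<sigma>: "partition_on {1..m} \<sigma>" for \<sigma>
  proof -
    have sub: "B \<subseteq> {1..m}" if "B \<in> \<sigma>" for B using \<sigma> that unfolding partition_on_def by blast
    have dis: "B \<inter> C = {}" if "B \<in> \<sigma>" "C \<in> \<sigma>" "B \<noteq> C" for B C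
      using \<sigma> that unfolding partition_on_def disjoint_def by blast
    show ?thesis
      unfolding disjoint_family_on_def noncrossing_def
      using disjoint_hulls[OF sub sub dis] crossing_hulls_meet[OF sub sub] by metis
  qed
  then show ?thesis unfolding NC_def by auto
qed

section \<open>Permutations and transpositions\<close>

abbreviation swap :: "'a \<Rightarrow> 'a \<Rightarrow> 'a \<Rightarrow> 'a" where
  "swap \<equiv> Transposition.transpose"

section \<open>The effect of a transposition on the cycles of a permutation\<close>

lemma orbit_eq_of_mem:
  assumes "permutation f" "j \<in> orbit f i"
  shows "orbit f j = orbit f i"
  using orbit_cyclic_eq3[OF cyclic_on_orbit'[OF assms(1)] assms(2)] .

lemma orbit_disjoint:
  assumes "permutation f" "orbit f i \<noteq> orbit f j"
  shows "orbit f i \<inter> orbit f j = {}"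
  using orbit_eq_of_mem[OF assms(1)] assms(2) by (metis disjoint_iff)

lemma orbit_subset_orbit:
  assumes "permutation g" "\<And>i. f i \<in> orbit g i"
  shows "orbit f i \<subseteq> orbit g i"
proof
  fix j assume "j \<in> orbit f i"
  then show "j \<in> orbit g i"
    by induct (auto intro: assms(2) orbit_trans)
qed

lemma permutation_comp_transpose:
  "permutation f \<Longrightarrow> permutation (f \<circ> swap a b)"
  by (simp add: permutation_compose permutation_swap_id)

lemma comp_transpose_twice: "f \<circ> swap a b \<circ> swap a b = f"
  by (simp add: comp_assoc)

text \<open>As \<open>a\<close> and \<open>b\<close> share a cycle of \<open>f\<close>, the
  transposition maps every cycle of \<open>f\<close> to itself, so cycles can only be cut.\<close>

lemma orbit_split_subset:
  assumes f: "permutation f" and b: "b \<in> orbit f a"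
  shows "orbit (f \<circ> swap a b) i \<subseteq> orbit f i"
proof (rule orbit_subset_orbit[OF f])
  fix j
  have "orbit f b = orbit f a" using orbit_eq_of_mem[OF f b] .
  then have "orbit f (swap a b j) = orbit f j"
    by (cases "j = a"; cases "j = b") auto
  then show "(f \<circ> swap a b) j \<in> orbit f j" by (metis comp_apply orbit.base)
qed

text \<open>From \<open>a\<close> the new permutation jumps to \<open>f b\<close> and then follows
  the old cycle until it returns to \<open>b\<close>. The disjunction in the induction allows for
  \<open>b\<close> having been reached already.\<close>

lemma transpose_joins_orbits:
  assumes f: "permutation f" and b: "b \<notin> orbit f a"
  shows "b \<in> orbit (f \<circ> swap a b) a"
proof -
  have a: "a \<notin> orbit f b"
    using b orbit_swap permutation_self_in_orbit[OF f] by metis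
  have "b \<in> orbit (f \<circ> swap a b) a \<or> z \<in> orbit (f \<circ> swap a b) a"
    if "z \<in> orbit f b" for z
    using that
  proof induct
    case base
    have "(f \<circ> swap a b) a = f b" by simp
    then show ?case by (metis orbit.base)
  next
    case (step z)
    show ?case
    proof (cases "z = b")
      case False
      moreover have "z \<noteq> a" using step a by auto
      ultimately have "(f \<circ> swap a b) z = f z" by simp
      then show ?thesis using step by (metis orbit.step)
    qed (use step in auto)
  qed
  from this[OF permutation_self_in_orbit[OF f]] show ?thesis by simp
qed

lemma orbit_merge:
  assumes f: "permutation f" and b: "b \<notin> orbit f a"
  shows "orbit (f \<circ> swap a b) i =
    (if i \<in> orbit f a \<union> orbit f b then orbit f a \<union> orbit f b else orbit f i)"
proof -
  let ?g = "f \<circ> swap a b"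
  let ?U = "orbit f a \<union> orbit f b"
  have g: "permutation ?g" using permutation_comp_transpose[OF f] .
  have bg: "b \<in> orbit ?g a" using transpose_joins_orbits[OF f b] .
  \<comment> \<open>Multiplying by the transposition again gives back \<open>f\<close>, so the
    cutting lemma applied to \<open>?g\<close> says that the cycles of \<open>f\<close> lie inside
    those of \<open>?g\<close>.\<close>
  have sup: "orbit f j \<subseteq> orbit ?g j" for j
    using orbit_split_subset[OF g bg] unfolding comp_transpose_twice .
  have selff: "j \<in> orbit f j" for j using permutation_self_in_orbit[OF f] .
  have selfg: "j \<in> orbit ?g j" for j using permutation_self_in_orbit[OF g] .
  have fU: "f j \<in> ?U" if "j \<in> ?U" for j using that by (auto intro: orbit.step)
  have tU: "swap a b j \<in> ?U \<longleftrightarrow> j \<in> ?U" for j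
    using selff[of a] selff[of b] by (auto simp: Transposition.transpose_def)
  show ?thesis
  proof (cases "i \<in> ?U")
    case True
    have "orbit ?g i \<subseteq> ?U"
    proof
      fix j assume "j \<in> orbit ?g i"
      then show "j \<in> ?U"
      proof induct
        case base show ?case using fU[of "swap a b i"] tU[of i] True by simp
      next
        case (step y) then show ?case using fU[of "swap a b y"] tU[of y] by simp
      qed
    qed
    moreover have "orbit ?g i = orbit ?g a"
      using True sup orbit_eq_of_mem[OF g] bg by (metis UnE subsetD)
    moreover have "?U \<subseteq> orbit ?g a" using sup orbit_eq_of_mem[OF g bg] by blast
    ultimately show ?thesis using True by auto
  next
    case False
    have "orbit ?g i \<subseteq> orbit f i"
    proof
      fix j assume "j \<in> orbit ?g i"
      then show "j \<in> orbit f i"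
      proof induct
        case base
        have "i \<noteq> a" "i \<noteq> b" using False selff by auto
        then show ?case by (simp add: orbit.base)
      next
        case (step y)
        have "y \<notin> ?U" using step(2) False orbit_swap[OF selff] orbit_trans by (metis Un_iff)
        then have "y \<noteq> a" "y \<noteq> b" using selff by auto
        then show ?case using step by (simp add: orbit.step)
      qed
    qed
    then show ?thesis using False sup by auto
  qed
qed

lemma permutes_comp_transpose:
  assumes "f permutes S" "a \<in> S" "b \<in> S"
  shows "f \<circ> swap a b permutes S"
  using assms by (simp add: permutes_compose permutes_swap_id)

lemma card_orbits_merge:
  assumes S: "finite S" "f permutes S" "a \<in> S" "b \<in> S" and b: "b \<notin> orbit f a"
  shows "card (orbit f ` S) = Suc (card (orbit (f \<circ> swap a b) ` S))"
proof -
  let ?A = "orbit f a" and ?B = "orbit f b"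
  have f: "permutation f" using S by (auto simp: permutation_permutes)
  have self: "j \<in> orbit f j" for j using permutation_self_in_orbit[OF f] .
  have ne: "?A \<noteq> ?B" using b self by blast
  have mem: "orbit f i = ?A \<or> orbit f i = ?B" if "i \<in> ?A \<union> ?B" for i
    using that orbit_eq_of_mem[OF f] by blast
  have "orbit (f \<circ> swap a b) ` S = insert (?A \<union> ?B) (orbit f ` S - {?A, ?B})"
  proof
    show "orbit (f \<circ> swap a b) ` S \<subseteq> insert (?A \<union> ?B) (orbit f ` S - {?A, ?B})"
      using self by (auto simp: orbit_merge[OF f b])
    show "insert (?A \<union> ?B) (orbit f ` S - {?A, ?B}) \<subseteq> orbit (f \<circ> swap a b) ` S"
    proof
      fix C assume "C \<in> insert (?A \<union> ?B) (orbit f ` S - {?A, ?B})"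
      then consider "C = ?A \<union> ?B" | i where "i \<in> S" "C = orbit f i" "C \<noteq> ?A" "C \<noteq> ?B" by blast
      then show "C \<in> orbit (f \<circ> swap a b) ` S"
      proof cases
        case 1
        then have "C = orbit (f \<circ> swap a b) a" using self by (simp add: orbit_merge[OF f b])
        then show ?thesis using S by blast
      next
        case 2
        then have "C = orbit (f \<circ> swap a b) i" using mem by (auto simp: orbit_merge[OF f b])
        then show ?thesis using 2 by blast
      qed
    qed
  qed
  moreover have "?A \<union> ?B \<notin> orbit f ` S - {?A, ?B}"
  proof
    assume "?A \<union> ?B \<in> orbit f ` S - {?A, ?B}"
    then obtain i where i: "orbit f i = ?A \<union> ?B" "orbit f i \<noteq> ?A" by auto
    then have "orbit f i = ?B" using mem[of i] self[of i] by auto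
    then show False using i(1) orbit_disjoint[OF f ne] self[of a] by auto
  qed
  moreover have "card (orbit f ` S - {?A, ?B}) = card (orbit f ` S) - 2"
    using S ne by (simp add: card_Diff_subset)
  moreover have "card {?A, ?B} \<le> card (orbit f ` S)" using S by (intro card_mono) auto
  ultimately show ?thesis using S ne by simp
qed

text \<open>Every new cycle lies in one old cycle, and sending it there is onto.\<close>

lemma card_orbits_split:
  assumes S: "finite S" "f permutes S" "a \<in> S" "b \<in> S" and b: "b \<in> orbit f a"
  shows "card (orbit f ` S) \<le> card (orbit (f \<circ> swap a b) ` S)"
proof -
  have f: "permutation f" using S by (auto simp: permutation_permutes)
  have g: "permutation (f \<circ> swap a b)" using permutation_comp_transpose[OF f] .
  have *: "(\<Union>j\<in>orbit (f \<circ> swap a b) i. orbit f j) = orbit f i" for i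
    using orbit_split_subset[OF f b, of i] permutation_self_in_orbit[OF g, of i] orbit_eq_of_mem[OF f]
    by blast
  have "orbit f ` S = (\<lambda>C. \<Union>j\<in>C. orbit f j) ` orbit (f \<circ> swap a b) ` S"
    by (simp add: image_image *)
  then show ?thesis using S by (metis card_image_le finite_imageI)
qed

text \<open>On a cycle the inverting involutions are the
  reflections of the polygon formed by the cycle, and any two points of the cycle are exchanged by
  one of them.\<close>

lemma inverting_involution:
  assumes S: "finite S" and k: "k permutes S"
  obtains w where "w permutes S" "w \<circ> w = id" "w \<circ> k \<circ> w = inv k" "w ` {u, v} = {u, v}"
proof -
  \<comment> \<open>\<open>r\<close> chooses a base point in each cycle and \<open>r'\<close> the
    image of this base point under the reflection: \<open>u\<close> goes to \<open>v\<close> if the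
    cycle contains both, and otherwise the base point is fixed. Thus \<open>u\<close> and
    \<open>v\<close> are exchanged or both fixed.\<close>
  define r where "r z = (if u \<in> orbit k z then u else if v \<in> orbit k z then v
    else (SOME y. y \<in> orbit k z))" for z
  define r' where "r' z = (if u \<in> orbit k z \<and> v \<in> orbit k z then v else r z)" for z
  \<comment> \<open>The reflection sends the \<open>i\<close>-th successor of the base point to the
    \<open>i\<close>-th predecessor of \<open>r'\<close>. \<open>W\<close> states this without
    negative powers; the exponent is determined only modulo the cycle length, whence
    \<open>W_unique\<close>.\<close>
  define W where "W z y \<longleftrightarrow> (\<exists>i. (k ^^ i) (r z) = z \<and> (k ^^ i) y = r' z)" for z y
  have perm: "permutation k" using S k by (auto simp: permutation_permutes)
  have self: "z \<in> orbit k z" for z using permutation_self_in_orbit[OF perm] .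
  have orb: "orbit k z = {(k ^^ n) z | n. True}" for z using orbit_altdef_permutation[OF perm] .
  have eq: "orbit k y = orbit k z" if "y \<in> orbit k z" for y z using orbit_eq_of_mem[OF perm that] .
  have bij: "bij (k ^^ i)" for i using permutes_bij[OF k] by (rule bij_betw_funpow)
  have r: "r z \<in> orbit k z" for z
    unfolding r_def using self[of z] by (auto intro: someI)
  have r': "r' z \<in> orbit k z" for z unfolding r'_def using r by auto
  have r_cong: "r y = r z" "r' y = r' z" if "y \<in> orbit k z" for y z
    using eq[OF that] by (simp_all add: r_def r'_def)
  have W_orbit: "y \<in> orbit k z" if "W z y" for z y
  proof -
    from that have "r' z \<in> orbit k y" unfolding W_def orb[of y] by (metis (mono_tags, lifting) mem_Collect_eq)
    then have "orbit k y = orbit k z" using eq r' by metis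
    then show ?thesis using self by metis
  qed
  have W_ex: "\<exists>y. W z y" for z
  proof -
    have "z \<in> orbit k (r z)" using r eq self by metis
    then obtain i where "(k ^^ i) (r z) = z" unfolding orb[of "r z"] by (auto dest: sym)
    moreover obtain y where "(k ^^ i) y = r' z" using bij by (metis bij_pointE)
    ultimately show ?thesis unfolding W_def by blast
  qed
  have W_unique: "y = y'" if W2: "W z y" "W z y'" for z y y'
  proof -
    obtain i j where ij: "(k ^^ i) (r z) = z" "(k ^^ i) y = r' z"
      "(k ^^ j) (r z) = z" "(k ^^ j) y' = r' z" using W2 unfolding W_def by blast
    have "y \<in> orbit k (r z)" using W_orbit[OF W2(1)] eq[OF r] by metis
    then obtain p where p: "y = (k ^^ p) (r z)" unfolding orb[of "r z"] by auto
    have "(k ^^ j) y = (k ^^ p) ((k ^^ j) (r z))" unfolding p by (metis add.commute comp_apply funpow_add)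
    also have "\<dots> = (k ^^ p) ((k ^^ i) (r z))" using ij by simp
    also have "\<dots> = (k ^^ i) y" unfolding p by (metis add.commute comp_apply funpow_add)
    also have "\<dots> = (k ^^ j) y'" using ij by simp
    finally show ?thesis using bij[of j] by (metis bij_is_inj injD)
  qed
  define w where "w z = (THE y. W z y)" for z
  have W_w: "W z (w z)" for z unfolding w_def by (rule theI') (use W_ex W_unique in blast)
  have w_eq: "w z = y" if "W z y" for z y using W_unique[OF W_w that] .
  have ww: "w (w z) = z" for z
  proof -
    obtain i where i: "(k ^^ i) (r z) = z" "(k ^^ i) (w z) = r' z" using W_w unfolding W_def by blast
    have wz: "w z \<in> orbit k z" using W_orbit[OF W_w] .
    then have "w z \<in> orbit k (r z)" using eq[OF r] by metis
    then obtain p where p: "w z = (k ^^ p) (r z)" unfolding orb[of "r z"] by auto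
    have "(k ^^ p) z = (k ^^ p) ((k ^^ i) (r z))" using i by simp
    also have "\<dots> = (k ^^ i) (w z)" unfolding p by (metis add.commute comp_apply funpow_add)
    finally have "(k ^^ p) z = r' (w z)" using i r_cong[OF wz] by simp
    then have "W (w z) z" unfolding W_def using p r_cong[OF wz] by auto
    then show ?thesis by (rule w_eq)
  qed
  \<comment> \<open>This is the inversion of \<open>k\<close> by \<open>w\<close>, arranged so that
    no inverse of \<open>k\<close> occurs.\<close>
  have kwk: "k (w (k z)) = w z" for z
  proof -
    obtain i where i: "(k ^^ i) (r z) = z" "(k ^^ i) (w z) = r' z" using W_w unfolding W_def by blast
    have kz: "k z \<in> orbit k z" by (rule orbit.base)
    obtain y where y: "k y = w z" using permutes_bij[OF k] by (metis bij_pointE)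
    have "(k ^^ Suc i) (r (k z)) = k z" using i r_cong[OF kz] by simp
    moreover have "(k ^^ Suc i) y = r' (k z)"
      using i r_cong[OF kz] y by (metis comp_apply funpow_Suc_right)
    ultimately have "W (k z) y" unfolding W_def by blast
    then have "w (k z) = y" by (rule w_eq)
    then show ?thesis using y by simp
  qed
  have "w z = z" if "z \<notin> S" for z
  proof -
    have "k z = z" using k that by (simp add: permutes_def)
    then have "orbit k z = {z}" by (simp add: orbit_eq_singleton_iff)
    then show ?thesis using W_orbit[OF W_w, of z] by simp
  qed
  then have "w permutes S" unfolding permutes_def using ww by metis
  moreover have "w \<circ> w = id" using ww by auto
  moreover have "w \<circ> k \<circ> w = inv k"
  proof
    fix z
    have "k (w (k (w z))) = z" using kwk[of "w z"] ww by simp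
    then show "(w \<circ> k \<circ> w) z = inv k z" by (metis comp_apply permutes_inverses(2)[OF k])
  qed
  moreover have "w ` {u, v} = {u, v}"
  proof (cases "v \<in> orbit k u")
    case True
    then have "W u v" unfolding W_def using self by (intro exI[of _ 0]) (auto simp: r_def r'_def)
    then have "w u = v" by (rule w_eq)
    then show ?thesis using ww by auto
  next
    case False
    then have "u \<notin> orbit k v" using eq self by metis
    then have "W v v" unfolding W_def using self by (intro exI[of _ 0]) (auto simp: r_def r'_def)
    moreover have "W u u" unfolding W_def using self False
      by (intro exI[of _ 0]) (auto simp: r_def r'_def)
    ultimately show ?thesis using w_eq by simp
  qed
  ultimately show thesis by (rule that)
qed

section \<open>Chains as factorizations into transpositions, and their reversal\<close>

definition merge_step :: "('a \<Rightarrow> 'a) set \<Rightarrow> 'a set \<Rightarrow> 'a \<Rightarrow> 'a \<Rightarrow> ('a \<Rightarrow> 'a) \<Rightarrow> ('a \<Rightarrow> 'a) \<Rightarrow> bool" where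
  "merge_step N S u v p q \<longleftrightarrow> p \<in> N \<and> q \<in> N \<and>
    (\<exists>a\<in>S. \<exists>b\<in>S. b \<notin> orbit p a \<and> {a, b} \<noteq> {u, v} \<and> q = p \<circ> swap a b)"

text \<open>What a reflected step is known to satisfy at first: its factor is not the excluded
  transposition. Membership in \<open>N\<close> and the cutting of a cycle are recovered later by
  counting.\<close>

definition transpose_step :: "'a set \<Rightarrow> 'a \<Rightarrow> 'a \<Rightarrow> ('a \<Rightarrow> 'a) \<Rightarrow> ('a \<Rightarrow> 'a) \<Rightarrow> bool" where
  "transpose_step S u v p q \<longleftrightarrow>
    (\<exists>a\<in>S. \<exists>b\<in>S. {a, b} \<noteq> {u, v} \<and> q = p \<circ> swap a b)"

lemma transpose_step_permutes:
  "transpose_step S u v p q \<Longrightarrow> p permutes S \<Longrightarrow> q permutes S"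
  unfolding transpose_step_def using permutes_comp_transpose by metis

text \<open>\<open>p\<close> arises from \<open>q\<close> by the same transposition, which either
  joins two cycles of \<open>q\<close>, losing exactly one, or does not lower the number of
  cycles.\<close>

lemma card_orbits_transpose_step:
  assumes "finite S" "p permutes S" "transpose_step S u v p q"
  shows "card (orbit q ` S) \<le> Suc (card (orbit p ` S))"
proof -
  obtain a b where ab: "a \<in> S" "b \<in> S" "q = p \<circ> swap a b"
    using assms(3) unfolding transpose_step_def by blast
  then have q: "q permutes S" and p: "p = q \<circ> swap a b"
    using permutes_comp_transpose assms(2) by (auto simp: comp_assoc)
  show ?thesis
    using card_orbits_merge[OF assms(1) q ab(1,2)] card_orbits_split[OF assms(1) q ab(1,2)]
    unfolding p[symmetric] by linarith
qed

lemma card_orbits_transpose_steps: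
  assumes "finite S" "(transpose_step S u v ^^ n) p q" "p permutes S"
  shows "q permutes S \<and> card (orbit q ` S) \<le> card (orbit p ` S) + n"
  using assms(2,3)
proof (induction n arbitrary: q)
  case (Suc n)
  then obtain y where y: "(transpose_step S u v ^^ n) p y" "transpose_step S u v y q" by auto
  with Suc show ?case
    using transpose_step_permutes[OF y(2)] card_orbits_transpose_step[OF assms(1) _ y(2)]
    by fastforce
qed auto

text \<open>The number of cycles is a rank function: it fixes the length of every chain between two
  given permutations.\<close>

lemma card_orbits_merge_steps:
  assumes S: "finite S" and N: "\<forall>p\<in>N. p permutes S"
    and "(merge_step N S u v ^^ n) p q"
  shows "card (orbit p ` S) = card (orbit q ` S) + n"
  using assms(3)
proof (induction n arbitrary: q)
  case (Suc n)
  then obtain y where y: "(merge_step N S u v ^^ n) p y" "merge_step N S u v y q" by auto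
  then obtain a b where "y \<in> N" "a \<in> S" "b \<in> S" "b \<notin> orbit y a" "q = y \<circ> swap a b"
    unfolding merge_step_def by blast
  then have "card (orbit y ` S) = Suc (card (orbit q ` S))"
    using card_orbits_merge[OF S] N by blast
  then show ?case using Suc.IH[OF y(1)] by simp
qed auto

lemma merge_steps_mem:
  "(merge_step N S u v)\<^sup>*\<^sup>* p q \<Longrightarrow> q \<in> N \<Longrightarrow> p \<in> N"
  by (induction rule: converse_rtranclp_induct) (auto simp: merge_step_def)

text \<open>Each step gains at most one cycle. If \<open>n\<close> steps gain \<open>n\<close>
  cycles, every one of them cuts a cycle, so \<open>split\<close> keeps it inside \<open>N\<close>,
  and read from \<open>p\<close> back to \<open>q\<close> it is a merge.\<close>

lemma transpose_steps_imp_merge_steps: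
  assumes S: "finite S" and N: "\<forall>p\<in>N. p permutes S"
    and split: "\<forall>q\<in>N. \<forall>a\<in>S. \<forall>b\<in>S.
      b \<notin> orbit (q \<circ> swap a b) a \<longrightarrow> q \<circ> swap a b \<in> N"
    and "(transpose_step S u v ^^ n) q p" "q \<in> N"
    and "card (orbit p ` S) = card (orbit q ` S) + n"
  shows "(merge_step N S u v)\<^sup>*\<^sup>* p q"
  using assms(4-6)
proof (induction n arbitrary: q)
  case (Suc n)
  obtain y where y: "transpose_step S u v q y" "(transpose_step S u v ^^ n) y p"
    using relpowp_Suc_D2[OF Suc.prems(1)] by blast
  obtain a b where ab: "a \<in> S" "b \<in> S" "{a, b} \<noteq> {u, v}" "y = q \<circ> swap a b"
    using y(1) unfolding transpose_step_def by blast
  have q: "q permutes S" using N Suc.prems(2) by blast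
  have yS: "y permutes S" using transpose_step_permutes[OF y(1) q] .
  have card: "card (orbit y ` S) = Suc (card (orbit q ` S))" "card (orbit p ` S) = card (orbit y ` S) + n"
    using card_orbits_transpose_steps[OF S y(2) yS] card_orbits_transpose_step[OF S q y(1)]
      Suc.prems(3) by auto
  have qy: "q = y \<circ> swap a b" unfolding ab by (simp add: comp_assoc)
  have "b \<notin> orbit y a"
    using card_orbits_split[OF S yS ab(1,2)] card(1) unfolding qy[symmetric] by auto
  moreover from this have yN: "y \<in> N" using split Suc.prems(2) ab by blast
  ultimately have "merge_step N S u v y q"
    unfolding merge_step_def using ab qy Suc.prems(2) by blast
  moreover have "(merge_step N S u v)\<^sup>*\<^sup>* p y" using Suc.IH[OF y(2) yN card(2)] .
  ultimately show ?case by simp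
qed auto

text \<open>For permutations \<open>\<sigma> \<le> \<tau>\<close>, let \<open>w\<close> be an involution that preserves \<open>{u, v}\<close> and inverts
  \<open>\<sigma>\<inverse> \<tau>\<close>. If \<open>x = \<sigma> t\<^sub>1 \<dots> t\<^sub>i\<close>, then \<open>\<tau> w \<sigma>\<inverse> x w\<close> is the product of \<open>\<tau>\<close> and the
  conjugated transpositions \<open>w t\<^sub>j w\<close>; so this map turns a chain from \<open>\<sigma>\<close> to \<open>\<tau>\<close> into a
  chain from \<open>\<tau>\<close> down to \<open>\<sigma>\<close>.\<close>

lemma merge_step_interval_dual:
  fixes u v :: 'a
  assumes S: "finite S" and N: "\<forall>p\<in>N. p permutes S"
    and split: "\<forall>q\<in>N. \<forall>a\<in>S. \<forall>b\<in>S.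
      b \<notin> orbit (q \<circ> swap a b) a \<longrightarrow> q \<circ> swap a b \<in> N"
    and st: "s \<in> N" "t \<in> N"
  defines "le \<equiv> (merge_step N S u v)\<^sup>*\<^sup>*"
  obtains f where
    "\<And>x. f (f x) = x"
    "\<And>x y. le s x \<Longrightarrow> le x y \<Longrightarrow> le y t \<Longrightarrow> le s (f y) \<and> le (f y) (f x) \<and> le (f x) t"
proof -
  have sS: "s permutes S" and tS: "t permutes S" using N st by auto
  define k where "k = inv s \<circ> t"
  have kS: "k permutes S" unfolding k_def using sS tS by (simp add: permutes_compose permutes_inv)
  obtain w where w: "w permutes S" "w \<circ> w = id" "w \<circ> k \<circ> w = inv k" "w ` {u, v} = {u, v}"
    using inverting_involution[OF S kS] by blast
  have ww: "w (w z) = z" for z using w(2) by (metis comp_apply id_apply)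
  have sk: "s \<circ> k = t" unfolding k_def using permutes_inv_o(1)[OF sS] by (metis comp_assoc id_comp)
  define f where "f x = t \<circ> w \<circ> inv s \<circ> x \<circ> w" for x
  have ff: "f (f x) = x" for x
  proof -
    have "f (f x) = t \<circ> (w \<circ> k \<circ> w) \<circ> inv s \<circ> x \<circ> (w \<circ> w)"
      unfolding f_def k_def by (simp add: comp_assoc)
    also have "\<dots> = s \<circ> (k \<circ> inv k) \<circ> inv s \<circ> x" unfolding w(2,3) sk[symmetric] by (simp add: comp_assoc)
    also have "\<dots> = x" using permutes_inv_o(1)[OF kS] permutes_inv_o(1)[OF sS] by simp
    finally show ?thesis .
  qed
  have fs: "f s = t"
    unfolding f_def using permutes_inv_o(2)[OF sS] w(2) by (metis comp_assoc comp_id)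
  have ft: "f t = s" using ff[of s] fs by simp
  have step: "transpose_step S u v (f x) (f y)" if xy: "merge_step N S u v x y" for x y
  proof -
    obtain a b where ab: "a \<in> S" "b \<in> S" "{a, b} \<noteq> {u, v}" "y = x \<circ> swap a b"
      using xy unfolding merge_step_def by blast
    have tw: "swap a b \<circ> w = w \<circ> swap (w a) (w b)"
      using permutes_bij[OF w(1)] ww by (auto simp: fun_eq_iff Transposition.transpose_def)
    have "f y = f x \<circ> swap (w a) (w b)"
      unfolding f_def ab(4) by (simp add: comp_assoc tw)
    moreover have "w a \<in> S" "w b \<in> S" using ab w(1) by (auto simp: permutes_in_image)
    \<comment> \<open>Here the choice of \<open>w\<close> pays off: conjugation by \<open>w\<close>
      fixes the excluded transposition, so it cannot turn another one into it.\<close>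
    moreover have "{w a, w b} \<noteq> {u, v}"
    proof
      assume "{w a, w b} = {u, v}"
      then have "w ` w ` {a, b} = w ` {u, v}" by simp
      then have "{a, b} = {u, v}" using w(4) by (simp add: ww)
      then show False using ab(3) by simp
    qed
    ultimately show ?thesis unfolding transpose_step_def by blast
  qed
  have steps: "(transpose_step S u v ^^ n) (f x) (f y)" if "(merge_step N S u v ^^ n) x y" for n x y
    using that by (induction n arbitrary: y) (auto dest: step)
  have "le s (f y) \<and> le (f y) (f x) \<and> le (f x) t" if le: "le s x" "le x y" "le y t" for x y
  proof -
    obtain i j l where ijl: "(merge_step N S u v ^^ i) s x" "(merge_step N S u v ^^ j) x y"
      "(merge_step N S u v ^^ l) y t" using le unfolding le_def by (metis rtranclp_imp_relpowp)
    have c: "card (orbit s ` S) = card (orbit t ` S) + i + j + l"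
      using card_orbits_merge_steps[OF S N ijl(1)] card_orbits_merge_steps[OF S N ijl(2)]
        card_orbits_merge_steps[OF S N ijl(3)] by linarith
    have ch: "(transpose_step S u v ^^ i) t (f x)" "(transpose_step S u v ^^ j) (f x) (f y)"
      "(transpose_step S u v ^^ l) (f y) s" using ijl[THEN steps] fs ft by auto
    note b1 = card_orbits_transpose_steps[OF S ch(1) tS]
    note b2 = card_orbits_transpose_steps[OF S ch(2) conjunct1[OF b1]]
    note b3 = card_orbits_transpose_steps[OF S ch(3) conjunct1[OF b2]]
    note M = transpose_steps_imp_merge_steps[OF S N split]
    \<comment> \<open>The gain on each piece of the reflected chain is at most its length, and by
      \<open>c\<close> the total gain from \<open>t\<close> to \<open>s\<close> equals the total
      length; so all three bounds are attained.\<close>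
    have cards: "card (orbit (f x) ` S) = card (orbit t ` S) + i"
      "card (orbit (f y) ` S) = card (orbit (f x) ` S) + j"
      "card (orbit s ` S) = card (orbit (f y) ` S) + l"
      using c conjunct2[OF b1] conjunct2[OF b2] conjunct2[OF b3] by linarith+
    have 1: "le (f x) t" unfolding le_def by (rule M[OF ch(1) \<open>t \<in> N\<close> cards(1)])
    then have fx: "f x \<in> N" unfolding le_def by (rule merge_steps_mem) fact
    have 2: "le (f y) (f x)" unfolding le_def by (rule M[OF ch(2) fx cards(2)])
    then have fy: "f y \<in> N" unfolding le_def by (rule merge_steps_mem) fact
    have 3: "le s (f y)" unfolding le_def by (rule M[OF ch(3) fy cards(3)])
    from 1 2 3 show ?thesis by blast
  qed
  then show thesis using that ff by blast
qed

section \<open>Partitions and merging of blocks\<close>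

text \<open>Partitions are compared and built through this partial equivalence relation. A point is
  related to itself exactly if it lies in the ground set.\<close>

definition same :: "nat set set \<Rightarrow> nat \<Rightarrow> nat \<Rightarrow> bool" where
  "same \<sigma> i j \<longleftrightarrow> (\<exists>B\<in>\<sigma>. i \<in> B \<and> j \<in> B)"

lemma same_sym: "same \<sigma> i j \<Longrightarrow> same \<sigma> j i"
  unfolding same_def by blast

lemma same_block:
  assumes "partition_on A \<sigma>" "B \<in> \<sigma>" "i \<in> B"
  shows "same \<sigma> i j \<longleftrightarrow> j \<in> B"
  using assms unfolding same_def partition_on_def disjoint_def by (metis disjoint_iff)

lemma block_unique:
  "partition_on A \<sigma> \<Longrightarrow> B \<in> \<sigma> \<Longrightarrow> C \<in> \<sigma> \<Longrightarrow> i \<in> B \<Longrightarrow> i \<in> C \<Longrightarrow> B = C"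
  unfolding partition_on_def disjoint_def by blast

lemma same_trans:
  assumes "partition_on A \<sigma>" "same \<sigma> i j" "same \<sigma> j l"
  shows "same \<sigma> i l"
  using assms same_block[OF assms(1)] unfolding same_def by blast

lemma same_refl: "partition_on A \<sigma> \<Longrightarrow> same \<sigma> i i \<longleftrightarrow> i \<in> A"
  unfolding partition_on_def same_def by blast

lemma same_mem: "partition_on A \<sigma> \<Longrightarrow> same \<sigma> i j \<Longrightarrow> i \<in> A \<and> j \<in> A"
  unfolding partition_on_def same_def by blast

lemma obtain_block:
  assumes "partition_on A \<sigma>" "i \<in> A"
  obtains B where "B \<in> \<sigma>" "i \<in> B"
  using assms unfolding partition_on_def by blast

lemma same_Collect_block: "partition_on A \<sigma> \<Longrightarrow> B \<in> \<sigma> \<Longrightarrow> i \<in> B \<Longrightarrow> {j. same \<sigma> i j} = B"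
  using same_block by blast

lemma partition_eqI:
  assumes \<sigma>: "partition_on A \<sigma>" and \<tau>: "partition_on A \<tau>"
    and eq: "\<And>i j. same \<sigma> i j \<longleftrightarrow> same \<tau> i j"
  shows "\<sigma> = \<tau>"
proof -
  have "B \<in> \<tau>'" if *: "partition_on A \<sigma>'" "partition_on A \<tau>'" "B \<in> \<sigma>'"
    "\<And>i j. same \<sigma>' i j \<longleftrightarrow> same \<tau>' i j" for B \<sigma>' \<tau>'
  proof -
    obtain i where i: "i \<in> B" using *(1,3) unfolding partition_on_def by fastforce
    then have "i \<in> A" using *(1,3) unfolding partition_on_def by blast
    then obtain C where C: "C \<in> \<tau>'" "i \<in> C" using obtain_block[OF *(2)] by blast
    have "B = C" using same_Collect_block[OF *(1,3) i] same_Collect_block[OF *(2) C] *(4) by simp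
    then show ?thesis using C by simp
  qed
  from this[OF \<sigma> \<tau> _ eq] this[OF \<tau> \<sigma> _ eq[symmetric]] show ?thesis by blast
qed

lemma refines_iff_same:
  fixes \<sigma> \<tau> :: "nat set set"
  assumes \<sigma>: "partition_on A \<sigma>" and \<tau>: "partition_on A \<tau>"
  shows "refines A \<sigma> \<tau> \<longleftrightarrow> (\<forall>i j. same \<sigma> i j \<longrightarrow> same \<tau> i j)"
proof
  assume "refines A \<sigma> \<tau>"
  then show "\<forall>i j. same \<sigma> i j \<longrightarrow> same \<tau> i j" unfolding refines_def same_def by blast
next
  assume *: "\<forall>i j. same \<sigma> i j \<longrightarrow> same \<tau> i j"
  have "\<exists>C\<in>\<tau>. B \<subseteq> C" if B: "B \<in> \<sigma>" for B
  proof -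
    obtain i where i: "i \<in> B" using \<sigma> B unfolding partition_on_def by fastforce
    then have "i \<in> A" using \<sigma> B unfolding partition_on_def by blast
    then obtain C where C: "C \<in> \<tau>" "i \<in> C" using obtain_block[OF \<tau>] by blast
    then have "B \<subseteq> C"
      using same_Collect_block[OF \<sigma> B i] same_Collect_block[OF \<tau> C] * by blast
    then show ?thesis using C by blast
  qed
  then show "refines A \<sigma> \<tau>" unfolding refines_def using \<sigma> \<tau> by blast
qed

lemma noncrossing_iff_same:
  assumes \<sigma>: "partition_on A \<sigma>"
  shows "noncrossing \<sigma> \<longleftrightarrow> (\<forall>a b c d. a < b \<longrightarrow> b < c \<longrightarrow> c < d \<longrightarrow> same \<sigma> a c \<longrightarrow> same \<sigma> b d
    \<longrightarrow> same \<sigma> a b)"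
proof
  assume nc: "noncrossing \<sigma>"
  show "\<forall>a b c d. a < b \<longrightarrow> b < c \<longrightarrow> c < d \<longrightarrow> same \<sigma> a c \<longrightarrow> same \<sigma> b d \<longrightarrow> same \<sigma> a b"
  proof (intro allI impI)
    fix a b c d assume *: "a < b" "b < c" "c < d" "same \<sigma> a c" "same \<sigma> b d"
    then obtain B C where BC: "B \<in> \<sigma>" "a \<in> B" "c \<in> B" "C \<in> \<sigma>" "b \<in> C" "d \<in> C"
      unfolding same_def by blast
    then have "crossing B C" using * unfolding crossing_def by blast
    then have "B = C" using nc BC unfolding noncrossing_def by blast
    then show "same \<sigma> a b" using BC unfolding same_def by blast
  qed
next
  assume *: "\<forall>a b c d. a < b \<longrightarrow> b < c \<longrightarrow> c < d \<longrightarrow> same \<sigma> a c \<longrightarrow> same \<sigma> b d \<longrightarrow> same \<sigma> a b"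
  show "noncrossing \<sigma>"
    unfolding noncrossing_def
  proof (intro ballI impI notI)
    fix B C assume BC: "B \<in> \<sigma>" "C \<in> \<sigma>" "B \<noteq> C" and "crossing B C"
    then obtain a b c d where abcd: "a \<in> B" "c \<in> B" "b \<in> C" "d \<in> C" "a < b" "b < c" "c < d"
      unfolding crossing_def by blast
    then have "same \<sigma> a c" "same \<sigma> b d" using BC unfolding same_def by blast+
    then have "same \<sigma> a b" using * abcd by blast
    then have "b \<in> B" using same_block[OF \<sigma> BC(1) abcd(1)] by simp
    then show False using BC abcd \<sigma> unfolding partition_on_def disjoint_def by blast
  qed
qed

definition rel_classes :: "nat set \<Rightarrow> (nat \<Rightarrow> nat \<Rightarrow> bool) \<Rightarrow> nat set set" where
  "rel_classes A E = (\<lambda>i. {j. E i j}) ` A"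

lemma
  assumes mem: "\<And>i j. E i j \<Longrightarrow> i \<in> A \<and> j \<in> A" and refl: "\<And>i. i \<in> A \<Longrightarrow> E i i"
    and sym: "\<And>i j. E i j \<Longrightarrow> E j i" and trans: "\<And>i j l. E i j \<Longrightarrow> E j l \<Longrightarrow> E i l"
  shows partition_rel_classes: "partition_on A (rel_classes A E)"
    and same_rel_classes: "same (rel_classes A E) i j \<longleftrightarrow> E i j"
proof -
  show "partition_on A (rel_classes A E)"
  proof (rule partition_onI)
    show "\<Union>(rel_classes A E) = A" using mem refl unfolding rel_classes_def by blast
    show "{} \<notin> rel_classes A E" using refl unfolding rel_classes_def by blast
  next
    fix p q assume *: "p \<in> rel_classes A E" "q \<in> rel_classes A E" "p \<noteq> q"
    then obtain i j where ij: "p = {l. E i l}" "q = {l. E j l}" unfolding rel_classes_def by blast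
    show "disjnt p q"
    proof (rule ccontr)
      assume "\<not> disjnt p q"
      then obtain l where "E i l" "E j l" unfolding disjnt_def ij by blast
      then have "E i j" using sym trans by blast
      then have "p = q" unfolding ij using sym trans by blast
      then show False using * by blast
    qed
  qed
  show "same (rel_classes A E) i j \<longleftrightarrow> E i j"
  proof
    assume "same (rel_classes A E) i j"
    then show "E i j" unfolding same_def rel_classes_def using sym trans by blast
  next
    assume *: "E i j"
    then have "i \<in> A" "E i i" using mem refl by blast+
    then show "same (rel_classes A E) i j" unfolding same_def rel_classes_def using * by blast
  qed
qed

section \<open>Merging two blocks, and the label of a merge\<close>

definition merges :: "nat set \<Rightarrow> nat set \<Rightarrow> nat set set \<Rightarrow> nat set set \<Rightarrow> bool" where
  "merges B1 B2 \<sigma> \<tau> \<longleftrightarrow> B1 \<in> \<sigma> \<and> B2 \<in> \<sigma> \<and> B1 \<noteq> B2 \<and> Min (B1 \<union> B2) \<in> B1 \<and>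
    \<tau> = insert (B1 \<union> B2) (\<sigma> - {B1, B2})"

locale merging =
  fixes m :: nat and B1 B2 :: "nat set" and \<sigma> \<tau> :: "nat set set"
  assumes part: "partition_on {1..m} \<sigma>" and merges: "merges B1 B2 \<sigma> \<tau>"
begin

lemma blocks: "B1 \<in> \<sigma>" "B2 \<in> \<sigma>" "B1 \<noteq> B2" "\<tau> = insert (B1 \<union> B2) (\<sigma> - {B1, B2})"
  using merges unfolding merges_def by auto

lemma sub: "B1 \<subseteq> {1..m}" "B2 \<subseteq> {1..m}"
  using part blocks unfolding partition_on_def by blast+

lemma fin: "finite B1" "finite B2"
  using sub finite_subset by blast+

lemma ne: "B1 \<noteq> {}" "B2 \<noteq> {}"
  using part blocks unfolding partition_on_def by blast+

lemma dis: "B1 \<inter> B2 = {}"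
  using part blocks unfolding partition_on_def disjoint_def by blast

lemma union_notin: "B1 \<union> B2 \<notin> \<sigma>"
proof
  assume "B1 \<union> B2 \<in> \<sigma>"
  moreover have "B1 \<union> B2 \<noteq> B1" "B1 \<union> B2 \<noteq> B2" using ne dis by auto
  ultimately show False using block_unique[OF part blocks(1)] ne(1) by blast
qed

lemma part': "partition_on {1..m} \<tau>"
proof (rule partition_onI)
  have "\<Union>\<sigma> = {1..m}" using part unfolding partition_on_def by blast
  then show "\<Union>\<tau> = {1..m}" using blocks by blast
  show "{} \<notin> \<tau>" using part ne unfolding blocks(4) partition_on_def by blast
  show "disjnt p q" if pq: "p \<in> \<tau>" "q \<in> \<tau>" "p \<noteq> q" for p q
  proof -
    have d: "X \<inter> Y = {}" if "X \<in> \<sigma>" "Y \<in> \<sigma>" "X \<noteq> Y" for X Y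
      using part that unfolding partition_on_def disjoint_def by blast
    then have "(B1 \<union> B2) \<inter> Y = {}" if "Y \<in> \<sigma> - {B1, B2}" for Y using that blocks by blast
    then show ?thesis using pq d unfolding blocks(4) disjnt_def by blast
  qed
qed

lemma same_iff: "same \<tau> i j \<longleftrightarrow> same \<sigma> i j \<or> (i \<in> B1 \<union> B2 \<and> j \<in> B1 \<union> B2)"
proof
  assume "same \<tau> i j"
  then obtain B where B: "B \<in> \<tau>" "i \<in> B" "j \<in> B" unfolding same_def by blast
  then have "B = B1 \<union> B2 \<or> B \<in> \<sigma>" unfolding blocks(4) by auto
  then show "same \<sigma> i j \<or> (i \<in> B1 \<union> B2 \<and> j \<in> B1 \<union> B2)"
    using B(2,3) unfolding same_def by metis
next
  assume *: "same \<sigma> i j \<or> (i \<in> B1 \<union> B2 \<and> j \<in> B1 \<union> B2)"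
  have u: "B1 \<union> B2 \<in> \<tau>" unfolding blocks(4) by simp
  show "same \<tau> i j"
  proof (cases "i \<in> B1 \<union> B2 \<and> j \<in> B1 \<union> B2")
    case True then show ?thesis using u unfolding same_def by metis
  next
    case False
    then obtain B where B: "B \<in> \<sigma>" "i \<in> B" "j \<in> B" using * unfolding same_def by metis
    then have "B \<noteq> B1" "B \<noteq> B2" using False by auto
    then have "B \<in> \<tau>" using B unfolding blocks(4) by simp
    then show ?thesis using B unfolding same_def by metis
  qed
qed

lemma fin_part: "finite \<sigma>" "finite \<tau>"
  using finite_elements[OF _ part] finite_elements[OF _ part'] by auto

lemma card_eq: "card \<sigma> = Suc (card \<tau>)"
proof -
  have "card \<tau> = Suc (card (\<sigma> - {B1, B2}))"
    unfolding blocks(4) using fin_part union_notin by simp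
  also have "card (\<sigma> - {B1, B2}) = card \<sigma> - 2"
    using blocks fin_part by (simp add: card_Diff_subset)
  finally have "card \<tau> = Suc (card \<sigma> - 2)" .
  moreover have "card {B1, B2} \<le> card \<sigma>" using blocks fin_part by (intro card_mono) auto
  ultimately show ?thesis using blocks by simp
qed

lemma refines: "refines {1..m} \<sigma> \<tau>"
  using refines_iff_same[OF part part'] same_iff by blast

lemma Min_less: "y \<in> B2 \<Longrightarrow> Min B1 < y"
proof -
  assume y: "y \<in> B2"
  have "Min (B1 \<union> B2) \<in> B1" using merges unfolding merges_def by blast
  then have "Min B1 \<le> Min (B1 \<union> B2)" using fin by auto
  moreover have "Min (B1 \<union> B2) \<le> y" using y fin by auto
  moreover have "Min B1 \<noteq> y" using y dis Min_in[OF fin(1) ne(1)] by auto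
  ultimately show ?thesis by linarith
qed

definition lab where "lab = Max {x\<in>B1. \<forall>y\<in>B2. x < y}"

lemma lab: "lab \<in> B1" "y \<in> B2 \<Longrightarrow> lab < y" "x \<in> B1 \<Longrightarrow> \<forall>y\<in>B2. x < y \<Longrightarrow> x \<le> lab"
proof -
  let ?L = "{x\<in>B1. \<forall>y\<in>B2. x < y}"
  have f: "finite ?L" using fin by simp
  have "Min B1 \<in> ?L" using Min_less Min_in[OF fin(1) ne(1)] by auto
  then have "Max ?L \<in> ?L" using f Max_in by blast
  then show "lab \<in> B1" "y \<in> B2 \<Longrightarrow> lab < y" unfolding lab_def by auto
  show "x \<in> B1 \<Longrightarrow> \<forall>y\<in>B2. x < y \<Longrightarrow> x \<le> lab" unfolding lab_def using f by auto
qed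

text \<open>The definite description is well defined: the two merged blocks are recovered as
  \<open>\<sigma> - \<tau>\<close>, and their minima tell which of them is
  \<open>B1\<close>.\<close>

lemma cover_label_eq: "cover_label \<sigma> \<tau> = lab"
  unfolding cover_label_def
proof (rule the_equality)
  show "\<exists>B1\<in>\<sigma>. \<exists>B2\<in>\<sigma>. B1 \<noteq> B2 \<and> \<tau> = insert (B1 \<union> B2) (\<sigma> - {B1, B2}) \<and>
     Min (B1 \<union> B2) \<in> B1 \<and> lab = Max {x\<in>B1. \<forall>y\<in>B2. x < y}"
    using merges unfolding merges_def lab_def by blast
next
  fix l assume "\<exists>C1\<in>\<sigma>. \<exists>C2\<in>\<sigma>. C1 \<noteq> C2 \<and> \<tau> = insert (C1 \<union> C2) (\<sigma> - {C1, C2}) \<and>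
     Min (C1 \<union> C2) \<in> C1 \<and> l = Max {x\<in>C1. \<forall>y\<in>C2. x < y}"
  then obtain C1 C2 where C: "merges C1 C2 \<sigma> \<tau>" "l = Max {x\<in>C1. \<forall>y\<in>C2. x < y}"
    unfolding merges_def by blast
  interpret C: merging m C1 C2 \<sigma> \<tau> using part C by unfold_locales
  have "\<sigma> - \<tau> = {B1, B2}" unfolding blocks(4) using union_notin blocks(1,2) by auto
  moreover have "\<sigma> - \<tau> = {C1, C2}" unfolding C.blocks(4) using C.union_notin C.blocks(1,2) by auto
  ultimately have "{B1, B2} = {C1, C2}" by simp
  moreover have "B1 \<noteq> C2"
  proof
    assume "B1 = C2"
    then have "B2 = C1" using calculation by (metis doubleton_eq_iff)
    moreover have "Min B1 < Min B2" by (rule Min_less[OF Min_in[OF fin(2) ne(2)]])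
    moreover have "Min C1 < Min C2" by (rule C.Min_less[OF Min_in[OF C.fin(2) C.ne(2)]])
    ultimately show False using \<open>B1 = C2\<close> by simp
  qed
  ultimately have "C1 = B1" "C2 = B2" by (metis doubleton_eq_iff)+
  then show "l = lab" unfolding C(2) lab_def by simp
qed

end

lemma merges_ex:
  assumes \<sigma>: "partition_on {1..m} \<sigma>" and B: "B \<in> \<sigma>" "C \<in> \<sigma>" "B \<noteq> C"
  shows "merges B C \<sigma> (insert (B \<union> C) (\<sigma> - {B, C})) \<or> merges C B \<sigma> (insert (B \<union> C) (\<sigma> - {B, C}))"
proof -
  have "finite B" "finite C" "B \<noteq> {}"
    using \<sigma> B unfolding partition_on_def by (metis Union_upper finite_atLeastAtMost finite_subset)+
  then have "Min (B \<union> C) \<in> B \<union> C" by (intro Min_in) auto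
  then show ?thesis using B unfolding merges_def by (auto simp: Un_commute insert_commute)
qed

section \<open>Counting blocks by their least elements\<close>

definition mins :: "nat set set \<Rightarrow> nat set" where
  "mins \<sigma> = {i. same \<sigma> i i \<and> (\<forall>j. same \<sigma> i j \<longrightarrow> i \<le> j)}"

lemma card_mins:
  assumes \<sigma>: "partition_on {1..m} \<sigma>"
  shows "card (mins \<sigma>) = card \<sigma>"
proof -
  have B: "finite B \<and> B \<noteq> {}" if "B \<in> \<sigma>" for B
    using \<sigma> that unfolding partition_on_def by (metis Union_upper finite_atLeastAtMost finite_subset)
  have "bij_betw Min \<sigma> (mins \<sigma>)"
    unfolding bij_betw_def
  proof
    show "inj_on Min \<sigma>"
    proof (rule inj_onI)
      fix B C assume BC: "B \<in> \<sigma>" "C \<in> \<sigma>" "Min B = Min C"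
      then have "Min B \<in> B \<inter> C" using B by (metis IntI Min_in)
      then show "B = C" using BC \<sigma> unfolding partition_on_def disjoint_def by blast
    qed
    show "Min ` \<sigma> = mins \<sigma>"
    proof
      show "Min ` \<sigma> \<subseteq> mins \<sigma>"
      proof
        fix i assume "i \<in> Min ` \<sigma>"
        then obtain C where C: "C \<in> \<sigma>" "i = Min C" by blast
        then have "i \<in> C" using B by auto
        then show "i \<in> mins \<sigma>" unfolding mins_def using same_block[OF \<sigma> C(1)] C B by auto
      qed
      show "mins \<sigma> \<subseteq> Min ` \<sigma>"
      proof
        fix i assume i: "i \<in> mins \<sigma>"
        then obtain C where C: "C \<in> \<sigma>" "i \<in> C" unfolding mins_def same_def by blast
        then have "Min C = i"
          using i same_block[OF \<sigma> C] B[OF C(1)] unfolding mins_def by (intro Min_eqI) auto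
        then show "i \<in> Min ` \<sigma>" using C by blast
      qed
    qed
  qed
  then show ?thesis by (simp add: bij_betw_same_card)
qed

lemma finite_mins: "partition_on {1..m} \<sigma> \<Longrightarrow> finite (mins \<sigma>)"
  unfolding mins_def by (rule finite_subset[of _ "{1..m}"]) (auto simp: same_refl)

lemma mins_ex:
  assumes \<sigma>: "partition_on {1..m} \<sigma>" and i: "i \<in> {1..m}"
  obtains j where "j \<in> mins \<sigma>" "same \<sigma> i j"
proof -
  define j where "j = (LEAST j. same \<sigma> i j)"
  have j: "same \<sigma> i j" unfolding j_def using same_refl[OF \<sigma>] i by (intro LeastI) auto
  have "j \<le> l" if "same \<sigma> j l" for l unfolding j_def using same_trans[OF \<sigma> j that] by (rule Least_le)
  then have "j \<in> mins \<sigma>" unfolding mins_def using j same_sym same_trans[OF \<sigma>] by blast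
  then show thesis using that j by blast
qed

text \<open>Coarsening can only remove least elements. With equally many blocks none is removed, so
  two least elements of \<sigma> that \<tau> joins must coincide.\<close>

lemma refines_card_eq:
  fixes \<sigma> \<tau> :: "nat set set"
  assumes r: "refines {1..m} \<sigma> \<tau>" and c: "card \<sigma> \<le> card \<tau>"
  shows "\<sigma> = \<tau>"
proof -
  have \<sigma>: "partition_on {1..m} \<sigma>" and \<tau>: "partition_on {1..m} \<tau>" using r unfolding refines_def by auto
  have le: "same \<sigma> i j \<Longrightarrow> same \<tau> i j" for i j using r refines_iff_same[OF \<sigma> \<tau>] by blast
  have "mins \<tau> \<subseteq> mins \<sigma>"
    unfolding mins_def using le same_refl[OF \<sigma>] same_refl[OF \<tau>] by blast
  then have eq: "mins \<tau> = mins \<sigma>"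
    using c card_mins[OF \<sigma>] card_mins[OF \<tau>] finite_mins[OF \<sigma>] card_seteq by metis
  show ?thesis
  proof (rule partition_eqI[OF \<sigma> \<tau>])
    fix i j
    show "same \<sigma> i j \<longleftrightarrow> same \<tau> i j"
    proof
      assume ij: "same \<tau> i j"
      obtain i' j' where i': "i' \<in> mins \<sigma>" "same \<sigma> i i'" and j': "j' \<in> mins \<sigma>" "same \<sigma> j j'"
        using mins_ex[OF \<sigma>] same_mem[OF \<tau> ij] by metis
      have "same \<tau> i' j'" using i' j' ij le same_sym same_trans[OF \<tau>] by meson
      moreover from this have "same \<tau> j' i'" by (rule same_sym)
      moreover have "i' \<in> mins \<tau>" "j' \<in> mins \<tau>" using i'(1) j'(1) eq by auto
      ultimately have "i' = j'" unfolding mins_def by (auto intro: antisym)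
      then show "same \<sigma> i j" using i' j' same_sym same_trans[OF \<sigma>] by metis
    qed (rule le)
  qed
qed

lemma refines_card_less:
  fixes \<sigma> \<tau> :: "nat set set"
  shows "refines {1..m} \<sigma> \<tau> \<Longrightarrow> \<sigma> \<noteq> \<tau> \<Longrightarrow> card \<tau> < card \<sigma>"
  using refines_card_eq by (metis not_le)

section \<open>Merges inside a coarser noncrossing partition\<close>

lemma NC_D:
  assumes "\<sigma> \<in> NC m"
  shows "partition_on {1..m} \<sigma>"
    "\<And>a b c d. a < b \<Longrightarrow> b < c \<Longrightarrow> c < d \<Longrightarrow> same \<sigma> a c \<Longrightarrow> same \<sigma> b d \<Longrightarrow> same \<sigma> a b"
proof -
  show p: "partition_on {1..m} \<sigma>" using assms unfolding NC_eq by blast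
  show "\<And>a b c d. a < b \<Longrightarrow> b < c \<Longrightarrow> c < d \<Longrightarrow> same \<sigma> a c \<Longrightarrow> same \<sigma> b d \<Longrightarrow> same \<sigma> a b"
    using assms unfolding NC_eq noncrossing_iff_same[OF p, symmetric] using noncrossing_iff_same[OF p] by blast
qed

lemma NC_I:
  assumes p: "partition_on {1..m} \<sigma>"
    and "\<And>a b c d. a < b \<Longrightarrow> b < c \<Longrightarrow> c < d \<Longrightarrow> same \<sigma> a c \<Longrightarrow> same \<sigma> b d \<Longrightarrow> same \<sigma> a b"
  shows "\<sigma> \<in> NC m"
  unfolding NC_eq using assms noncrossing_iff_same[OF p] by blast

text \<open>Merge two blocks containing points \<open>a < b\<close> at minimal distance among all pairs that
  \<open>\<tau>\<close> joins and \<open>\<sigma>\<close> separates: no third block can separate \<open>a\<close> from \<open>b\<close>.\<close>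

lemma merge_between:
  assumes \<sigma>: "\<sigma> \<in> NC m" and \<tau>: "\<tau> \<in> NC m" and r: "refines {1..m} \<sigma> \<tau>" "\<sigma> \<noteq> \<tau>"
  obtains B1 B2 \<rho> where "merges B1 B2 \<sigma> \<rho>" "\<rho> \<in> NC m" "refines {1..m} \<rho> \<tau>"
proof -
  note ps = NC_D(1)[OF \<sigma>] and pt = NC_D(1)[OF \<tau>]
  note tr = same_trans[OF ps] and tr' = same_trans[OF pt]
  have le: "same \<sigma> i j \<Longrightarrow> same \<tau> i j" for i j using r refines_iff_same[OF ps pt] by blast
  let ?P = "\<lambda>d. \<exists>a b. a < b \<and> b - a = d \<and> same \<tau> a b \<and> \<not> same \<sigma> a b"
  obtain i j where "same \<tau> i j" "\<not> same \<sigma> i j" using partition_eqI[OF ps pt] le r(2) by blast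
  moreover then have "i \<noteq> j" using same_refl[OF ps] same_mem[OF pt] by blast
  ultimately have "\<exists>d. ?P d" by (metis linorder_neqE_nat same_sym)
  then have "?P (Least ?P)" by (rule LeastI_ex)
  then obtain a b where ab: "a < b" "same \<tau> a b" "\<not> same \<sigma> a b" "b - a = Least ?P" by blast
  have least: "b - a \<le> d - c" if "c < d" "same \<tau> c d" "\<not> same \<sigma> c d" for c d
    unfolding ab(4) using that by (intro Least_le) blast
  \<comment> \<open>Such a \<open>c\<close> would give two closer pairs that \<tau> joins; by
    minimality \<sigma> joins both, hence also \<open>a\<close> and \<open>b\<close>.\<close>
  have gap: "\<not> same \<tau> a c" if c: "a < c" "c < b" for c
  proof
    assume ac: "same \<tau> a c"
    have "same \<sigma> a c" using least[OF c(1) ac] c by linarith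
    moreover have "same \<sigma> c b" using least[OF c(2)] c ac ab(2) same_sym tr' by (metis diff_less_mono2 leD less_trans)
    ultimately show False using ab(3) tr by blast
  qed
  obtain B where B: "B \<in> \<sigma>" "a \<in> B" using obtain_block[OF ps] same_mem[OF pt ab(2)] by blast
  obtain C where C: "C \<in> \<sigma>" "b \<in> C" using obtain_block[OF ps] same_mem[OF pt ab(2)] by blast
  have "B \<noteq> C" using B C ab(3) unfolding same_def by blast
  define \<rho> where "\<rho> = insert (B \<union> C) (\<sigma> - {B, C})"
  obtain B1 B2 where BB: "merges B1 B2 \<sigma> \<rho>" "B1 \<union> B2 = B \<union> C"
    using merges_ex[OF ps B(1) C(1) \<open>B \<noteq> C\<close>] unfolding \<rho>_def by (metis Un_commute)
  interpret merging m B1 B2 \<sigma> \<rho> using ps BB by unfold_locales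
  define U where "U i \<longleftrightarrow> same \<sigma> a i \<or> same \<sigma> b i" for i
  have U: "same \<rho> i j \<longleftrightarrow> same \<sigma> i j \<or> (U i \<and> U j)" for i j
    unfolding same_iff BB(2) U_def using same_block[OF ps B] same_block[OF ps C] by blast
  have Ut: "U i \<Longrightarrow> same \<tau> a i" for i unfolding U_def using le ab(2) tr' by blast
  have Utt: "U i \<Longrightarrow> U j \<Longrightarrow> same \<tau> i j" for i j using Ut[of i] Ut[of j] tr' same_sym by metis
  have U_cong: "same \<sigma> i j \<Longrightarrow> U i \<longleftrightarrow> U j" for i j unfolding U_def using tr same_sym by blast
  have nc: "same \<sigma> p q" if "p < q" "q < r" "r < s" "same \<sigma> p r" "same \<sigma> q s" for p q r s
    using NC_D(2)[OF \<sigma>] that by blast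
  have nct: "same \<tau> p q" if "p < q" "q < r" "r < s" "same \<tau> p r" "same \<tau> q s" for p q r s
    using NC_D(2)[OF \<tau>] that by blast
  have out: "i < a \<or> b < i" if "same \<tau> a i" "\<not> U i" for i
  proof -
    have "same \<sigma> a a" "same \<sigma> b b" using same_refl[OF ps] same_mem[OF pt ab(2)] by auto
    then have "i \<noteq> a" "i \<noteq> b" using that unfolding U_def by auto
    then show ?thesis using gap[of i] that by force
  qed
  have "\<rho> \<in> NC m"
  proof (rule NC_I[OF part'])
    fix p q r s assume l: "p < q" "q < r" "r < s" and pr: "same \<rho> p r" and qs: "same \<rho> q s"
    show "same \<rho> p q"
    proof (rule ccontr)
      assume n: "\<not> same \<rho> p q"
      then have n': "\<not> same \<sigma> p q" "\<not> same \<sigma> q p" "\<not> (U p \<and> U q)" using U same_sym by blast+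
      consider "same \<sigma> p r" "same \<sigma> q s" | "U p" "U r" "same \<sigma> q s" "\<not> U q" "\<not> U s"
        | "U q" "U s" "same \<sigma> p r" "\<not> U p" "\<not> U r"
        using pr qs U U_cong n' by metis
      then show False
      proof cases
        case 1 then show ?thesis using nc l n' by blast
      next
        case 2
        \<comment> \<open>Noncrossing of \<tau> puts the other pair into the \<tau>-block of
          \<open>a\<close>, so by \<open>out\<close> it avoids the segment from \<open>a\<close> to
          \<open>b\<close>. It then crosses the block of \<open>a\<close> or the block of
          \<open>b\<close> already in \<sigma>. The third case is handled in the same way.\<close>
        have "same \<tau> p r" using Utt 2 by blast
        then have "same \<tau> p q" using nct[OF l] le 2 by blast
        then have "same \<tau> a q" "same \<tau> a s" using Ut 2 le tr' by blast+
        then have o: "q < a \<or> b < q" "s < a \<or> b < s" using out 2 by blast+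
        have N: "\<not> same \<sigma> z q" "\<not> same \<sigma> q z" "\<not> same \<sigma> z s" "\<not> same \<sigma> s z" if "U z" for z
          using that U_cong 2 by blast+
        have Uab: "U a" "U b" unfolding U_def using same_refl[OF ps] same_mem[OF pt ab(2)] by auto
        have "same \<sigma> a p \<or> same \<sigma> b p" "same \<sigma> a r \<or> same \<sigma> b r" using 2 unfolding U_def by auto
        then consider "same \<sigma> a p" "same \<sigma> a r" | "same \<sigma> b p" "same \<sigma> b r"
          | "same \<sigma> a p" "same \<sigma> b r" | "same \<sigma> b p" "same \<sigma> a r" by blast
        then show False
        proof cases
          case 11: 1 then show ?thesis using nc[OF l] 2 n' tr same_sym by blast
        next
          case 12: 2 then show ?thesis using nc[OF l] 2 n' tr same_sym by blast
        next
          case 3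
          show ?thesis
          proof (cases "q < a")
            case True
            then show ?thesis
              using nc[of p q a s] nc[of q r s b] N Uab 2 3 o l ab(1) same_sym
              by (metis less_trans)
          next
            case False
            then show ?thesis using nc[of b q r s] N Uab 2 3 o l by blast
          qed
        next
          case 4
          show ?thesis
          proof (cases "q < a")
            case True
            then show ?thesis
              using nc[of p q b s] nc[of q r s a] N Uab 2 4 o l ab(1) same_sym
              by (metis less_trans)
          next
            case False
            then show ?thesis using nc[of a q r s] N Uab 2 4 o l ab(1) by (metis less_trans)
          qed
        qed
      next
        case 3
        have "same \<tau> q s" using Utt 3 by blast
        then have "same \<tau> p q" using nct[OF l] le 3 by blast
        then have "same \<tau> a p" "same \<tau> a r" using Ut[of q] 3 le[of p r] tr' same_sym by metis+
        then have o: "p < a \<or> b < p" "r < a \<or> b < r" using out 3 by blast+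
        have N: "\<not> same \<sigma> z p" "\<not> same \<sigma> p z" "\<not> same \<sigma> z r" "\<not> same \<sigma> r z" if "U z" for z
          using that U_cong 3 by blast+
        have Uab: "U a" "U b" unfolding U_def using same_refl[OF ps] same_mem[OF pt ab(2)] by auto
        have "same \<sigma> a q \<or> same \<sigma> b q" "same \<sigma> a s \<or> same \<sigma> b s" using 3 unfolding U_def by auto
        then consider "same \<sigma> a q" "same \<sigma> a s" | "same \<sigma> b q" "same \<sigma> b s"
          | "same \<sigma> a q" "same \<sigma> b s" | "same \<sigma> b q" "same \<sigma> a s" by blast
        then show False
        proof cases
          case 11: 1 then show ?thesis using nc[OF l] 3 n' tr same_sym by blast
        next
          case 12: 2 then show ?thesis using nc[OF l] 3 n' tr same_sym by blast
        next
          case 33: 3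
          show ?thesis
          proof (cases "r < a")
            case True
            then show ?thesis using nc[of p q r a] N Uab 3 33 l same_sym by blast
          next
            case False
            then have "b < r" using o by blast
            then show ?thesis
              using nc[of p b r s] nc[of a p q r] N Uab 3 33 o l ab(1) by (metis less_trans)
          qed
        next
          case 4
          show ?thesis
          proof (cases "r < a")
            case True
            then show ?thesis using nc[of p q r b] N Uab 3 4 l ab(1) same_sym by (metis less_trans)
          next
            case False
            then have "b < r" using o by blast
            then show ?thesis
              using nc[of p a r s] nc[of b p q r] N Uab 3 4 o l ab(1) by (metis less_trans)
          qed
        qed
      qed
    qed
  qed
  moreover have "refines {1..m} \<rho> \<tau>"
    unfolding refines_iff_same[OF part' pt] U using le Utt by blast
  ultimately show thesis using that BB(1) by blast
qed

section \<open>Maximal chains and parking functions\<close>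

definition NC_bot :: "nat \<Rightarrow> nat set set" where
  "NC_bot m = (\<lambda>i. {i}) ` {1..m}"

definition NC_top :: "nat \<Rightarrow> nat set set" where
  "NC_top m = {{1..m}}"

lemma same_NC_bot: "same (NC_bot m) i j \<longleftrightarrow> i = j \<and> i \<in> {1..m}"
  unfolding same_def NC_bot_def by auto

lemma same_NC_top: "same (NC_top m) i j \<longleftrightarrow> i \<in> {1..m} \<and> j \<in> {1..m}"
  unfolding same_def NC_top_def by auto

lemma refines_same:
  fixes \<sigma> \<tau> :: "nat set set"
  shows "refines A \<sigma> \<tau> \<Longrightarrow> same \<sigma> i j \<Longrightarrow> same \<tau> i j"
  using refines_iff_same[of A \<sigma> \<tau>] unfolding refines_def by metis

lemma NC_bot_in: "NC_bot m \<in> NC m"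
proof (rule NC_I)
  show "partition_on {1..m} (NC_bot m)" unfolding NC_bot_def by (rule partition_on_singletons)
qed (auto simp: same_NC_bot)

lemma NC_top_in: "1 \<le> m \<Longrightarrow> NC_top m \<in> NC m"
proof (rule NC_I)
  show "partition_on {1..m} (NC_top m)" if "1 \<le> m"
    unfolding NC_top_def using that by (intro partition_on_space) auto
qed (auto simp: same_NC_top)

lemma card_NC_bot: "card (NC_bot m) = m"
  unfolding NC_bot_def by (simp add: card_image)

lemma card_NC_top: "card (NC_top m) = 1"
  unfolding NC_top_def by simp

lemma NC_bot_refines: "\<sigma> \<in> NC m \<Longrightarrow> refines {1..m} (NC_bot m) \<sigma>"
  using refines_iff_same[OF NC_D(1)[OF NC_bot_in] NC_D(1)] same_refl[OF NC_D(1)]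
  by (auto simp: same_NC_bot)

lemma refines_NC_top: "1 \<le> m \<Longrightarrow> \<sigma> \<in> NC m \<Longrightarrow> refines {1..m} \<sigma> (NC_top m)"
  using refines_iff_same[OF NC_D(1) NC_D(1)[OF NC_top_in]] same_mem[OF NC_D(1)]
  by (metis same_NC_top)

section \<open>Covering relations and maximal chains of noncrossing partitions\<close>

definition NC_cover :: "nat \<Rightarrow> nat set set \<Rightarrow> nat set set \<Rightarrow> bool" where
  "NC_cover m \<sigma> \<tau> \<longleftrightarrow> \<sigma> \<in> NC m \<and> \<tau> \<in> NC m \<and> (\<exists>B1 B2. merges B1 B2 \<sigma> \<tau>)"

lemma NC_cover_merging:
  assumes "NC_cover m \<sigma> \<tau>"
  obtains B1 B2 where "merging m B1 B2 \<sigma> \<tau>"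
  using assms NC_D(1) unfolding NC_cover_def merging_def by blast

text \<open>For the converse, \<open>merge_between\<close> inserts a merge of \<sigma> below \<tau>;
  having no more blocks than \<tau>, it equals \<tau>.\<close>

lemma NC_cover_iff:
  "NC_cover m \<sigma> \<tau> \<longleftrightarrow> \<sigma> \<in> NC m \<and> \<tau> \<in> NC m \<and> refines {1..m} \<sigma> \<tau> \<and> card \<sigma> = Suc (card \<tau>)"
proof
  assume *: "NC_cover m \<sigma> \<tau>"
  then obtain B1 B2 where "merging m B1 B2 \<sigma> \<tau>" by (rule NC_cover_merging)
  then show "\<sigma> \<in> NC m \<and> \<tau> \<in> NC m \<and> refines {1..m} \<sigma> \<tau> \<and> card \<sigma> = Suc (card \<tau>)"
    using * merging.refines merging.card_eq unfolding NC_cover_def by metis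
next
  assume *: "\<sigma> \<in> NC m \<and> \<tau> \<in> NC m \<and> refines {1..m} \<sigma> \<tau> \<and> card \<sigma> = Suc (card \<tau>)"
  then have "\<sigma> \<noteq> \<tau>" by auto
  then obtain B1 B2 \<rho> where \<rho>: "merges B1 B2 \<sigma> \<rho>" "\<rho> \<in> NC m" "refines {1..m} \<rho> \<tau>"
    using merge_between * by metis
  then have "merging m B1 B2 \<sigma> \<rho>" using * NC_D(1) unfolding merging_def by blast
  then have "card \<sigma> = Suc (card \<rho>)" by (rule merging.card_eq)
  then have "card \<rho> \<le> card \<tau>" using * by linarith
  then have "\<rho> = \<tau>" by (rule refines_card_eq[OF \<rho>(3)])
  then show "NC_cover m \<sigma> \<tau>" unfolding NC_cover_def using * \<rho> by blast
qed

lemma finer_trans: "finer m \<rho> \<sigma> \<Longrightarrow> finer m \<sigma> \<tau> \<Longrightarrow> finer m \<rho> \<tau>"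
  unfolding finer_def by (metis refines_asym refines_trans)

lemma NC_cover_finer: "NC_cover m \<sigma> \<tau> \<Longrightarrow> finer m \<sigma> \<tau>"
  unfolding NC_cover_iff finer_def by auto

lemma finer_card: "finer m \<sigma> \<tau> \<Longrightarrow> card \<tau> < card \<sigma>"
  unfolding finer_def using refines_card_less by blast

lemma maximal_chain_insert:
  assumes c: "c \<in> maximal_chains m" and x: "x \<in> NC m"
    and cmp: "\<And>y. y \<in> set c \<Longrightarrow> finer m x y \<or> finer m y x"
  shows False
proof -
  have mc: "pred_on.maxchain (NC m) (finer m) (set c)" using c unfolding maximal_chains_def by blast
  then have "pred_on.chain (NC m) (finer m) (set c)" unfolding pred_on.maxchain_def by blast
  then have "pred_on.chain (NC m) (finer m) (insert x (set c))"
    unfolding pred_on.chain_def using x cmp by auto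
  moreover have "x \<notin> set c" using cmp[of x] unfolding finer_def by blast
  ultimately show False using mc unfolding pred_on.maxchain_def by blast
qed

lemma card_nth_cover_list:
  "successively (NC_cover m) c \<Longrightarrow> i < length c \<Longrightarrow> card (c ! i) + i = card (c ! 0)"
proof (induction i)
  case (Suc i)
  then show ?case using successively_nth[OF Suc.prems] unfolding NC_cover_iff by auto
qed auto

lemma sorted_cover_list:
  "successively (NC_cover m) c \<Longrightarrow> sorted_wrt (finer m) c"
  using successively_conv_sorted_wrt[of "finer m" c] finer_trans
  by (metis NC_cover_finer successively_mono transpI)

text \<open>Maximality becomes a condition on consecutive entries. In one direction, a partition
  that \<open>merge_between\<close> finds strictly inside a step could be inserted; in the other,
  the block counts along the list take all values from \<open>m\<close> to 1, so a partition
  comparable with every entry equals the entry with as many blocks.\<close>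

lemma maximal_chains_iff:
  assumes m: "1 \<le> m"
  shows "c \<in> maximal_chains m \<longleftrightarrow> c \<noteq> [] \<and> hd c = NC_bot m \<and> last c = NC_top m \<and>
    set c \<subseteq> NC m \<and> successively (NC_cover m) c"
proof
  assume c: "c \<in> maximal_chains m"
  then have sorted: "sorted_wrt (finer m) c"
    and sub: "set c \<subseteq> NC m"
    unfolding maximal_chains_def pred_on.maxchain_def pred_on.chain_def by blast+
  have srt: "finer m (c ! i) (c ! j)" if "i < j" "j < length c" for i j
    using sorted that unfolding sorted_wrt_iff_nth_less by blast
  have ne: "c \<noteq> []" using maximal_chain_insert[OF c NC_bot_in] by auto
  have bot: "NC_bot m \<in> set c"
  proof (rule ccontr)
    assume n: "NC_bot m \<notin> set c"
    have "finer m (NC_bot m) y" if "y \<in> set c" for y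
      unfolding finer_def using NC_bot_refines sub that n by blast
    then show False using maximal_chain_insert[OF c NC_bot_in] by blast
  qed
  have top: "NC_top m \<in> set c"
  proof (rule ccontr)
    assume n: "NC_top m \<notin> set c"
    have "finer m y (NC_top m)" if "y \<in> set c" for y
      unfolding finer_def using refines_NC_top[OF m] sub that n by blast
    then show False using maximal_chain_insert[OF c NC_top_in[OF m]] by blast
  qed
  have "hd c = NC_bot m"
  proof -
    obtain i where i: "i < length c" "c ! i = NC_bot m" using bot by (meson in_set_conv_nth)
    have "i = 0"
    proof (rule ccontr)
      assume "i \<noteq> 0"
      then have "finer m (c ! 0) (NC_bot m)" using srt[of 0 i] i by simp
      moreover have "c ! 0 \<in> NC m" using sub ne by auto
      ultimately show False using NC_bot_refines unfolding finer_def by (metis refines_asym)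
    qed
    then show ?thesis using i ne by (simp add: hd_conv_nth)
  qed
  moreover have "last c = NC_top m"
  proof -
    obtain i where i: "i < length c" "c ! i = NC_top m" using top by (meson in_set_conv_nth)
    have "i = length c - 1"
    proof (rule ccontr)
      assume "i \<noteq> length c - 1"
      then have "finer m (NC_top m) (c ! (length c - 1))" using srt[of i "length c - 1"] i by simp
      moreover have "c ! (length c - 1) \<in> NC m" using sub ne by auto
      ultimately show False using refines_NC_top[OF m] unfolding finer_def by (metis refines_asym)
    qed
    then show ?thesis using i ne by (simp add: last_conv_nth)
  qed
  moreover have "successively (NC_cover m) c"
    unfolding successively_conv_nth
  proof (intro allI impI)
    fix i assume i: "Suc i < length c"
    let ?s = "c ! i" and ?t = "c ! Suc i"
    have st: "?s \<in> NC m" "?t \<in> NC m" using sub i by auto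
    have f: "refines {1..m} ?s ?t" "?s \<noteq> ?t" using srt[of i "Suc i"] i unfolding finer_def by auto
    obtain B1 B2 \<rho> where \<rho>: "merges B1 B2 ?s \<rho>" "\<rho> \<in> NC m" "refines {1..m} \<rho> ?t"
      using merge_between[OF st f] by blast
    have cov: "NC_cover m ?s \<rho>" unfolding NC_cover_def using st \<rho> by blast
    have "\<rho> = ?t"
    proof (rule ccontr)
      assume "\<rho> \<noteq> ?t"
      then have f2: "finer m \<rho> ?t" unfolding finer_def using \<rho> by blast
      have f1: "finer m ?s \<rho>" using NC_cover_finer[OF cov] .
      have "finer m \<rho> y \<or> finer m y \<rho>" if y: "y \<in> set c" for y
      proof -
        obtain j where j: "j < length c" "y = c ! j" using y by (metis in_set_conv_nth)
        consider "j = i" | "j < i" | "j = Suc i" | "Suc i < j" by linarith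
        then show ?thesis
        proof cases
          case 2 then show ?thesis using srt[of j i] i j f1 finer_trans by (metis Suc_lessD)
        next
          case 4 then show ?thesis using srt[of "Suc i" j] i j f2 finer_trans by metis
        qed (use f1 f2 j in auto)
      qed
      then show False using maximal_chain_insert[OF c \<rho>(2)] by blast
    qed
    then show "NC_cover m ?s ?t" using cov by simp
  qed
  ultimately show "c \<noteq> [] \<and> hd c = NC_bot m \<and> last c = NC_top m \<and> set c \<subseteq> NC m \<and>
    successively (NC_cover m) c" using ne sub by blast
next
  assume *: "c \<noteq> [] \<and> hd c = NC_bot m \<and> last c = NC_top m \<and> set c \<subseteq> NC m \<and>
    successively (NC_cover m) c"
  then have succ: "successively (NC_cover m) c" by blast
  have sorted: "sorted_wrt (finer m) c" using sorted_cover_list[OF succ] .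
  have chain: "pred_on.chain (NC m) (finer m) (set c)"
    unfolding pred_on.chain_def
  proof (intro conjI ballI)
    fix x y assume "x \<in> set c" "y \<in> set c"
    then obtain i j where "i < length c" "x = c ! i" "j < length c" "y = c ! j"
      by (metis in_set_conv_nth)
    then show "(finer m)\<^sup>=\<^sup>= x y \<or> (finer m)\<^sup>=\<^sup>= y x"
      using sorted unfolding sorted_wrt_iff_nth_less by (metis linorder_neqE_nat sup2CI)
  qed (use * in blast)
  have c0: "card (c ! 0) = m" using * by (metis card_NC_bot hd_conv_nth)
  have "card (c ! (length c - 1)) + (length c - 1) = m"
    using card_nth_cover_list[OF succ, of "length c - 1"] c0 * by simp
  then have len: "length c = m" using * card_NC_top by (metis One_nat_def Suc_pred add.commute
      last_conv_nth length_greater_0_conv plus_1_eq_Suc)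
  have False if S: "pred_on.chain (NC m) (finer m) S" "set c \<subset> S" for S
  proof -
    obtain x where x: "x \<in> S" "x \<notin> set c" using S by blast
    then have xN: "x \<in> NC m" using S unfolding pred_on.chain_def by blast
    have "card x \<le> m"
      using refines_card_less[OF NC_bot_refines[OF xN]] by (metis card_NC_bot less_imp_le order_refl)
    moreover have "1 \<le> card x"
      using refines_card_less[OF refines_NC_top[OF m xN]] by (metis card_NC_top less_imp_le order_refl)
    \<comment> \<open>The entry at position \<open>m - card x\<close> is the one with as many blocks
      as \<open>x\<close>.\<close>
    ultimately have i: "m - card x < length c" "card x + (m - card x) = m" using len by auto
    then have "card (c ! (m - card x)) = card x"
      using card_nth_cover_list[OF succ i(1)] c0 by simp
    moreover have y: "c ! (m - card x) \<in> set c" using i by simp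
    then have "(finer m)\<^sup>=\<^sup>= x (c ! (m - card x)) \<or> (finer m)\<^sup>=\<^sup>= (c ! (m - card x)) x"
      using S x unfolding pred_on.chain_def by blast
    ultimately have "x = c ! (m - card x)"
      using finer_card by fastforce
    then show False using x y by simp
  qed
  then show "c \<in> maximal_chains m"
    unfolding maximal_chains_def pred_on.maxchain_def using chain sorted by blast
qed

text \<open>Each block of a partition satisfying \<open>upper_intervals k\<close> meets \<open>{k+1, k+2, \<dots>}\<close> in an
  interval, and only the interval starting at \<open>k+1\<close> can be joined to points \<open>\<le> k\<close>.\<close>

definition upper_intervals :: "nat \<Rightarrow> nat set set \<Rightarrow> bool" where
  "upper_intervals k \<sigma> \<longleftrightarrow> (\<forall>i j. k < j \<longrightarrow> i \<le> j \<longrightarrow> same \<sigma> i (Suc j) \<longrightarrow> same \<sigma> j (Suc j))"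

text \<open>For a merge: a block starting at \<open>k+1\<close> is absorbed into the block of
  \<open>k\<close>. This forces the label \<open>k\<close>, and under
  \<open>upper_intervals k\<close> for \<tau> it is equivalent to it. Unlike the label, it involves
  only points up to \<open>k+1\<close>, so it survives the restriction to them.\<close>

definition omitted_step :: "nat \<Rightarrow> nat set set \<Rightarrow> nat set set \<Rightarrow> bool" where
  "omitted_step k \<sigma> \<tau> \<longleftrightarrow> (\<forall>i. same \<sigma> i (Suc k) \<longrightarrow> Suc k \<le> i) \<and> same \<tau> k (Suc k)"

section \<open>Recognizing the label of a merge from its two partitions\<close>

context merging
begin

lemma same_B1: "i \<in> B1 \<Longrightarrow> same \<sigma> i j \<longleftrightarrow> j \<in> B1"
  using same_block[OF part blocks(1)] .

lemma same_B2: "i \<in> B2 \<Longrightarrow> same \<sigma> i j \<longleftrightarrow> j \<in> B2"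
  using same_block[OF part blocks(2)] .

text \<open>If \<open>l+1\<close> were in \<open>B1\<close>, then \<open>l\<close> would be in
  \<open>B2\<close>, and \<open>Min B1 < l\<close> would share the block of \<open>l+1\<close>,
  which starts at \<open>l+1\<close>.\<close>

lemma omitted_step_blocks:
  assumes "omitted_step l \<sigma> \<tau>"
  shows "l \<in> B1" "Min B2 = Suc l" "lab = l"
proof -
  have mn: "\<And>i. same \<sigma> i (Suc l) \<Longrightarrow> Suc l \<le> i" and s: "same \<tau> l (Suc l)"
    using assms unfolding omitted_step_def by auto
  have ns: "\<not> same \<sigma> l (Suc l)" using mn[of l] by auto
  then have l: "l \<in> B1 \<union> B2" "Suc l \<in> B1 \<union> B2" using s same_iff by auto
  have "Suc l \<notin> B1"
  proof
    assume 1: "Suc l \<in> B1"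
    then have "l \<notin> B1" using ns same_B1[of "Suc l" l] same_sym by blast
    then have "Min B1 < l" using l Min_less by blast
    moreover have "same \<sigma> (Min B1) (Suc l)" using same_B1 1 Min_in[OF fin(1) ne(1)] by blast
    ultimately show False using mn by fastforce
  qed
  then have 2: "Suc l \<in> B2" using l by blast
  then have "l \<notin> B2" using ns same_B2[of "Suc l" l] same_sym by blast
  then show l1: "l \<in> B1" using l by blast
  have "Suc l \<le> y" if "y \<in> B2" for y using mn[of y] same_B2[OF that] 2 by blast
  then show "Min B2 = Suc l" using 2 fin by (intro Min_eqI) auto
  then have "l < y" if "y \<in> B2" for y using that fin by (metis Min_le Suc_le_lessD)
  then have "l \<le> lab" using lab(3) l1 by blast
  moreover have "lab < Suc l" using lab(2) 2 by blast
  ultimately show "lab = l" by simp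
qed

text \<open>If \<open>B2\<close> started at \<open>j+1\<close> with \<open>lab < j\<close>, then
  \<tau> would join \<open>j\<close> to \<open>j+1\<close>. Being below \<open>B2\<close>, the point
  \<open>j\<close> would lie in \<open>B1\<close>, against the maximality of
  \<open>lab\<close>.\<close>

lemma Min_B2:
  assumes "upper_intervals lab \<tau>"
  shows "Min B2 = Suc lab"
proof (rule ccontr)
  assume "Min B2 \<noteq> Suc lab"
  moreover have M: "Min B2 \<in> B2" using fin ne by simp
  moreover from this have "lab < Min B2" by (rule lab(2))
  ultimately obtain j where j: "Min B2 = Suc j" "lab < j"
    by (metis Suc_lessI less_Suc_eq_0_disj less_imp_Suc_add not_less_eq)
  have "same \<tau> lab (Suc j)" using M lab(1) same_iff j by auto
  then have "same \<tau> j (Suc j)" using assms[unfolded upper_intervals_def, rule_format, of j lab] j by simp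
  moreover have jB: "j \<notin> B2" using j fin Min_le[OF fin(2)] by fastforce
  then have "\<not> same \<sigma> j (Suc j)" using same_B2[OF M] j same_sym by metis
  ultimately have "j \<in> B1" using jB same_iff by blast
  moreover have "\<forall>y\<in>B2. j < y" using j fin Min_le[OF fin(2)] by fastforce
  ultimately have "j \<le> lab" by (rule lab(3))
  then show False using j by simp
qed

lemma omitted_step_lab:
  assumes "upper_intervals lab \<tau>"
  shows "omitted_step lab \<sigma> \<tau>"
proof -
  have M: "Min B2 = Suc lab" using Min_B2[OF assms] .
  then have 2: "Suc lab \<in> B2" using Min_in[OF fin(2) ne(2)] by simp
  have "Suc lab \<le> i" if "same \<sigma> i (Suc lab)" for i
    using same_B2[OF 2, of i] same_sym[OF that] M fin by (metis Min_le)
  moreover have "same \<tau> lab (Suc lab)" using 2 lab(1) same_iff by blast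
  ultimately show ?thesis unfolding omitted_step_def by blast
qed

end

text \<open>All conditions concern a single step. This is what allows chains of the family to be cut
  and glued at any common element.\<close>

definition good_cover :: "nat \<Rightarrow> nat \<Rightarrow> nat set set \<Rightarrow> nat set set \<Rightarrow> bool" where
  "good_cover n k \<sigma> \<tau> \<longleftrightarrow> NC_cover (n + 1) \<sigma> \<tau> \<and> upper_intervals k \<sigma> \<and> upper_intervals k \<tau> \<and>
    \<not> omitted_step k \<sigma> \<tau>"

section \<open>Label sets of maximal chains\<close>

lemma length_chain_labels: "length (chain_labels c) = length c - 1"
  unfolding chain_labels_def by simp

lemma chain_labels_nth:
  "Suc i < length c \<Longrightarrow> chain_labels c ! i = cover_label (c ! i) (c ! Suc i)"
  unfolding chain_labels_def by (simp add: nth_butlast nth_tl)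

lemma set_chain_labels:
  "set (chain_labels c) = {cover_label (c ! i) (c ! Suc i) | i. Suc i < length c}"
proof -
  have "set (chain_labels c) = {chain_labels c ! i | i. Suc i < length c}"
    unfolding set_conv_nth length_chain_labels less_diff_conv by simp
  also have "\<dots> = {cover_label (c ! i) (c ! Suc i) | i. Suc i < length c}"
    using chain_labels_nth by metis
  finally show ?thesis .
qed

text \<open>Downward induction from \<open>n\<close> to \<open>k\<close>. By the induction
  hypothesis the step with label \<open>j+1\<close> absorbs a block starting at \<open>j+2\<close>
  into the block of \<open>j+1\<close>. Before this step nothing smaller is joined to
  \<open>j+2\<close>, and after it \<open>j+1\<close> and \<open>j+2\<close> are together; this is
  the one clause that \<open>upper_intervals j\<close> adds to
  \<open>upper_intervals (Suc j)\<close>.\<close>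

lemma PF_chain_upper_intervals:
  assumes succ: "successively (NC_cover (n + 1)) c" and sub: "set c \<subseteq> NC (n + 1)"
    and lab: "{k+1..n} \<subseteq> set (chain_labels c)" and k: "k \<le> n"
  shows "\<forall>\<sigma>\<in>set c. upper_intervals k \<sigma>"
  using k
proof (induction rule: inc_induct)
  \<comment> \<open>\<open>upper_intervals n\<close> speaks only of blocks with points beyond
    \<open>n+1\<close>, so it holds vacuously.\<close>
  case base
  show ?case
    unfolding upper_intervals_def using sub same_mem[OF NC_D(1)] by fastforce
next
  case (step j)
  have "Suc j \<in> set (chain_labels c)" using lab step.hyps by auto
  then obtain t where t: "Suc t < length c" "cover_label (c ! t) (c ! Suc t) = Suc j"
    unfolding set_chain_labels by auto
  have "NC_cover (n + 1) (c ! t) (c ! Suc t)" using successively_nth[OF succ t(1)] .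
  then obtain B1 B2 where "merging (n + 1) B1 B2 (c ! t) (c ! Suc t)" by (rule NC_cover_merging)
  then interpret merging "n + 1" B1 B2 "c ! t" "c ! Suc t" .
  have l: "lab = Suc j" using t cover_label_eq by simp
  have "upper_intervals (Suc j) (c ! Suc t)" using step.IH t by auto
  then have os: "omitted_step (Suc j) (c ! t) (c ! Suc t)" using omitted_step_lab l by simp
  have le: "same (c ! a) x y \<Longrightarrow> same (c ! b) x y" if "a \<le> b" "b < length c" for a b x y
  proof (cases "a = b")
    case False
    then have "finer (n + 1) (c ! a) (c ! b)"
      using sorted_cover_list[OF succ] that unfolding sorted_wrt_iff_nth_less by simp
    then have "refines {1..n + 1} (c ! a) (c ! b)" unfolding finer_def by blast
    then show "same (c ! a) x y \<Longrightarrow> same (c ! b) x y"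
      by (rule refines_same)
  qed auto
  show ?case
  proof
    fix \<sigma> assume \<sigma>: "\<sigma> \<in> set c"
    then obtain a where a: "a < length c" "\<sigma> = c ! a" by (metis in_set_conv_nth)
    have "same \<sigma> (Suc j) (Suc (Suc j))" if i: "i \<le> Suc j" "same \<sigma> i (Suc (Suc j))" for i
    proof (cases "a \<le> t")
      case True
      then have "same (c ! t) i (Suc (Suc j))" using le[of a t] i t a by simp
      then show ?thesis using os i unfolding omitted_step_def by fastforce
    next
      case False
      have "same (c ! Suc t) (Suc j) (Suc (Suc j))" using os unfolding omitted_step_def by blast
      then show ?thesis using le[of "Suc t" a] False a by simp
    qed
    moreover have "upper_intervals (Suc j) \<sigma>" using step.IH \<sigma> by blast
    ultimately show "upper_intervals j \<sigma>"
      unfolding upper_intervals_def by (metis Suc_lessI)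
  qed
qed

text \<open>Take the step that first joins \<open>l\<close> and \<open>l+1\<close>. Just before it,
  \<open>upper_intervals k\<close> makes \<open>l+1\<close> the least point of its block, so the
  step has label \<open>l\<close>.\<close>

lemma all_labels_occur:
  assumes succ: "successively (NC_cover (n + 1)) c" and c: "c \<noteq> []" "hd c = NC_bot (n + 1)"
    "last c = NC_top (n + 1)"
    and ui: "\<forall>\<sigma>\<in>set c. upper_intervals k \<sigma>" and l: "k < l" "l \<le> n"
  shows "l \<in> set (chain_labels c)"
proof -
  define P where "P t \<longleftrightarrow> t < length c \<and> same (c ! t) l (Suc l)" for t
  have "P (length c - 1)" unfolding P_def using c l last_conv_nth[OF c(1)] by (simp add: same_NC_top)
  then have PL: "P (LEAST t. P t)" by (rule LeastI)
  have "\<not> P 0" unfolding P_def using c by (simp add: hd_conv_nth[symmetric] same_NC_bot)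
  then obtain t where t: "(LEAST t. P t) = Suc t" using PL by (metis not0_implies_Suc)
  then have "\<not> P t" using not_less_Least[of t P] by simp
  then have tc: "Suc t < length c" "same (c ! Suc t) l (Suc l)" "\<not> same (c ! t) l (Suc l)"
    using PL t unfolding P_def by auto
  have "NC_cover (n + 1) (c ! t) (c ! Suc t)" using successively_nth[OF succ tc(1)] .
  then obtain B1 B2 where "merging (n + 1) B1 B2 (c ! t) (c ! Suc t)" by (rule NC_cover_merging)
  then interpret merging "n + 1" B1 B2 "c ! t" "c ! Suc t" .
  have "upper_intervals k (c ! t)" using ui tc by simp
  then have "Suc l \<le> i" if "same (c ! t) i (Suc l)" for i
    using that tc(3) l unfolding upper_intervals_def by (metis not_less_eq_eq)
  then have "omitted_step l (c ! t) (c ! Suc t)" unfolding omitted_step_def using tc by blast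
  then have "cover_label (c ! t) (c ! Suc t) = l" using omitted_step_blocks(3) cover_label_eq by simp
  then show ?thesis unfolding set_chain_labels using tc by blast
qed

text \<open>The number of blocks meeting \<open>{i+1, i+2, \<dots>}\<close>, counted by their least elements in that
  set, drops at each step with label \<open>> i\<close>; this gives the parking condition.\<close>

definition mins_above :: "nat \<Rightarrow> nat set set \<Rightarrow> nat set" where
  "mins_above i \<sigma> = {x. i < x \<and> same \<sigma> x x \<and> (\<forall>y. i < y \<longrightarrow> same \<sigma> x y \<longrightarrow> x \<le> y)}"

lemma card_mins_above_cover:
  assumes "NC_cover m \<sigma> \<tau>"
  shows "(if i < cover_label \<sigma> \<tau> then 1 else 0) + card (mins_above i \<tau>) \<le> card (mins_above i \<sigma>)"
proof -
  obtain B1 B2 where "merging m B1 B2 \<sigma> \<tau>" using NC_cover_merging[OF assms] .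
  then interpret merging m B1 B2 \<sigma> \<tau> .
  have fin': "finite (mins_above i \<sigma>)"
    by (rule finite_subset[of _ "{1..m}"]) (auto simp: mins_above_def same_refl[OF part])
  have sub: "mins_above i \<tau> \<subseteq> mins_above i \<sigma>"
    unfolding mins_above_def using same_iff same_refl[OF part] same_refl[OF part'] by auto
  show ?thesis
  proof (cases "i < lab")
    case True
    have M: "Min B2 \<in> B2" using fin ne by simp
    \<comment> \<open>\<open>Min B2\<close> is the element that is lost: the label is smaller, still
      above \<open>i\<close>, and joins its block.\<close>
    have "Min B2 \<in> mins_above i \<sigma>"
      unfolding mins_above_def using lab(2)[OF M] True same_B2[OF M] M fin by auto
    moreover have "same \<tau> (Min B2) lab" using M lab(1) same_iff by blast
    then have "Min B2 \<notin> mins_above i \<tau>"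
      unfolding mins_above_def using lab(2)[OF M] True by auto
    ultimately have "mins_above i \<tau> \<subset> mins_above i \<sigma>" using sub by blast
    then have "card (mins_above i \<tau>) < card (mins_above i \<sigma>)" by (rule psubset_card_mono[OF fin'])
    then show ?thesis using True cover_label_eq by simp
  next
    case False
    then show ?thesis using card_mono[OF fin' sub] cover_label_eq by simp
  qed
qed

lemma count_labels_above:
  assumes "successively (NC_cover m) c" "c \<noteq> []"
  shows "length (filter (\<lambda>x. i < x) (chain_labels c)) + card (mins_above i (last c))
    \<le> card (mins_above i (hd c))"
  using assms
proof (induction c rule: induct_list012)
  case (3 x y zs)
  have "chain_labels (x # y # zs) = cover_label x y # chain_labels (y # zs)"
    unfolding chain_labels_def by simp
  then show ?case
    using 3 card_mins_above_cover[of m x y i] by (auto split: if_splits)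
qed (auto simp: chain_labels_def)

text \<open>If the \<open>i\<close>-th smallest entry exceeded \<open>i\<close>, so would all
  \<open>n - i + 1\<close> entries from there on.\<close>

lemma sort_nth_le:
  fixes a :: "nat list"
  assumes "length a = n" "i \<in> {1..n}" "length (filter (\<lambda>x. i < x) a) \<le> n - i"
  shows "sort a ! (i - 1) \<le> i"
proof (rule ccontr)
  assume *: "\<not> sort a ! (i - 1) \<le> i"
  let ?d = "drop (i - 1) (sort a)"
  have "\<forall>x\<in>set ?d. i < x"
  proof
    fix x assume "x \<in> set ?d"
    then obtain j where j: "j < length ?d" "x = ?d ! j" by (metis in_set_conv_nth)
    then have "sort a ! (i - 1) \<le> sort a ! (i - 1 + j)" using assms by (intro sorted_nth_mono) auto
    then show "i < x" using * j by simp
  qed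
  then have "length (filter (\<lambda>x. i < x) ?d) = n - (i - 1)" using assms by (simp add: filter_True)
  moreover have "filter (\<lambda>x. i < x) (sort a) =
    filter (\<lambda>x. i < x) (take (i - 1) (sort a)) @ filter (\<lambda>x. i < x) ?d"
    by (metis append_take_drop_id filter_append)
  then have "length (filter (\<lambda>x. i < x) (sort a)) \<ge> length (filter (\<lambda>x. i < x) ?d)" by simp
  moreover have "length (filter (\<lambda>x. i < x) (sort a)) = length (filter (\<lambda>x. i < x) a)"
    by (metis mset_filter mset_sort size_mset)
  ultimately show False using assms by auto
qed

text \<open>\<open>mins_above i\<close> has \<open>n + 1 - i\<close> elements at the bottom and one
  at the top, so at most \<open>n - i\<close> labels exceed \<open>i\<close>.\<close>

lemma chain_labels_parking:
  assumes succ: "successively (NC_cover (n + 1)) c" and c: "c \<noteq> []" "hd c = NC_bot (n + 1)"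
    "last c = NC_top (n + 1)"
  shows "chain_labels c \<in> parking_functions n"
proof -
  have "card (c ! (length c - 1)) + (length c - 1) = card (c ! 0)"
    using card_nth_cover_list[OF succ, of "length c - 1"] c by simp
  then have len: "length (chain_labels c) = n"
    using c last_conv_nth[OF c(1)] hd_conv_nth[OF c(1)]
    by (simp add: card_NC_bot card_NC_top length_chain_labels)
  have "0 < x" if x: "x \<in> set (chain_labels c)" for x
  proof -
    obtain i where i: "Suc i < length c" "x = cover_label (c ! i) (c ! Suc i)"
      using x unfolding set_chain_labels by blast
    have "NC_cover (n + 1) (c ! i) (c ! Suc i)" using successively_nth[OF succ i(1)] .
    then obtain B1 B2 where "merging (n + 1) B1 B2 (c ! i) (c ! Suc i)" by (rule NC_cover_merging)
    then interpret merging "n + 1" B1 B2 "c ! i" "c ! Suc i" .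
    show ?thesis using lab(1) sub i cover_label_eq by auto
  qed
  moreover have "sort (chain_labels c) ! (i - 1) \<le> i" if i: "i \<in> {1..n}" for i
  proof (rule sort_nth_le[OF len i])
    have "mins_above i (NC_bot (n + 1)) = {Suc i..n + 1}"
      unfolding mins_above_def same_NC_bot by auto
    then have 1: "card (mins_above i (hd c)) = n + 1 - i" using c by simp
    have "mins_above i (NC_top (n + 1)) = {Suc i}"
    proof (rule set_eqI)
      fix x
      have "x \<in> mins_above i (NC_top (n + 1)) \<longleftrightarrow>
          i < x \<and> x \<le> n + 1 \<and> (\<forall>y. i < y \<and> y \<le> n + 1 \<longrightarrow> x \<le> y)"
        unfolding mins_above_def same_NC_top by auto
      also have "\<dots> \<longleftrightarrow> x = Suc i" using i by (auto intro: le_antisym)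
      finally show "x \<in> mins_above i (NC_top (n + 1)) \<longleftrightarrow> x \<in> {Suc i}" by simp
    qed
    then have "card (mins_above i (last c)) = 1" using c by simp
    then show "length (filter (\<lambda>x. i < x) (chain_labels c)) \<le> n - i"
      using count_labels_above[OF succ c(1), of i] 1 by simp
  qed
  ultimately show ?thesis unfolding parking_functions_def using len by blast
qed

lemma PF_chains_iff:
  assumes k: "k \<le> n" "1 \<le> n"
  shows "c \<in> PF_chains n k \<longleftrightarrow> c \<noteq> [] \<and> hd c = NC_bot (n + 1) \<and> last c = NC_top (n + 1) \<and>
    successively (good_cover n k) c"
proof
  assume "c \<in> PF_chains n k"
  then have "c \<in> maximal_chains (n + 1)" and PF: "k \<notin> set (chain_labels c)"
    "{k+1..n} \<subseteq> set (chain_labels c)" unfolding PF_chains_def PF_def by auto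
  then have c: "c \<noteq> []" "hd c = NC_bot (n + 1)" "last c = NC_top (n + 1)" "set c \<subseteq> NC (n + 1)"
    and succ: "successively (NC_cover (n + 1)) c" using maximal_chains_iff[of "n + 1" c] by auto
  have ui: "\<forall>\<sigma>\<in>set c. upper_intervals k \<sigma>" using PF_chain_upper_intervals[OF succ c(4) PF(2) k(1)] .
  have "successively (good_cover n k) c"
    unfolding successively_conv_nth
  proof (intro allI impI)
    fix i assume i: "Suc i < length c"
    have cov: "NC_cover (n + 1) (c ! i) (c ! Suc i)" using successively_nth[OF succ i] .
    then obtain B1 B2 where "merging (n + 1) B1 B2 (c ! i) (c ! Suc i)" by (rule NC_cover_merging)
    then interpret merging "n + 1" B1 B2 "c ! i" "c ! Suc i" .
    have "lab \<in> set (chain_labels c)" unfolding set_chain_labels using i cover_label_eq[symmetric] by blast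
    then have "\<not> omitted_step k (c ! i) (c ! Suc i)" using PF(1) omitted_step_blocks(3) by auto
    then show "good_cover n k (c ! i) (c ! Suc i)" unfolding good_cover_def using cov ui i by simp
  qed
  then show "c \<noteq> [] \<and> hd c = NC_bot (n + 1) \<and> last c = NC_top (n + 1) \<and>
    successively (good_cover n k) c" using c by blast
next
  assume *: "c \<noteq> [] \<and> hd c = NC_bot (n + 1) \<and> last c = NC_top (n + 1) \<and>
    successively (good_cover n k) c"
  then have c: "c \<noteq> []" "hd c = NC_bot (n + 1)" "last c = NC_top (n + 1)"
    and good: "successively (good_cover n k) c" by auto
  have succ: "successively (NC_cover (n + 1)) c"
    using good by (rule successively_mono) (simp add: good_cover_def)
  have "\<not> same (NC_bot (n + 1)) 1 2" "same (NC_top (n + 1)) 1 2"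
    unfolding same_NC_bot same_NC_top using k by auto
  then have "NC_bot (n + 1) \<noteq> NC_top (n + 1)" by auto
  \<comment> \<open>With at least two entries, every entry is an end of some step, and its
    properties can be read off from \<open>good_cover\<close>.\<close>
  then have len: "length c \<ge> 2" using c by (cases c rule: list.exhaust) (auto split: if_splits simp: Suc_le_eq)
  have mem: "\<sigma> \<in> NC (n + 1) \<and> upper_intervals k \<sigma>" if "\<sigma> \<in> set c" for \<sigma>
  proof -
    obtain i where i: "i < length c" "\<sigma> = c ! i" using \<open>\<sigma> \<in> set c\<close> by (metis in_set_conv_nth)
    show ?thesis
    proof (cases "Suc i < length c")
      case True
      then show ?thesis using successively_nth[OF good True] i
        unfolding good_cover_def NC_cover_def by simp
    next
      case False
      then obtain j where "i = Suc j" using len i by (cases i) auto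
      then show ?thesis using successively_nth[OF good, of j] i
        unfolding good_cover_def NC_cover_def by simp
    qed
  qed
  have "c \<in> maximal_chains (n + 1)"
    using maximal_chains_iff[of "n + 1" c] c succ mem by auto
  moreover have "chain_labels c \<in> parking_functions n" using chain_labels_parking[OF succ c] .
  moreover have "k \<notin> set (chain_labels c)"
  proof
    assume "k \<in> set (chain_labels c)"
    then obtain i where i: "Suc i < length c" "k = cover_label (c ! i) (c ! Suc i)"
      unfolding set_chain_labels by blast
    have g: "good_cover n k (c ! i) (c ! Suc i)" using successively_nth[OF good i(1)] .
    then have "NC_cover (n + 1) (c ! i) (c ! Suc i)" unfolding good_cover_def by blast
    then obtain B1 B2 where "merging (n + 1) B1 B2 (c ! i) (c ! Suc i)" by (rule NC_cover_merging)
    then interpret merging "n + 1" B1 B2 "c ! i" "c ! Suc i" .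
    show False using g omitted_step_lab i cover_label_eq unfolding good_cover_def by simp
  qed
  moreover have "{k+1..n} \<subseteq> set (chain_labels c)"
    using all_labels_occur[OF succ c, of k] mem by auto
  ultimately show "c \<in> PF_chains n k" unfolding PF_chains_def PF_def by blast
qed

text \<open>An interval of the poset only depends on the local relation \<open>good_cover\<close>, because chains can
  be concatenated at any element.\<close>

lemma rtranclp_iff_list:
  "R\<^sup>*\<^sup>* x y \<longleftrightarrow> (\<exists>c. c \<noteq> [] \<and> hd c = x \<and> last c = y \<and> successively R c)"
proof
  assume "R\<^sup>*\<^sup>* x y"
  then show "\<exists>c. c \<noteq> [] \<and> hd c = x \<and> last c = y \<and> successively R c"
  proof (induction rule: converse_rtranclp_induct)
    case base
    show ?case by (intro exI[of _ "[y]"]) simp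
  next
    case (step x z)
    then obtain c where "c \<noteq> []" "hd c = z" "last c = y" "successively R c" by blast
    then show ?case using step by (intro exI[of _ "x # c"]) (auto simp: successively_Cons)
  qed
next
  assume "\<exists>c. c \<noteq> [] \<and> hd c = x \<and> last c = y \<and> successively R c"
  then obtain c where "c \<noteq> []" "hd c = x" "last c = y" "successively R c" by blast
  then show "R\<^sup>*\<^sup>* x y"
  proof (induction c arbitrary: x rule: induct_list012)
    case (3 a b zs)
    then have "R\<^sup>*\<^sup>* b y" by auto
    moreover have "R x b" using 3 by auto
    ultimately show ?case by simp
  qed auto
qed

lemma successively_splice:
  assumes "i < length c" "successively R c"
  shows "R\<^sup>*\<^sup>* (hd c) (c ! i) \<and> R\<^sup>*\<^sup>* (c ! i) (last c)"
proof
  show "R\<^sup>*\<^sup>* (hd c) (c ! i)"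
    using assms(1)
  proof (induction i)
    case 0 then show ?case by (cases c) auto
  next
    case (Suc i) then show ?case using successively_nth[OF assms(2) Suc.prems] by simp
  qed
  show "R\<^sup>*\<^sup>* (c ! i) (last c)"
    unfolding rtranclp_iff_list using assms
    by (intro exI[of _ "drop i c"])
      (metis append_take_drop_id hd_drop_conv_nth last_drop length_drop list.size(3)
        successively_append_iff zero_less_diff less_numeral_extra(3))
qed

section \<open>Intervals of the poset in terms of allowed steps\<close>

context
  fixes n k :: nat
  assumes kn: "k \<le> n" "1 \<le> n"
begin

lemma Poset_carrier_iff:
  "x \<in> Poset_carrier n k \<longleftrightarrow>
    (good_cover n k)\<^sup>*\<^sup>* (NC_bot (n + 1)) x \<and> (good_cover n k)\<^sup>*\<^sup>* x (NC_top (n + 1))"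
proof
  assume "x \<in> Poset_carrier n k"
  then obtain c i where "c \<in> PF_chains n k" "i < length c" "x = c ! i"
    unfolding Poset_carrier_def by (metis UN_E in_set_conv_nth)
  then show "(good_cover n k)\<^sup>*\<^sup>* (NC_bot (n + 1)) x \<and> (good_cover n k)\<^sup>*\<^sup>* x (NC_top (n + 1))"
    using successively_splice[of i c "good_cover n k"] unfolding PF_chains_iff[OF kn] by auto
next
  assume "(good_cover n k)\<^sup>*\<^sup>* (NC_bot (n + 1)) x \<and> (good_cover n k)\<^sup>*\<^sup>* x (NC_top (n + 1))"
  then obtain c d where cd: "c \<noteq> []" "hd c = NC_bot (n + 1)" "last c = x" "successively (good_cover n k) c"
    "d \<noteq> []" "hd d = x" "last d = NC_top (n + 1)" "successively (good_cover n k) d"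
    unfolding rtranclp_iff_list by blast
  \<comment> \<open>Both lists contain \<open>x\<close> at the junction; \<open>butlast\<close>
    drops one copy.\<close>
  have "butlast c @ d \<in> PF_chains n k"
  proof -
    have c: "c = butlast c @ [x]" using cd by (metis append_butlast_last_id)
    then have s: "successively (good_cover n k) (butlast c @ [x])" using cd by simp
    have d: "d = x # tl d" using cd by (metis list.collapse)
    have "hd (butlast c @ d) = NC_bot (n + 1)"
      using c cd by (metis hd_append hd_append2 list.sel(1) append_Nil)
    then show ?thesis
      unfolding PF_chains_iff[OF kn] using cd s by (auto simp: successively_append_iff)
  qed
  moreover have "x \<in> set (butlast c @ d)" using cd by (metis Un_iff hd_in_set set_append)
  ultimately show "x \<in> Poset_carrier n k" unfolding Poset_carrier_def by blast
qed

lemma Poset_cover_iff: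
  "Poset_cover n k x y \<longleftrightarrow> good_cover n k x y \<and> x \<in> Poset_carrier n k \<and> y \<in> Poset_carrier n k"
proof
  assume "Poset_cover n k x y"
  then obtain c i where c: "c \<in> PF_chains n k" "Suc i < length c" "c ! i = x" "c ! Suc i = y"
    unfolding Poset_cover_def by blast
  then have "good_cover n k x y" unfolding PF_chains_iff[OF kn] using successively_nth by metis
  moreover have "x \<in> set c" "y \<in> set c" using c by auto
  ultimately show "good_cover n k x y \<and> x \<in> Poset_carrier n k \<and> y \<in> Poset_carrier n k"
    unfolding Poset_carrier_def using c by blast
next
  assume *: "good_cover n k x y \<and> x \<in> Poset_carrier n k \<and> y \<in> Poset_carrier n k"
  then obtain c d where cd: "c \<noteq> []" "hd c = NC_bot (n + 1)" "last c = x" "successively (good_cover n k) c"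
    "d \<noteq> []" "hd d = y" "last d = NC_top (n + 1)" "successively (good_cover n k) d"
    unfolding Poset_carrier_iff rtranclp_iff_list by blast
  then have "c @ d \<in> PF_chains n k"
    unfolding PF_chains_iff[OF kn] using * by (simp add: successively_append_iff)
  moreover have "(c @ d) ! (length c - 1) = x" "(c @ d) ! Suc (length c - 1) = y"
    using cd by (simp_all add: nth_append last_conv_nth hd_conv_nth)
  moreover have "Suc (length c - 1) < length (c @ d)" using cd by simp
  ultimately show "Poset_cover n k x y" unfolding Poset_cover_def by blast
qed

lemma Poset_le_iff:
  assumes "x \<in> Poset_carrier n k" "y \<in> Poset_carrier n k"
  shows "Poset_le n k x y \<longleftrightarrow> (good_cover n k)\<^sup>*\<^sup>* x y"
proof
  show "Poset_le n k x y \<Longrightarrow> (good_cover n k)\<^sup>*\<^sup>* x y"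
    unfolding Poset_le_def by (erule rtranclp_mono[THEN predicate2D, rotated]) (auto simp: Poset_cover_iff)
next
  assume "(good_cover n k)\<^sup>*\<^sup>* x y"
  then show "Poset_le n k x y"
    using assms(1)
  proof (induction rule: converse_rtranclp_induct)
    case (step a b)
    have "(good_cover n k)\<^sup>*\<^sup>* b (NC_top (n + 1))"
      using step(2) assms(2) unfolding Poset_carrier_iff by (meson rtranclp_trans)
    moreover have "(good_cover n k)\<^sup>*\<^sup>* (NC_bot (n + 1)) b"
      using step(1,4) unfolding Poset_carrier_iff by (meson rtranclp.rtrancl_into_rtrancl)
    ultimately have b: "b \<in> Poset_carrier n k" unfolding Poset_carrier_iff by blast
    then have "Poset_cover n k a b" using step Poset_cover_iff by blast
    then show ?case using step.IH[OF b] unfolding Poset_le_def by simp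
  qed (simp add: Poset_le_def)
qed

lemma interval_Poset:
  assumes "x \<in> Poset_carrier n k" "y \<in> Poset_carrier n k"
  shows "interval (Poset_carrier n k) (Poset_le n k) x y =
    {z. (good_cover n k)\<^sup>*\<^sup>* x z \<and> (good_cover n k)\<^sup>*\<^sup>* z y}" (is "_ = ?I")
proof -
  have I: "z \<in> Poset_carrier n k" if "z \<in> ?I" for z
    using that assms unfolding Poset_carrier_iff by (auto intro: rtranclp_trans)
  show ?thesis
    unfolding interval_def using Poset_le_iff assms I by blast
qed

end

section \<open>Splitting off the upper intervals\<close>

definition upper_NC :: "nat \<Rightarrow> nat \<Rightarrow> nat set set set" where
  "upper_NC n k = {\<sigma> \<in> NC (n + 1). upper_intervals k \<sigma>}"

text \<open>For partitions in \<open>upper_NC\<close> this restriction is the contraction of the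
  points above \<open>k\<close>: a block that joins a point above \<open>k+1\<close> to one at most
  \<open>k\<close> also contains \<open>k+1\<close>.\<close>

definition restr :: "nat \<Rightarrow> nat set set \<Rightarrow> nat set set" where
  "restr k \<sigma> = rel_classes {1..k+1} (\<lambda>i j. same \<sigma> i j \<and> i \<in> {1..k+1} \<and> j \<in> {1..k+1})"

definition links :: "nat \<Rightarrow> nat \<Rightarrow> nat set set \<Rightarrow> nat set" where
  "links n k \<sigma> = {j \<in> {k+1..n}. same \<sigma> j (Suc j)}"

text \<open>\<open>min i (k+1)\<close> is the contraction of \<open>i\<close>. The last clause asks
  that every link passed on the way between \<open>i\<close> and \<open>j\<close> above
  \<open>k\<close> be present.\<close>

definition joined :: "nat \<Rightarrow> nat \<Rightarrow> nat set set \<Rightarrow> nat set \<Rightarrow> nat \<Rightarrow> nat \<Rightarrow> bool" where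
  "joined n k \<pi> S i j \<longleftrightarrow> i \<in> {1..n+1} \<and> j \<in> {1..n+1} \<and> same \<pi> (min i (k+1)) (min j (k+1)) \<and>
    (\<forall>x. k < x \<longrightarrow> min i j \<le> x \<longrightarrow> x < max i j \<longrightarrow> x \<in> S)"

definition assemble :: "nat \<Rightarrow> nat \<Rightarrow> nat set set \<Rightarrow> nat set \<Rightarrow> nat set set" where
  "assemble n k \<pi> S = rel_classes {1..n+1} (joined n k \<pi> S)"

section \<open>Coordinates of a partition: its restriction and its links\<close>

context
  fixes n k :: nat
  assumes k: "1 \<le> k" "k \<le> n"
begin

lemma upper_NC_D:
  assumes "\<sigma> \<in> upper_NC n k"
  shows "\<sigma> \<in> NC (n + 1)" "partition_on {1..n+1} \<sigma>" "upper_intervals k \<sigma>"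
  using assms NC_D(1) unfolding upper_NC_def by auto

lemma
  assumes \<sigma>: "\<sigma> \<in> upper_NC n k"
  shows partition_restr: "partition_on {1..k+1} (restr k \<sigma>)"
    and same_restr: "same (restr k \<sigma>) i j \<longleftrightarrow> same \<sigma> i j \<and> i \<in> {1..k+1} \<and> j \<in> {1..k+1}"
    and restr_NC: "restr k \<sigma> \<in> NC (k + 1)"
proof -
  let ?E = "\<lambda>i j. same \<sigma> i j \<and> i \<in> {1..k+1} \<and> j \<in> {1..k+1}"
  note p = upper_NC_D(2)[OF \<sigma>]
  have refl: "?E i i" if "i \<in> {1..k+1}" for i using that k same_refl[OF p] by auto
  have sym: "?E i j \<Longrightarrow> ?E j i" for i j using same_sym by blast
  have trans: "?E i j \<Longrightarrow> ?E j l \<Longrightarrow> ?E i l" for i j l using same_trans[OF p] by blast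
  show part: "partition_on {1..k+1} (restr k \<sigma>)"
    unfolding restr_def by (rule partition_rel_classes) (use refl sym trans in blast)+
  have eq: "same (restr k \<sigma>) i j \<longleftrightarrow> ?E i j" for i j
    unfolding restr_def by (rule same_rel_classes) (use refl sym trans in blast)+
  show "same (restr k \<sigma>) i j \<longleftrightarrow> same \<sigma> i j \<and> i \<in> {1..k+1} \<and> j \<in> {1..k+1}" by (rule eq)
  show "restr k \<sigma> \<in> NC (k + 1)"
    by (rule NC_I[OF part]) (use eq NC_D(2)[OF upper_NC_D(1)[OF \<sigma>]] in blast)
qed

lemma links_subset: "links n k \<sigma> \<subseteq> {k+1..n}"
  unfolding links_def by blast

lemma finite_links: "finite (links n k \<sigma>)"
  using links_subset finite_subset by blast

text \<open>The two coordinates determine the partition. Descending from the larger point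
  \<open>j\<close>, \<open>upper_intervals\<close> shows that each point above \<open>k\<close> down
  to \<open>i\<close> is in the block of \<open>j\<close>, so all links passed are present;
  conversely, present links can be composed.\<close>

lemma same_upper_NC:
  assumes \<sigma>: "\<sigma> \<in> upper_NC n k"
  shows "same \<sigma> i j \<longleftrightarrow> joined n k (restr k \<sigma>) (links n k \<sigma>) i j"
proof -
  note p = upper_NC_D(2)[OF \<sigma>]
  note tr = same_trans[OF p]
  have ui: "same \<sigma> y (Suc y)" if "k < y" "x \<le> y" "same \<sigma> x (Suc y)" for x y
    using upper_NC_D(3)[OF \<sigma>] that unfolding upper_intervals_def by blast
  have *: "same \<sigma> i j \<longleftrightarrow> joined n k (restr k \<sigma>) (links n k \<sigma>) i j" if ij: "i \<le> j" for i j
  proof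
    assume s: "same \<sigma> i j"
    then have mem: "i \<in> {1..n+1}" "j \<in> {1..n+1}" using same_mem[OF p] by auto
    have up: "same \<sigma> x j" if "i \<le> x" "k < x" "x \<le> j" for x
      using that(3,1,2)
    proof (induction rule: inc_induct)
      case base show ?case using mem same_refl[OF p] by blast
    next
      case (step x)
      then have "same \<sigma> (Suc x) j" by simp
      then have "same \<sigma> i (Suc x)" using s tr same_sym by blast
      then have "same \<sigma> x (Suc x)" using ui step by blast
      then show ?case using \<open>same \<sigma> (Suc x) j\<close> tr by blast
    qed
    have "x \<in> links n k \<sigma>" if x: "k < x" "i \<le> x" "x < j" for x
    proof -
      have "same \<sigma> x j" "same \<sigma> (Suc x) j" using up x by auto
      then have "same \<sigma> x (Suc x)" using tr same_sym by blast
      then show ?thesis unfolding links_def using x mem by auto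
    qed
    moreover have "same \<sigma> (min i (k+1)) (min j (k+1))"
    proof (cases "j \<le> k + 1")
      case True then show ?thesis using s ij by simp
    next
      case False
      show ?thesis
      proof (cases "i \<le> k + 1")
        case True
        then have "same \<sigma> (k + 1) j" using up[of "k + 1"] False by simp
        then have "same \<sigma> i (k + 1)" using s tr same_sym by blast
        then show ?thesis using True False by simp
      next
        case i: False
        have "same \<sigma> (k + 1) (k + 1)" using k by (subst same_refl[OF p]) simp
        then show ?thesis using i False by simp
      qed
    qed
    ultimately show "joined n k (restr k \<sigma>) (links n k \<sigma>) i j"
      unfolding joined_def same_restr[OF \<sigma>] using mem ij by auto
  next
    assume jn: "joined n k (restr k \<sigma>) (links n k \<sigma>) i j"
    then have mem: "i \<in> {1..n+1}" "j \<in> {1..n+1}" and sm: "same \<sigma> (min i (k+1)) (min j (k+1))"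
      unfolding joined_def same_restr[OF \<sigma>] by auto
    have lk: "same \<sigma> x (Suc x)" if "k < x" "i \<le> x" "x < j" for x
      using jn that ij unfolding joined_def links_def by auto
    have up: "same \<sigma> x j" if "i \<le> x" "k < x" "x \<le> j" for x
      using that(3,1,2)
    proof (induction rule: inc_induct)
      case base show ?case using mem same_refl[OF p] by blast
    next
      case (step x)
      then show ?case using lk[of x] tr[of x "Suc x" j] by simp
    qed
    show "same \<sigma> i j"
    proof (cases "k < i \<or> j \<le> k + 1")
      case True
      then show ?thesis using up[of i] ij sm by (auto simp: min_def split: if_splits)
    next
      case False
      then have "same \<sigma> i (k + 1)" "same \<sigma> (k + 1) j" using sm up[of "k + 1"] by (auto simp: min_def)
      then show ?thesis using tr by blast
    qed
  qed
  have sym: "joined n k (restr k \<sigma>) (links n k \<sigma>) i j \<longleftrightarrow> joined n k (restr k \<sigma>) (links n k \<sigma>) j i"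
    unfolding joined_def by (metis max.commute min.commute same_sym)
  show ?thesis
  proof (cases "i \<le> j")
    case False
    then show ?thesis using *[of j i] sym same_sym by (metis nat_le_linear)
  qed (rule *)
qed

lemma joined_mono:
  assumes "joined n k \<pi> S i j" "\<And>i j. same \<pi> i j \<Longrightarrow> same \<pi>' i j" "S \<subseteq> S'"
  shows "joined n k \<pi>' S' i j"
  using assms unfolding joined_def by blast

lemma refines_upper_NC:
  assumes \<sigma>: "\<sigma> \<in> upper_NC n k" and \<tau>: "\<tau> \<in> upper_NC n k"
  shows "refines {1..n+1} \<sigma> \<tau> \<longleftrightarrow>
    refines {1..k+1} (restr k \<sigma>) (restr k \<tau>) \<and> links n k \<sigma> \<subseteq> links n k \<tau>"
proof
  assume "refines {1..n+1} \<sigma> \<tau>"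
  then have *: "same \<sigma> i j \<Longrightarrow> same \<tau> i j" for i j by (rule refines_same)
  have "refines {1..k+1} (restr k \<sigma>) (restr k \<tau>)"
    unfolding refines_iff_same[OF partition_restr[OF \<sigma>] partition_restr[OF \<tau>]]
      same_restr[OF \<sigma>] same_restr[OF \<tau>] using * by blast
  moreover have "links n k \<sigma> \<subseteq> links n k \<tau>" unfolding links_def using * by blast
  ultimately show "refines {1..k+1} (restr k \<sigma>) (restr k \<tau>) \<and> links n k \<sigma> \<subseteq> links n k \<tau>" by blast
next
  assume *: "refines {1..k+1} (restr k \<sigma>) (restr k \<tau>) \<and> links n k \<sigma> \<subseteq> links n k \<tau>"
  have "same \<tau> i j" if "same \<sigma> i j" for i j
  proof -
    have "joined n k (restr k \<sigma>) (links n k \<sigma>) i j" using that same_upper_NC[OF \<sigma>] by simp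
    then have "joined n k (restr k \<tau>) (links n k \<tau>) i j"
      by (rule joined_mono) (use * refines_same in blast)+
    then show ?thesis using same_upper_NC[OF \<tau>] by simp
  qed
  then show "refines {1..n+1} \<sigma> \<tau>"
    unfolding refines_iff_same[OF upper_NC_D(2)[OF \<sigma>] upper_NC_D(2)[OF \<tau>]] by blast
qed

lemma upper_NC_eqI:
  assumes \<sigma>: "\<sigma> \<in> upper_NC n k" and \<tau>: "\<tau> \<in> upper_NC n k"
    and "restr k \<sigma> = restr k \<tau>" "links n k \<sigma> = links n k \<tau>"
  shows "\<sigma> = \<tau>"
  by (rule partition_eqI[OF upper_NC_D(2)[OF \<sigma>] upper_NC_D(2)[OF \<tau>]])
    (simp add: same_upper_NC[OF \<sigma>] same_upper_NC[OF \<tau>] assms(3,4))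

lemma card_upper_NC:
  assumes \<sigma>: "\<sigma> \<in> upper_NC n k"
  shows "card \<sigma> + card (links n k \<sigma>) = card (restr k \<sigma>) + (n - k)"
proof -
  note p = upper_NC_D(2)[OF \<sigma>]
  \<comment> \<open>A point \<open>j+1\<close> above \<open>k+1\<close> is least in its block
    exactly if the link \<open>j\<close> is missing; the other least elements are those of the
    restriction.\<close>
  let ?U = "Suc ` ({k+1..n} - links n k \<sigma>)"
  have ui: "same \<sigma> y (Suc y)" if "k < y" "x \<le> y" "same \<sigma> x (Suc y)" for x y
    using upper_NC_D(3)[OF \<sigma>] that unfolding upper_intervals_def by blast
  have "i \<in> mins \<sigma> \<longleftrightarrow> i \<in> mins (restr k \<sigma>) \<union> ?U" for i
  proof (cases "i \<le> k + 1")
    case True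
    then have "i \<notin> ?U" by auto
    moreover have "i \<in> mins \<sigma> \<longleftrightarrow> i \<in> mins (restr k \<sigma>)"
    proof
      assume "i \<in> mins \<sigma>"
      then show "i \<in> mins (restr k \<sigma>)"
        unfolding mins_def same_restr[OF \<sigma>] using True same_mem[OF p] by auto
    next
      assume i: "i \<in> mins (restr k \<sigma>)"
      have "i \<le> j" if "same \<sigma> i j" for j
      proof (cases "j \<le> k + 1")
        case j: True
        then have "same (restr k \<sigma>) i j" unfolding same_restr[OF \<sigma>] using that True same_mem[OF p that] by auto
        then show ?thesis using i unfolding mins_def by blast
      qed (use True in simp)
      then show "i \<in> mins \<sigma>" using i unfolding mins_def same_restr[OF \<sigma>] by blast
    qed
    ultimately show ?thesis by blast
  next
    case False
    then have "i \<notin> mins (restr k \<sigma>)" unfolding mins_def same_restr[OF \<sigma>] by auto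
    moreover obtain j where j: "i = Suc j" "k < j" using False by (cases i) auto
    have "i \<in> mins \<sigma> \<longleftrightarrow> j \<in> {k+1..n} - links n k \<sigma>"
    proof
      assume i: "i \<in> mins \<sigma>"
      then have "i \<in> {1..n+1}" using same_mem[OF p] unfolding mins_def by blast
      moreover have "\<not> same \<sigma> j (Suc j)"
      proof
        assume "same \<sigma> j (Suc j)"
        then have "same \<sigma> i j" using j same_sym by blast
        then show False using i j unfolding mins_def by fastforce
      qed
      ultimately show "j \<in> {k+1..n} - links n k \<sigma>" unfolding links_def using j by auto
    next
      assume *: "j \<in> {k+1..n} - links n k \<sigma>"
      have "i \<le> l" if "same \<sigma> i l" for l
      proof (rule ccontr)
        assume "\<not> i \<le> l"
        then have "same \<sigma> j (Suc j)" using ui[of j l] that j same_sym by auto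
        then show False using * unfolding links_def by blast
      qed
      moreover have "same \<sigma> i i" using * j by (subst same_refl[OF p]) auto
      ultimately show "i \<in> mins \<sigma>" unfolding mins_def by blast
    qed
    then have "i \<in> mins \<sigma> \<longleftrightarrow> i \<in> ?U" using j by auto
    ultimately show ?thesis by blast
  qed
  then have eq: "mins \<sigma> = mins (restr k \<sigma>) \<union> ?U" by blast
  have "mins (restr k \<sigma>) \<inter> ?U = {}" unfolding mins_def same_restr[OF \<sigma>] by auto
  then have "card (mins \<sigma>) = card (mins (restr k \<sigma>)) + card ?U"
    unfolding eq using finite_mins[OF partition_restr[OF \<sigma>]] by (intro card_Un_disjoint) auto
  moreover have "card ?U = (n - k) - card (links n k \<sigma>)"
    using links_subset finite_links by (simp add: card_image card_Diff_subset)
  moreover have "card (links n k \<sigma>) \<le> n - k"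
    using card_mono[OF _ links_subset] by simp
  ultimately show ?thesis using card_mins[OF p] card_mins[OF partition_restr[OF \<sigma>]] by simp
qed

lemma omitted_step_restr:
  assumes \<sigma>: "\<sigma> \<in> upper_NC n k" and \<tau>: "\<tau> \<in> upper_NC n k"
  shows "omitted_step k \<sigma> \<tau> \<longleftrightarrow> omitted_step k (restr k \<sigma>) (restr k \<tau>)"
proof -
  have "Suc k \<le> i" if "\<not> i \<in> {1..k+1}" "same \<sigma> i (Suc k)" for i
    using that same_mem[OF upper_NC_D(2)[OF \<sigma>] that(2)] by auto
  then show ?thesis
    unfolding omitted_step_def same_restr[OF \<sigma>] same_restr[OF \<tau>] using k by auto
qed

text \<open>By \<open>card_upper_NC\<close> the rank is the sum of the ranks of the coordinates. A
  covering step raises it by one and lowers neither summand, so exactly one coordinate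
  moves.\<close>

lemma good_cover_iff:
  assumes \<sigma>: "\<sigma> \<in> upper_NC n k" and \<tau>: "\<tau> \<in> upper_NC n k"
  shows "good_cover n k \<sigma> \<tau> \<longleftrightarrow>
    (NC_cover (k + 1) (restr k \<sigma>) (restr k \<tau>) \<and> \<not> omitted_step k (restr k \<sigma>) (restr k \<tau>) \<and>
      links n k \<sigma> = links n k \<tau>) \<or>
    (restr k \<sigma> = restr k \<tau> \<and> (\<exists>j. j \<notin> links n k \<sigma> \<and> links n k \<tau> = insert j (links n k \<sigma>)))"
    (is "_ \<longleftrightarrow> ?A \<or> ?B")
proof -
  note c = card_upper_NC[OF \<sigma>] card_upper_NC[OF \<tau>]
  have g: "good_cover n k \<sigma> \<tau> \<longleftrightarrow> refines {1..k+1} (restr k \<sigma>) (restr k \<tau>) \<and>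
    links n k \<sigma> \<subseteq> links n k \<tau> \<and> card \<sigma> = Suc (card \<tau>) \<and> \<not> omitted_step k (restr k \<sigma>) (restr k \<tau>)"
    unfolding good_cover_def NC_cover_iff refines_upper_NC[OF \<sigma> \<tau>] omitted_step_restr[OF \<sigma> \<tau>]
    using upper_NC_D[OF \<sigma>] upper_NC_D[OF \<tau>] by blast
  show ?thesis
  proof
    assume "good_cover n k \<sigma> \<tau>"
    then have r: "refines {1..k+1} (restr k \<sigma>) (restr k \<tau>)" and l: "links n k \<sigma> \<subseteq> links n k \<tau>"
      and cs: "card \<sigma> = Suc (card \<tau>)" and o: "\<not> omitted_step k (restr k \<sigma>) (restr k \<tau>)"
      unfolding g by auto
    have l': "card (links n k \<sigma>) \<le> card (links n k \<tau>)" using card_mono[OF finite_links l] .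
    have sum: "card (restr k \<sigma>) + card (links n k \<tau>) = Suc (card (restr k \<tau>) + card (links n k \<sigma>))"
      using c cs by linarith
    show "?A \<or> ?B"
    proof (cases "restr k \<sigma> = restr k \<tau>")
      case True
      then have "card (links n k \<tau>) = Suc (card (links n k \<sigma>))" using sum by simp
      then have "card (links n k \<tau> - links n k \<sigma>) = 1"
        using l finite_links by (simp add: card_Diff_subset)
      then obtain j where "links n k \<tau> - links n k \<sigma> = {j}" using card_1_singletonE by blast
      then have "j \<notin> links n k \<sigma>" "links n k \<tau> = insert j (links n k \<sigma>)" using l by blast+
      then show ?thesis using True by blast
    next
      case False
      then have less: "card (restr k \<tau>) < card (restr k \<sigma>)" using refines_card_less r by blast
      then have cl: "card (links n k \<sigma>) = card (links n k \<tau>)" and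
        cr: "card (restr k \<sigma>) = Suc (card (restr k \<tau>))" using sum l' by linarith+
      have "links n k \<sigma> = links n k \<tau>" using card_subset_eq[OF finite_links l cl] .
      then show ?thesis
        unfolding NC_cover_iff using r o cr restr_NC[OF \<sigma>] restr_NC[OF \<tau>] by blast
    qed
  next
    assume "?A \<or> ?B"
    then show "good_cover n k \<sigma> \<tau>"
    proof
      assume ?A
      then show ?thesis unfolding g NC_cover_iff using c by auto
    next
      assume ?B
      then obtain j where B: "restr k \<sigma> = restr k \<tau>" "j \<notin> links n k \<sigma>"
        "links n k \<tau> = insert j (links n k \<sigma>)" by blast
      have "card (links n k \<tau>) = Suc (card (links n k \<sigma>))" using B finite_links by simp
      then have "card \<sigma> = Suc (card \<tau>)" using c B(1) by simp
      \<comment> \<open>A constant restriction is never an omitted step, since \<open>k\<close> and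
        \<open>k+1\<close> would have to be both separated and joined in it.\<close>
      moreover have "\<not> omitted_step k (restr k \<sigma>) (restr k \<tau>)"
        unfolding B(1) omitted_step_def by fastforce
      ultimately show ?thesis
        unfolding g using B refines_refl[OF partition_restr[OF \<tau>]] by auto
    qed
  qed
qed

section \<open>From coordinates back to partitions\<close>

context
  fixes \<pi> :: "nat set set" and S :: "nat set"
  assumes \<pi>: "\<pi> \<in> NC (k + 1)" and S: "S \<subseteq> {k+1..n}"
begin

lemma
  shows joined_refl: "i \<in> {1..n+1} \<Longrightarrow> joined n k \<pi> S i i"
    and joined_sym: "joined n k \<pi> S i j \<Longrightarrow> joined n k \<pi> S j i"
    and joined_trans: "joined n k \<pi> S i j \<Longrightarrow> joined n k \<pi> S j l \<Longrightarrow> joined n k \<pi> S i l"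
proof -
  note p = NC_D(1)[OF \<pi>]
  show "i \<in> {1..n+1} \<Longrightarrow> joined n k \<pi> S i i"
    unfolding joined_def using same_refl[OF p] by (auto simp: min_def)
  show "joined n k \<pi> S i j \<Longrightarrow> joined n k \<pi> S j i"
    unfolding joined_def by (metis max.commute min.commute same_sym)
  assume ij: "joined n k \<pi> S i j" and jl: "joined n k \<pi> S j l"
  have "same \<pi> (min i (k+1)) (min l (k+1))" using ij jl same_trans[OF p] unfolding joined_def by blast
  moreover have "x \<in> S" if x: "k < x" "min i l \<le> x" "x < max i l" for x
  proof -
    have "(min i j \<le> x \<and> x < max i j) \<or> (min j l \<le> x \<and> x < max j l)" using x by linarith
    then show ?thesis using ij jl x unfolding joined_def by blast
  qed
  ultimately show "joined n k \<pi> S i l" using ij jl unfolding joined_def by blast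
qed

lemma
  shows partition_assemble: "partition_on {1..n+1} (assemble n k \<pi> S)"
    and same_assemble: "same (assemble n k \<pi> S) i j \<longleftrightarrow> joined n k \<pi> S i j"
proof -
  have mem: "joined n k \<pi> S i j \<Longrightarrow> i \<in> {1..n+1} \<and> j \<in> {1..n+1}" for i j
    unfolding joined_def by blast
  show "partition_on {1..n+1} (assemble n k \<pi> S)"
    unfolding assemble_def
    by (rule partition_rel_classes) (use mem joined_refl joined_sym joined_trans in blast)+
  show "same (assemble n k \<pi> S) i j \<longleftrightarrow> joined n k \<pi> S i j"
    unfolding assemble_def
    by (rule same_rel_classes) (use mem joined_refl joined_sym joined_trans in blast)+
qed

text \<open>Contraction is weakly monotone, so two crossing pairs are sent to crossing pairs of
  \<pi>, or two neighbouring points coincide and the first two points are joined anyway. The links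
  between \<open>a\<close> and \<open>b\<close> are among those between \<open>a\<close> and
  \<open>c\<close>.\<close>

lemma assemble_upper_NC: "assemble n k \<pi> S \<in> upper_NC n k"
proof -
  note p = NC_D(1)[OF \<pi>]
  have "assemble n k \<pi> S \<in> NC (n + 1)"
  proof (rule NC_I[OF partition_assemble])
    fix a b c d assume abcd: "a < b" "b < c" "c < d"
      and "same (assemble n k \<pi> S) a c" "same (assemble n k \<pi> S) b d"
    then have ac: "joined n k \<pi> S a c" and bd: "joined n k \<pi> S b d"
      unfolding same_assemble by auto
    let ?h = "\<lambda>i. min i (k + 1)"
    have h: "?h a \<le> ?h b" "?h b \<le> ?h c" "?h c \<le> ?h d" using abcd by auto
    have s: "same \<pi> (?h a) (?h c)" "same \<pi> (?h b) (?h d)" using ac bd unfolding joined_def by auto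
    have mem: "?h a \<in> {1..k+1}" "?h b \<in> {1..k+1}" using ac bd unfolding joined_def by auto
    have "same \<pi> (?h a) (?h b)"
    proof (cases "?h a < ?h b \<and> ?h b < ?h c \<and> ?h c < ?h d")
      case True
      then show ?thesis using NC_D(2)[OF \<pi>] s by blast
    next
      case False
      then consider "?h a = ?h b" | "?h b = ?h c" | "?h c = ?h d" using h by linarith
      then show ?thesis
      proof cases
        case 1 then show ?thesis using same_refl[OF p] mem by metis
      next
        case 2 then show ?thesis using s by metis
      next
        case 3 then show ?thesis using s same_sym same_trans[OF p] by metis
      qed
    qed
    moreover have "x \<in> S" if "k < x" "min a b \<le> x" "x < max a b" for x
      using ac that abcd unfolding joined_def by auto
    ultimately have "joined n k \<pi> S a b" using ac bd unfolding joined_def by blast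
    then show "same (assemble n k \<pi> S) a b" unfolding same_assemble .
  qed
  moreover have "upper_intervals k (assemble n k \<pi> S)"
    unfolding upper_intervals_def same_assemble
  proof (intro allI impI)
    fix i j assume *: "k < j" "i \<le> j" "joined n k \<pi> S i (Suc j)"
    then have "j \<in> S" "Suc j \<le> n + 1" unfolding joined_def by auto
    moreover have "same \<pi> (k+1) (k+1)" by (subst same_refl[OF p]) simp
    moreover have "x = j" if "min j (Suc j) \<le> x" "x < max j (Suc j)" for x using that by simp
    ultimately show "joined n k \<pi> S j (Suc j)" unfolding joined_def using * by (auto simp: less_Suc_eq)
  qed
  ultimately show ?thesis unfolding upper_NC_def by blast
qed

lemma restr_assemble: "restr k (assemble n k \<pi> S) = \<pi>"
proof (rule partition_eqI[OF partition_restr[OF assemble_upper_NC] NC_D(1)[OF \<pi>]])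
  fix i j
  show "same (restr k (assemble n k \<pi> S)) i j \<longleftrightarrow> same \<pi> i j"
    unfolding same_restr[OF assemble_upper_NC] same_assemble joined_def
    using same_mem[OF NC_D(1)[OF \<pi>], of i j] k by (auto simp: min_def)
qed

lemma links_assemble: "links n k (assemble n k \<pi> S) = S"
proof -
  have "same \<pi> (k+1) (k+1)" by (subst same_refl[OF NC_D(1)[OF \<pi>]]) simp
  then have "joined n k \<pi> S j (Suc j) \<longleftrightarrow> j \<in> S" if "j \<in> {k+1..n}" for j
    unfolding joined_def using that by (auto simp: less_Suc_eq_le)
  then show ?thesis unfolding links_def same_assemble using S by blast
qed

end

lemma assemble_restr_links:
  assumes \<sigma>: "\<sigma> \<in> upper_NC n k"
  shows "assemble n k (restr k \<sigma>) (links n k \<sigma>) = \<sigma>"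
  using upper_NC_eqI[OF assemble_upper_NC[OF restr_NC[OF \<sigma>] links_subset] \<sigma>
      restr_assemble[OF restr_NC[OF \<sigma>] links_subset] links_assemble[OF restr_NC[OF \<sigma>] links_subset]] .

end

section \<open>Cyclic successor permutations\<close>

text \<open>The last disjunct wraps around from the largest element of a block to the least; on a
  singleton it gives a fixed point.\<close>

definition is_next :: "nat set set \<Rightarrow> nat \<Rightarrow> nat \<Rightarrow> bool" where
  "is_next \<sigma> i j \<longleftrightarrow> same \<sigma> i j \<and>
    (i < j \<and> (\<forall>x. i < x \<longrightarrow> x < j \<longrightarrow> \<not> same \<sigma> i x) \<or> (\<forall>x. same \<sigma> i x \<longrightarrow> j \<le> x \<and> x \<le> i))"

text \<open>The value \<open>i\<close> outside the ground set is what \<open>permutes\<close>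
  demands.\<close>

definition next_in_block :: "nat set set \<Rightarrow> nat \<Rightarrow> nat" where
  "next_in_block \<sigma> i = (if same \<sigma> i i then THE j. is_next \<sigma> i j else i)"

lemma is_next_unique:
  assumes "is_next \<sigma> i j" "is_next \<sigma> i j'"
  shows "j = j'"
proof -
  have *: "j \<le> j'" if "is_next \<sigma> i j" "is_next \<sigma> i j'" for j j'
    using that unfolding is_next_def by (metis leD leI less_le_trans)
  show ?thesis using *[OF assms] *[OF assms(2,1)] by simp
qed

lemma is_next_ex:
  assumes p: "partition_on {1..m} \<sigma>" and i: "i \<in> {1..m}"
  shows "\<exists>j. is_next \<sigma> i j"
proof (cases "\<exists>j. i < j \<and> same \<sigma> i j")
  case True
  let ?j = "LEAST j. i < j \<and> same \<sigma> i j"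
  have "i < ?j \<and> same \<sigma> i ?j" using True by (rule LeastI_ex)
  moreover have "\<not> same \<sigma> i x" if "i < x" "x < ?j" for x using not_less_Least[OF that(2)] that(1) by blast
  ultimately show ?thesis unfolding is_next_def by blast
next
  case False
  let ?j = "LEAST j. same \<sigma> i j"
  have "same \<sigma> i i" using same_refl[OF p] i by blast
  then have "same \<sigma> i ?j" by (rule LeastI)
  moreover have "?j \<le> x \<and> x \<le> i" if "same \<sigma> i x" for x
    using that False Least_le[of "same \<sigma> i" x] by (meson not_le)
  ultimately show ?thesis unfolding is_next_def by blast
qed

lemma next_in_block_eq:
  assumes p: "partition_on {1..m} \<sigma>" and "is_next \<sigma> i j"
  shows "next_in_block \<sigma> i = j"
proof -
  have "same \<sigma> i i" using assms same_refl[OF p] same_mem[OF p] unfolding is_next_def by blast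
  moreover have "(THE j. is_next \<sigma> i j) = j" using is_next_unique assms(2) by (intro the_equality) auto
  ultimately show ?thesis unfolding next_in_block_def by simp
qed

lemma is_next_next_in_block:
  "partition_on {1..m} \<sigma> \<Longrightarrow> i \<in> {1..m} \<Longrightarrow> is_next \<sigma> i (next_in_block \<sigma> i)"
  using is_next_ex next_in_block_eq by metis

lemma next_in_block_outside:
  "partition_on {1..m} \<sigma> \<Longrightarrow> i \<notin> {1..m} \<Longrightarrow> next_in_block \<sigma> i = i"
  unfolding next_in_block_def using same_refl by metis

lemma is_next_inj:
  assumes p: "partition_on {1..m} \<sigma>" and "is_next \<sigma> i j" "is_next \<sigma> i' j"
  shows "i = i'"
proof -
  have *: "\<not> i < i'" if ii: "is_next \<sigma> i j" "is_next \<sigma> i' j" for i i'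
  proof
    assume less: "i < i'"
    have "same \<sigma> i i'" "same \<sigma> i' i"
      using ii same_sym same_trans[OF p] unfolding is_next_def by blast+
    then show False using ii less unfolding is_next_def by (metis leD less_trans)
  qed
  show ?thesis using *[OF assms(2,3)] *[OF assms(3,2)] by simp
qed

lemma next_in_block_permutes:
  assumes p: "partition_on {1..m} \<sigma>"
  shows "next_in_block \<sigma> permutes {1..m}"
proof (rule bij_imp_permutes)
  have mem: "next_in_block \<sigma> i \<in> {1..m}" if "i \<in> {1..m}" for i
    using is_next_next_in_block[OF p that] same_mem[OF p] unfolding is_next_def by blast
  have "inj_on (next_in_block \<sigma>) {1..m}"
    by (rule inj_onI) (metis is_next_inj[OF p] is_next_next_in_block[OF p])
  moreover from this have "next_in_block \<sigma> ` {1..m} = {1..m}"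
    by (rule endo_inj_surj[rotated 2]) (use mem in blast)+
  ultimately show "bij_betw (next_in_block \<sigma>) {1..m} {1..m}"
    unfolding bij_betw_def by blast
qed (rule next_in_block_outside[OF p])

text \<open>Moving upwards reaches every larger element of the block; the smaller ones follow
  because lying in a common cycle is symmetric.\<close>

lemma orbit_next_in_block:
  assumes p: "partition_on {1..m} \<sigma>" and i: "i \<in> {1..m}"
  shows "orbit (next_in_block \<sigma>) i = {j. same \<sigma> i j}"
proof
  let ?f = "next_in_block \<sigma>"
  have f: "same \<sigma> x (?f x)" if "x \<in> {1..m}" for x
    using is_next_next_in_block[OF p that] unfolding is_next_def by blast
  show "orbit ?f i \<subseteq> {j. same \<sigma> i j}"
  proof
    fix j assume "j \<in> orbit ?f i"
    then have "same \<sigma> i j"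
    proof induct
      case base show ?case using f i by blast
    next
      case (step y)
      then show ?case using f[of y] same_mem[OF p] same_trans[OF p] by blast
    qed
    then show "j \<in> {j. same \<sigma> i j}" by simp
  qed
  have perm: "permutation ?f" using next_in_block_permutes[OF p] by (auto simp: permutation_permutes)
  have up: "y \<in> orbit ?f x" if "x < y" "same \<sigma> x y" for x y
    using that
  proof (induction "y - x" arbitrary: x rule: less_induct)
    case less
    have x: "x \<in> {1..m}" using less same_mem[OF p] by blast
    have nx: "is_next \<sigma> x (?f x)" using is_next_next_in_block[OF p x] .
    then have l: "x < ?f x" "?f x \<le> y" using less(2,3) unfolding is_next_def by (metis leD not_le)+
    show ?case
    proof (cases "?f x = y")
      case True then show ?thesis using orbit.base[of ?f x] by simp
    next
      case False
      have "same \<sigma> (?f x) y" using f[OF x] less(3) same_sym same_trans[OF p] by blast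
      then have "y \<in> orbit ?f (?f x)" using less(1)[of "?f x"] l False by simp
      then show ?thesis by (rule orbit_subset)
    qed
  qed
  show "{j. same \<sigma> i j} \<subseteq> orbit ?f i"
  proof
    fix j assume "j \<in> {j. same \<sigma> i j}"
    then have ij: "same \<sigma> i j" by simp
    consider "i < j" | "i = j" | "j < i" by linarith
    then show "j \<in> orbit ?f i"
    proof cases
      case 2 then show ?thesis using permutation_self_in_orbit[OF perm] by simp
    next
      case 3
      then have "i \<in> orbit ?f j" using up ij same_sym by blast
      then show ?thesis using orbit_swap[OF permutation_self_in_orbit[OF perm]] by blast
    qed (use up ij in blast)
  qed
qed

lemma next_in_block_inj:
  assumes \<sigma>: "partition_on {1..m} \<sigma>" and \<tau>: "partition_on {1..m} \<tau>"
    and eq: "next_in_block \<sigma> = next_in_block \<tau>"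
  shows "\<sigma> = \<tau>"
proof (rule partition_eqI[OF \<sigma> \<tau>])
  fix i j
  show "same \<sigma> i j \<longleftrightarrow> same \<tau> i j"
  proof (cases "i \<in> {1..m}")
    case True
    then have "{j. same \<sigma> i j} = {j. same \<tau> i j}"
      using orbit_next_in_block[OF \<sigma> True] orbit_next_in_block[OF \<tau> True] eq by simp
    then show ?thesis by blast
  next
    case False
    then show ?thesis using same_mem[OF \<sigma>] same_mem[OF \<tau>] by blast
  qed
qed

text \<open>By noncrossing, \<open>B2\<close> sits in the gap of \<open>B1\<close> right after
  \<open>lab\<close>. The merged cycle therefore runs from \<open>lab\<close> to
  \<open>Min B2\<close>, the old successor of \<open>Max B2\<close>, through \<open>B2\<close> up to
  \<open>Max B2\<close>, and on to the old successor of \<open>lab\<close>: these two successors are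
  exchanged and all others are kept.\<close>

lemma (in merging) next_in_block_merge:
  assumes \<sigma>: "\<sigma> \<in> NC m"
  shows "next_in_block \<tau> = next_in_block \<sigma> \<circ> swap lab (Max B2)"
proof
  fix i
  let ?b = "Max B2" and ?t = "swap lab (Max B2)" and ?f = "next_in_block \<sigma>"
  have b: "?b \<in> B2" using fin ne by simp
  have B2: "lab < y \<and> y \<le> ?b" if "y \<in> B2" for y using lab(2) that fin by simp
  \<comment> \<open>Otherwise, by maximality of \<open>lab\<close>, some \<open>y\<close> in
    \<open>B2\<close> is below \<open>x\<close>, and \<open>lab < y < x < Max B2\<close> is a
    crossing.\<close>
  have B1: "x \<le> lab \<or> ?b < x" if x: "x \<in> B1" for x
  proof (rule ccontr)
    assume n: "\<not> (x \<le> lab \<or> ?b < x)"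
    then obtain y where y: "y \<in> B2" "\<not> x < y" using lab(3) x by blast
    have "x \<noteq> y" "x \<noteq> ?b" using x y b dis by auto
    then have "lab < y" "y < x" "x < ?b" using n y B2 by auto
    moreover have "same \<sigma> lab x" "same \<sigma> y ?b" using same_B1 same_B2 lab(1) x y b by auto
    ultimately have "same \<sigma> lab y" using NC_D(2)[OF \<sigma>] by blast
    then show False using same_B1[OF lab(1)] y dis by auto
  qed
  have disj: "x \<notin> B2" if "x \<in> B1" for x using dis that by auto
  have lab_b: "lab \<noteq> ?b" using lab(1) b disj by auto
  show "next_in_block \<tau> i = (?f \<circ> ?t) i"
  proof (cases "i \<in> {1..m}")
    case False
    then have "i \<noteq> lab" "i \<noteq> ?b" using lab(1) b sub by auto
    then show ?thesis using False next_in_block_outside[OF part] next_in_block_outside[OF part'] by simp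
  next
    case True
    have "?t i \<in> {1..m}" using True lab(1) b sub by (auto simp: Transposition.transpose_def)
    then have nx: "is_next \<sigma> (?t i) (?f (?t i))" by (rule is_next_next_in_block[OF part])
    define j where "j = ?f (?t i)"
    consider "i \<notin> B1 \<union> B2" | "i \<in> B1" "i \<noteq> lab" | "i = lab" | "i \<in> B2" "i \<noteq> ?b" | "i = ?b" by blast
    then have "is_next \<tau> i j"
    proof cases
      case 1
      then have "i \<noteq> lab" "i \<noteq> ?b" using lab(1) b by auto
      then have "?t i = i" by simp
      then have n: "is_next \<sigma> i j" using nx unfolding j_def by simp
      have "same \<tau> i x \<longleftrightarrow> same \<sigma> i x" for x using same_iff 1 by blast
      then show ?thesis using n unfolding is_next_def by simp
    next
      case 2
      then have "i \<noteq> lab" "i \<noteq> ?b" using b disj by auto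
      then have "?t i = i" by simp
      then have n: "is_next \<sigma> i j" using nx unfolding j_def by simp
      then have j: "j \<in> B1" unfolding is_next_def using same_B1[OF 2(1)] by blast
      have s: "same \<tau> i x \<longleftrightarrow> x \<in> B1 \<or> x \<in> B2" for x using same_iff same_B1[OF 2(1)] 2 by blast
      show ?thesis
      proof (cases "i < j \<and> (\<forall>x. i < x \<longrightarrow> x < j \<longrightarrow> x \<notin> B1)")
        case up: True
        have "x \<notin> B2" if x: "i < x" "x < j" for x
        proof
          assume "x \<in> B2"
          then have "lab < x" "x \<le> ?b" using B2 by auto
          then have "i < lab" using B1[OF 2(1)] 2(2) x by linarith
          then show False using up lab(1) \<open>lab < x\<close> x by (meson less_trans)
        qed
        then show ?thesis unfolding is_next_def s using up j by blast
      next
        case False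
        then have w: "j \<le> x \<and> x \<le> i" if "x \<in> B1" for x
          using n that unfolding is_next_def same_B1[OF 2(1)] by blast
        then have "lab < i" using lab(1) 2(2) by (metis le_neq_implies_less)
        then have "?b < i" using B1[OF 2(1)] by linarith
        moreover have "j \<le> lab" using w lab(1) by blast
        ultimately have "j \<le> x \<and> x \<le> i" if "x \<in> B2" for x using B2[OF that] by linarith
        then show ?thesis unfolding is_next_def s using w j by blast
      qed
    next
      case 3
      then have "?t i = ?b" by simp
      then have n: "is_next \<sigma> ?b j" using nx unfolding j_def by simp
      then have j: "j \<in> B2" unfolding is_next_def using same_B2[OF b] by blast
      then have "\<not> ?b < j" using B2 by force
      then have w: "j \<le> x" if "x \<in> B2" for x
        using n that unfolding is_next_def same_B2[OF b] by blast
      have s: "same \<tau> i x \<longleftrightarrow> x \<in> B1 \<or> x \<in> B2" for x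
        using same_iff same_B1[OF lab(1)] lab(1) unfolding 3 by blast
      have "i < j" using B2[OF j] 3 by simp
      moreover have "\<not> (x \<in> B1 \<or> x \<in> B2)" if x: "i < x" "x < j" for x
        using B1[of x] w[of x] B2[OF j] x 3 by fastforce
      ultimately show ?thesis unfolding is_next_def s using j by blast
    next
      case 4
      then have "i \<noteq> lab" "i \<noteq> ?b" using lab(1) disj by auto
      then have "?t i = i" by simp
      then have n: "is_next \<sigma> i j" using nx unfolding j_def by simp
      then have j: "j \<in> B2" unfolding is_next_def using same_B2[OF 4(1)] by blast
      have s: "same \<tau> i x \<longleftrightarrow> x \<in> B1 \<or> x \<in> B2" for x using same_iff same_B2[OF 4(1)] 4 by blast
      have "i < ?b" using B2[OF 4(1)] 4(2) by simp
      then have up: "i < j" "\<And>x. i < x \<Longrightarrow> x < j \<Longrightarrow> x \<notin> B2"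
        using n b unfolding is_next_def same_B2[OF 4(1)] by (metis leD)+
      moreover have "x \<notin> B1" if "i < x" "x < j" for x
        using B1[of x] B2[OF 4(1)] B2[OF j] that by fastforce
      ultimately show ?thesis unfolding is_next_def s using j by blast
    next
      case 5
      then have "?t i = lab" by simp
      then have n: "is_next \<sigma> lab j" using nx unfolding j_def by simp
      then have j: "j \<in> B1" unfolding is_next_def using same_B1[OF lab(1)] by blast
      have s: "same \<tau> i x \<longleftrightarrow> x \<in> B1 \<or> x \<in> B2" for x
        using same_iff same_B2[OF b] b unfolding 5 by blast
      show ?thesis
      proof (cases "lab < j \<and> (\<forall>x. lab < x \<longrightarrow> x < j \<longrightarrow> x \<notin> B1)")
        case up: True
        then have "?b < j" using B1[OF j] by linarith
        moreover have "\<not> (x \<in> B1 \<or> x \<in> B2)" if x: "?b < x" "x < j" for x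
          using up B2[OF b] B2[of x] x by (meson leD less_trans)
        ultimately show ?thesis unfolding is_next_def s unfolding 5 using j by blast
      next
        case False
        then have w: "j \<le> x \<and> x \<le> lab" if "x \<in> B1" for x
          using n that unfolding is_next_def same_B1[OF lab(1)] by blast
        have "j \<le> x \<and> x \<le> ?b" if "x \<in> B1 \<or> x \<in> B2" for x
          using that w[of x] w[OF lab(1)] B2[of x] B2[OF b] by linarith
        then show ?thesis unfolding is_next_def s unfolding 5 using j by blast
      qed
    qed
    then show ?thesis using next_in_block_eq[OF part'] unfolding j_def by simp
  qed
qed

text \<open>The block of \<open>a\<close> and \<open>b\<close> is cut into the arc \<open>(a, b]\<close> and the rest.\<close>

lemma split_block:
  assumes \<tau>: "\<tau> \<in> NC m" and ab: "a < b" "same \<tau> a b"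
  obtains B1 B2 \<sigma> where "\<sigma> \<in> NC m" "merging m B1 B2 \<sigma> \<tau>" "merging.lab B1 B2 = a" "Max B2 = b"
proof -
  note p = NC_D(1)[OF \<tau>]
  note tr = same_trans[OF p]
  define P where "P i \<longleftrightarrow> same \<tau> a i \<and> a < i \<and> i \<le> b" for i
  define E where "E i j \<longleftrightarrow> same \<tau> i j \<and> (P i \<longleftrightarrow> P j)" for i j
  define \<sigma> where "\<sigma> = rel_classes {1..m} E"
  have mem: "E i j \<Longrightarrow> i \<in> {1..m} \<and> j \<in> {1..m}" for i j unfolding E_def using same_mem[OF p] by blast
  have refl: "i \<in> {1..m} \<Longrightarrow> E i i" for i unfolding E_def using same_refl[OF p] by blast
  have sym: "E i j \<Longrightarrow> E j i" for i j unfolding E_def using same_sym by blast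
  have trans: "E i j \<Longrightarrow> E j l \<Longrightarrow> E i l" for i j l unfolding E_def using tr by blast
  have ps: "partition_on {1..m} \<sigma>"
    unfolding \<sigma>_def by (rule partition_rel_classes) (use mem refl sym trans in blast)+
  have s: "same \<sigma> i j \<longleftrightarrow> E i j" for i j
    unfolding \<sigma>_def by (rule same_rel_classes) (use mem refl sym trans in blast)+
  have am: "a \<in> {1..m}" "b \<in> {1..m}" using same_mem[OF p ab(2)] by auto
  define B1 where "B1 = {j. E a j}"
  define B2 where "B2 = {j. E b j}"
  have "\<not> P a" "P b" unfolding P_def using ab by auto
  then have B1: "j \<in> B1 \<longleftrightarrow> same \<tau> a j \<and> \<not> P j" and B2: "j \<in> B2 \<longleftrightarrow> P j" for j
    unfolding B1_def B2_def E_def using ab tr same_sym P_def by blast+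
  have U: "j \<in> B1 \<union> B2 \<longleftrightarrow> same \<tau> a j" for j using B1 B2 unfolding P_def by blast
  have blocks: "B1 \<in> \<sigma>" "B2 \<in> \<sigma>" unfolding \<sigma>_def rel_classes_def B1_def B2_def using am by auto
  have a1: "a \<in> B1" and b2: "b \<in> B2" using B1 B2 \<open>\<not> P a\<close> \<open>P b\<close> same_refl[OF p] am by auto
  have fin: "finite B1" "finite B2"
    using B1 B2 same_mem[OF p] unfolding P_def by (auto intro!: finite_subset[of _ "{1..m}"])
  have "Min (B1 \<union> B2) \<in> B1 \<union> B2" using fin a1 by (intro Min_in) auto
  moreover have "Min (B1 \<union> B2) \<notin> B2"
  proof
    assume "Min (B1 \<union> B2) \<in> B2"
    then have "a < Min (B1 \<union> B2)" unfolding B2 P_def by blast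
    moreover have "Min (B1 \<union> B2) \<le> a" using fin a1 by (intro Min_le) auto
    ultimately show False by simp
  qed
  ultimately have mn: "Min (B1 \<union> B2) \<in> B1" by blast
  define \<tau>' where "\<tau>' = insert (B1 \<union> B2) (\<sigma> - {B1, B2})"
  have "B1 \<noteq> B2" using a1 B2 \<open>\<not> P a\<close> by auto
  then have "merges B1 B2 \<sigma> \<tau>'" unfolding merges_def \<tau>'_def using blocks mn by blast
  then have mg: "merging m B1 B2 \<sigma> \<tau>'" using ps by unfold_locales
  have "\<tau>' = \<tau>"
  proof (rule partition_eqI[OF merging.part'[OF mg] p])
    fix i j
    show "same \<tau>' i j \<longleftrightarrow> same \<tau> i j"
      unfolding merging.same_iff[OF mg] s U
      unfolding E_def P_def using tr[of i a j] tr[of a i j] tr[of a j i] same_sym by metis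
  qed
  then have mg: "merging m B1 B2 \<sigma> \<tau>" using mg by simp
  interpret merging m B1 B2 \<sigma> \<tau> by (rule mg)
  have "\<sigma> \<in> NC m"
  proof (rule NC_I[OF ps])
    fix w x y z assume l: "w < x" "x < y" "y < z" and "same \<sigma> w y" "same \<sigma> x z"
    then have E: "E w y" "E x z" using s by auto
    then have wx: "same \<tau> w x" using NC_D(2)[OF \<tau> l] unfolding E_def by blast
    \<comment> \<open>Within the block of \<open>a\<close> the arc is convex. If it contains
      \<open>w\<close> and \<open>y\<close>, it contains \<open>x\<close>; if it contains
      \<open>x\<close> and \<open>z\<close>, it contains \<open>y\<close> and hence
      \<open>w\<close>.\<close>
    have "P w \<longleftrightarrow> P x"
    proof (cases "same \<tau> a w")
      case True
      then have "same \<tau> a x" "same \<tau> a y" "same \<tau> a z" using wx E tr unfolding E_def by blast+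
      then show ?thesis using E l True unfolding E_def P_def by auto
    next
      case False
      then have "\<not> same \<tau> a x" using wx tr same_sym by blast
      then show ?thesis using False unfolding P_def by blast
    qed
    then show "same \<sigma> w x" unfolding s E_def using wx by blast
  qed
  moreover have "lab = a"
  proof (rule antisym)
    show "a \<le> lab" using lab(3)[OF a1] B2 unfolding P_def by blast
    show "lab \<le> a"
    proof (rule ccontr)
      assume "\<not> lab \<le> a"
      then have "P lab" unfolding P_def using lab(1) lab(2)[OF b2] B1 by auto
      then show False using lab(1) B1 by blast
    qed
  qed
  moreover have "Max B2 = b" using b2 fin B2 by (intro Max_eqI) (auto simp: P_def)
  ultimately show thesis using that mg by blast
qed

section \<open>Noncrossing permutations and their allowed steps\<close>

definition NC_perms :: "nat \<Rightarrow> (nat \<Rightarrow> nat) set" where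
  "NC_perms m = next_in_block ` NC m"

lemma NC_perms_permutes: "p \<in> NC_perms m \<Longrightarrow> p permutes {1..m}"
  unfolding NC_perms_def using next_in_block_permutes NC_D(1) by blast

lemma next_in_block_split:
  assumes \<tau>: "\<tau> \<in> NC m" and ab: "a < b" "same \<tau> a b"
  obtains B1 B2 \<sigma> where "\<sigma> \<in> NC m" "merging m B1 B2 \<sigma> \<tau>" "merging.lab B1 B2 = a" "Max B2 = b"
    "next_in_block \<sigma> = next_in_block \<tau> \<circ> swap a b"
proof -
  obtain B1 B2 \<sigma> where *: "\<sigma> \<in> NC m" "merging m B1 B2 \<sigma> \<tau>" "merging.lab B1 B2 = a" "Max B2 = b"
    using split_block[OF assms] by blast
  have "next_in_block \<tau> = next_in_block \<sigma> \<circ> swap a b"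
    using merging.next_in_block_merge[OF *(2,1)] *(3,4) by simp
  then have "next_in_block \<sigma> = next_in_block \<tau> \<circ> swap a b" by (simp add: comp_assoc)
  then show thesis using that * by blast
qed

text \<open>If the product separates \<open>a\<close> and \<open>b\<close>, multiplying by the
  transposition once more joins them, so they share a cycle of the original permutation.\<close>

lemma split_orbit_same:
  assumes q: "\<tau> \<in> NC m" and ab: "a \<in> {1..m}" "b \<in> {1..m}"
    and b: "b \<notin> orbit (next_in_block \<tau> \<circ> swap a b) a"
  shows "same \<tau> a b" "a \<noteq> b"
proof -
  have "next_in_block \<tau> permutes {1..m}" using next_in_block_permutes NC_D(1)[OF q] .
  then have "permutation (next_in_block \<tau>)" by (auto simp: permutation_permutes)
  then have perm: "permutation (next_in_block \<tau> \<circ> swap a b)" by (rule permutation_comp_transpose)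
  have "b \<in> orbit (next_in_block \<tau>) a"
    using transpose_joins_orbits[OF perm b] by (simp add: comp_assoc)
  then show "same \<tau> a b" using orbit_next_in_block[OF NC_D(1)[OF q] ab(1)] by simp
  show "a \<noteq> b" using b permutation_self_in_orbit[OF perm] by auto
qed

text \<open>Provides the closure hypothesis of \<open>merge_step_interval_dual\<close>.\<close>

lemma NC_perms_split:
  assumes "q \<in> NC_perms m" and ab: "a \<in> {1..m}" "b \<in> {1..m}"
    and b: "b \<notin> orbit (q \<circ> swap a b) a"
  shows "q \<circ> swap a b \<in> NC_perms m"
proof -
  obtain \<tau> where \<tau>: "\<tau> \<in> NC m" "q = next_in_block \<tau>" using assms(1) unfolding NC_perms_def by blast
  have s: "same \<tau> a b" "a \<noteq> b" using split_orbit_same[OF \<tau>(1) ab] b unfolding \<tau>(2) by auto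
  then consider "a < b" | "b < a" by linarith
  then show ?thesis
  proof cases
    case 1
    then show ?thesis
      using next_in_block_split[OF \<tau>(1) 1 s(1)] unfolding NC_perms_def \<tau>(2) by (metis imageI)
  next
    case 2
    then show ?thesis
      using next_in_block_split[OF \<tau>(1) 2 same_sym[OF s(1)]]
      unfolding NC_perms_def \<tau>(2) by (metis imageI transpose_commute)
  qed
qed

text \<open>Since \<open>k+1\<close> is the last point, a block starting there is a singleton. So
  the omitted merges are exactly those with \<open>lab = k\<close> and
  \<open>Max B2 = Suc k\<close>, that is, multiplications by the excluded transposition.\<close>

lemma merge_step_iff:
  assumes \<pi>: "\<pi> \<in> NC (k + 1)" and \<pi>': "\<pi>' \<in> NC (k + 1)"
  shows "merge_step (NC_perms (k + 1)) {1..k + 1} k (Suc k) (next_in_block \<pi>) (next_in_block \<pi>') \<longleftrightarrow>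
    NC_cover (k + 1) \<pi> \<pi>' \<and> \<not> omitted_step k \<pi> \<pi>'"
proof
  assume *: "NC_cover (k + 1) \<pi> \<pi>' \<and> \<not> omitted_step k \<pi> \<pi>'"
  then obtain B1 B2 where "merging (k + 1) B1 B2 \<pi> \<pi>'" using NC_cover_merging by blast
  then interpret merging "k + 1" B1 B2 \<pi> \<pi>' .
  have b: "Max B2 \<in> B2" using fin ne by simp
  have eq: "next_in_block \<pi>' = next_in_block \<pi> \<circ> swap lab (Max B2)"
    using next_in_block_merge[OF \<pi>] .
  have mem: "lab \<in> {1..k+1}" "Max B2 \<in> {1..k+1}" using lab(1) b sub by auto
  have "Max B2 \<notin> orbit (next_in_block \<pi>) lab"
    unfolding orbit_next_in_block[OF part mem(1)] using same_B1[OF lab(1)] b dis by auto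
  moreover have "{lab, Max B2} \<noteq> {k, Suc k}"
  proof
    assume "{lab, Max B2} = {k, Suc k}"
    then have e: "lab = k" "Max B2 = Suc k" using lab(2)[OF b] by (auto simp: doubleton_eq_iff)
    have "Suc k \<le> i" if "same \<pi> i (Suc k)" for i
      using same_B2[OF b] same_sym[OF that] lab(2)[of i] e by simp
    moreover have "same \<pi>' k (Suc k)" using same_iff lab(1) b e by auto
    ultimately show False using * unfolding omitted_step_def by blast
  qed
  ultimately show "merge_step (NC_perms (k + 1)) {1..k + 1} k (Suc k) (next_in_block \<pi>) (next_in_block \<pi>')"
    unfolding merge_step_def NC_perms_def using eq mem \<pi> \<pi>' by blast
next
  let ?p = "next_in_block \<pi>" and ?q = "next_in_block \<pi>'"
  assume "merge_step (NC_perms (k + 1)) {1..k + 1} k (Suc k) ?p ?q"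
  then obtain a b where ab: "a \<in> {1..k+1}" "b \<in> {1..k+1}" "b \<notin> orbit ?p a" "{a, b} \<noteq> {k, Suc k}"
    "?q = ?p \<circ> swap a b" unfolding merge_step_def by blast
  have p: "?p = ?q \<circ> swap a b" unfolding ab(5) by (simp add: comp_assoc)
  have s: "same \<pi>' a b" "a \<noteq> b"
    using split_orbit_same[OF \<pi>' ab(1,2)] ab(3) unfolding p[symmetric] by auto
  have *: "NC_cover (k + 1) \<pi> \<pi>' \<and> \<not> omitted_step k \<pi> \<pi>'"
    if c: "c < d" "same \<pi>' c d" "{c, d} \<noteq> {k, Suc k}" "?p = ?q \<circ> swap c d" for c d
  proof -
    obtain B1 B2 \<sigma> where \<sigma>: "\<sigma> \<in> NC (k + 1)" "merging (k + 1) B1 B2 \<sigma> \<pi>'" "merging.lab B1 B2 = c"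
      "Max B2 = d" "next_in_block \<sigma> = ?q \<circ> swap c d"
      using next_in_block_split[OF \<pi>' c(1,2)] by blast
    then have "\<sigma> = \<pi>" using next_in_block_inj[OF NC_D(1)[OF \<sigma>(1)] NC_D(1)[OF \<pi>]] c(4) by simp
    then interpret merging "k + 1" B1 B2 \<pi> \<pi>' using \<sigma> by simp
    have "\<not> omitted_step k \<pi> \<pi>'"
    proof
      assume o: "omitted_step k \<pi> \<pi>'"
      have "Max B2 = Suc k"
      proof (rule antisym)
        show "Max B2 \<le> Suc k" using sub fin ne by auto
        show "Suc k \<le> Max B2" using omitted_step_blocks(2)[OF o] fin ne
          by (metis Max_ge Min_in)
      qed
      then show False using omitted_step_blocks(3)[OF o] \<sigma>(3,4) c(3) by simp
    qed
    then show ?thesis unfolding NC_cover_def using merges \<pi> \<pi>' by blast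
  qed
  show "NC_cover (k + 1) \<pi> \<pi>' \<and> \<not> omitted_step k \<pi> \<pi>'"
  proof (cases "a < b")
    case True then show ?thesis using * s ab p by blast
  next
    case False
    then have "b < a" using s by simp
    then show ?thesis using *[of b a] s ab p same_sym by (metis doubleton_eq_iff transpose_commute)
  qed
qed

section \<open>Self-duality of intervals\<close>

abbreviation perm_step :: "nat \<Rightarrow> (nat \<Rightarrow> nat) \<Rightarrow> (nat \<Rightarrow> nat) \<Rightarrow> bool" where
  "perm_step k \<equiv> merge_step (NC_perms (k + 1)) {1..k + 1} k (Suc k)"

definition restr_perm :: "nat \<Rightarrow> nat set set \<Rightarrow> nat \<Rightarrow> nat" where
  "restr_perm k \<sigma> = next_in_block (restr k \<sigma>)"

definition assemble_perm :: "nat \<Rightarrow> nat \<Rightarrow> (nat \<Rightarrow> nat) \<Rightarrow> nat set \<Rightarrow> nat set set" where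
  "assemble_perm n k p S = assemble n k (inv_into (NC (k + 1)) next_in_block p) S"

lemma next_in_block_inj_on: "inj_on next_in_block (NC m)"
  using next_in_block_inj NC_D(1) by (intro inj_onI) blast

context
  fixes n k :: nat
  assumes k: "1 \<le> k" "k \<le> n"
begin

lemma restr_perm_in: "\<sigma> \<in> upper_NC n k \<Longrightarrow> restr_perm k \<sigma> \<in> NC_perms (k + 1)"
  unfolding restr_perm_def NC_perms_def using restr_NC[OF k] by blast

lemma assemble_perm:
  assumes p: "p \<in> NC_perms (k + 1)" and S: "S \<subseteq> {k+1..n}"
  shows "assemble_perm n k p S \<in> upper_NC n k"
    and "restr_perm k (assemble_perm n k p S) = p"
    and "links n k (assemble_perm n k p S) = S"
proof -
  let ?\<pi> = "inv_into (NC (k + 1)) next_in_block p"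
  have \<pi>: "?\<pi> \<in> NC (k + 1)" "next_in_block ?\<pi> = p"
    using p unfolding NC_perms_def by (auto intro: inv_into_into f_inv_into_f)
  show "assemble_perm n k p S \<in> upper_NC n k"
    unfolding assemble_perm_def by (rule assemble_upper_NC[OF k \<pi>(1) S])
  show "restr_perm k (assemble_perm n k p S) = p"
    unfolding assemble_perm_def restr_perm_def restr_assemble[OF k \<pi>(1) S] by (rule \<pi>(2))
  show "links n k (assemble_perm n k p S) = S"
    unfolding assemble_perm_def by (rule links_assemble[OF k \<pi>(1) S])
qed

lemma assemble_perm_restr_perm:
  assumes \<sigma>: "\<sigma> \<in> upper_NC n k"
  shows "assemble_perm n k (restr_perm k \<sigma>) (links n k \<sigma>) = \<sigma>"
  unfolding assemble_perm_def restr_perm_def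
  using inv_into_f_f[OF next_in_block_inj_on restr_NC[OF k \<sigma>]] assemble_restr_links[OF k \<sigma>] by simp

section \<open>The product order on permutations and link sets\<close>

lemma good_cover_iff_perm:
  assumes \<sigma>: "\<sigma> \<in> upper_NC n k" and \<tau>: "\<tau> \<in> upper_NC n k"
  shows "good_cover n k \<sigma> \<tau> \<longleftrightarrow>
    (perm_step k (restr_perm k \<sigma>) (restr_perm k \<tau>) \<and> links n k \<sigma> = links n k \<tau>) \<or>
    (restr_perm k \<sigma> = restr_perm k \<tau> \<and> (\<exists>j. j \<notin> links n k \<sigma> \<and> links n k \<tau> = insert j (links n k \<sigma>)))"
proof -
  have "restr_perm k \<sigma> = restr_perm k \<tau> \<longleftrightarrow> restr k \<sigma> = restr k \<tau>"
    unfolding restr_perm_def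
    by (rule inj_on_eq_iff[OF next_in_block_inj_on restr_NC[OF k \<sigma>] restr_NC[OF k \<tau>]])
  then show ?thesis
    unfolding good_cover_iff[OF k \<sigma> \<tau>] restr_perm_def
      merge_step_iff[OF restr_NC[OF k \<sigma>] restr_NC[OF k \<tau>]] by blast
qed

lemma good_cover_upper_NC: "good_cover n k \<sigma> \<tau> \<Longrightarrow> \<sigma> \<in> upper_NC n k \<and> \<tau> \<in> upper_NC n k"
  unfolding good_cover_def NC_cover_def upper_NC_def by blast

lemma good_covers_upper_NC: "(good_cover n k)\<^sup>*\<^sup>* \<sigma> \<tau> \<Longrightarrow> \<sigma> \<in> upper_NC n k \<Longrightarrow> \<tau> \<in> upper_NC n k"
  by (induction rule: rtranclp_induct) (auto dest: good_cover_upper_NC)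

lemma good_covers_perm_steps:
  assumes S: "S \<subseteq> {k+1..n}"
    and "(perm_step k)\<^sup>*\<^sup>* p q" "q \<in> NC_perms (k + 1)"
  shows "(good_cover n k)\<^sup>*\<^sup>* (assemble_perm n k p S) (assemble_perm n k q S)"
  using assms(2)
proof (induction rule: converse_rtranclp_induct)
  case (step p r)
  then have pr: "p \<in> NC_perms (k + 1)" "r \<in> NC_perms (k + 1)" unfolding merge_step_def by auto
  have "good_cover n k (assemble_perm n k p S) (assemble_perm n k r S)"
    using good_cover_iff_perm[OF assemble_perm(1)[OF pr(1) S] assemble_perm(1)[OF pr(2) S]] step(1)
    unfolding assemble_perm(2,3)[OF pr(1) S] assemble_perm(2,3)[OF pr(2) S] by blast
  then show ?case using step(3) by simp
qed simp

lemma good_covers_links: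
  assumes p: "p \<in> NC_perms (k + 1)" and T: "S \<subseteq> T" "T \<subseteq> {k+1..n}"
  shows "(good_cover n k)\<^sup>*\<^sup>* (assemble_perm n k p S) (assemble_perm n k p T)"
proof -
  have fin: "finite (T - S)" using finite_subset[OF T(2)] by simp
  have "(good_cover n k)\<^sup>*\<^sup>* (assemble_perm n k p S) (assemble_perm n k p (S \<union> U))"
    if "U \<subseteq> T - S" for U
    using finite_subset[OF that fin] that
  proof (induction U rule: finite_induct)
    case (insert j U)
    have sub: "S \<union> U \<subseteq> {k+1..n}" "S \<union> insert j U \<subseteq> {k+1..n}" using insert.prems T by auto
    have "j \<notin> S \<union> U" "S \<union> insert j U = insert j (S \<union> U)" using insert by auto
    then have "good_cover n k (assemble_perm n k p (S \<union> U)) (assemble_perm n k p (S \<union> insert j U))"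
      using good_cover_iff_perm[OF assemble_perm(1)[OF p sub(1)] assemble_perm(1)[OF p sub(2)]]
      unfolding assemble_perm(2,3)[OF p sub(1)] assemble_perm(2,3)[OF p sub(2)] by blast
    moreover have "(good_cover n k)\<^sup>*\<^sup>* (assemble_perm n k p S) (assemble_perm n k p (S \<union> U))"
      using insert by blast
    ultimately show ?case by (rule rtranclp.rtrancl_into_rtrancl[rotated])
  qed simp
  from this[of "T - S"] show ?thesis using T(1) by (simp add: Un_absorb1)
qed

text \<open>To climb in the product, first change the permutation while keeping the links of
  \<sigma>, then add the missing links one at a time.\<close>

lemma good_covers_iff:
  assumes \<sigma>: "\<sigma> \<in> upper_NC n k" and \<tau>: "\<tau> \<in> upper_NC n k"
  shows "(good_cover n k)\<^sup>*\<^sup>* \<sigma> \<tau> \<longleftrightarrow>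
    (perm_step k)\<^sup>*\<^sup>* (restr_perm k \<sigma>) (restr_perm k \<tau>) \<and> links n k \<sigma> \<subseteq> links n k \<tau>"
proof
  assume "(good_cover n k)\<^sup>*\<^sup>* \<sigma> \<tau>"
  then show "(perm_step k)\<^sup>*\<^sup>* (restr_perm k \<sigma>) (restr_perm k \<tau>) \<and> links n k \<sigma> \<subseteq> links n k \<tau>"
  proof (induction rule: rtranclp_induct)
    case (step y z)
    have "y \<in> upper_NC n k" "z \<in> upper_NC n k" using good_cover_upper_NC step(2) by auto
    then have "(perm_step k)\<^sup>*\<^sup>* (restr_perm k y) (restr_perm k z) \<and> links n k y \<subseteq> links n k z"
      using good_cover_iff_perm step(2) by fastforce
    then show ?case using step(3) by (meson rtranclp_trans subset_trans)
  qed simp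
next
  assume *: "(perm_step k)\<^sup>*\<^sup>* (restr_perm k \<sigma>) (restr_perm k \<tau>) \<and> links n k \<sigma> \<subseteq> links n k \<tau>"
  have "(good_cover n k)\<^sup>*\<^sup>* \<sigma> (assemble_perm n k (restr_perm k \<tau>) (links n k \<sigma>))"
    using good_covers_perm_steps[OF links_subset[OF k, of \<sigma>] conjunct1[OF *] restr_perm_in[OF \<tau>]]
    unfolding assemble_perm_restr_perm[OF \<sigma>] .
  moreover have "(good_cover n k)\<^sup>*\<^sup>* (assemble_perm n k (restr_perm k \<tau>) (links n k \<sigma>)) \<tau>"
    using good_covers_links[OF restr_perm_in[OF \<tau>] conjunct2[OF *] links_subset[OF k, of \<tau>]]
    unfolding assemble_perm_restr_perm[OF \<tau>] .
  ultimately show "(good_cover n k)\<^sup>*\<^sup>* \<sigma> \<tau>" by (rule rtranclp_trans)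
qed

lemma good_covers_interval_dual:
  assumes x: "x \<in> upper_NC n k" and y: "y \<in> upper_NC n k"
  defines "I \<equiv> {z. (good_cover n k)\<^sup>*\<^sup>* x z \<and> (good_cover n k)\<^sup>*\<^sup>* z y}"
  obtains F where "\<And>z. z \<in> I \<Longrightarrow> F z \<in> I" "\<And>z. z \<in> I \<Longrightarrow> F (F z) = z"
    "\<And>z z'. z \<in> I \<Longrightarrow> z' \<in> I \<Longrightarrow> (good_cover n k)\<^sup>*\<^sup>* z z' \<Longrightarrow> (good_cover n k)\<^sup>*\<^sup>* (F z') (F z)"
proof -
  let ?le = "(perm_step k)\<^sup>*\<^sup>*" and ?P = "restr_perm k" and ?L = "links n k"
  obtain f where ff: "\<And>p. f (f p) = p"
    and f: "\<And>p q. ?le (?P x) p \<Longrightarrow> ?le p q \<Longrightarrow> ?le q (?P y) \<Longrightarrow>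
      ?le (?P x) (f q) \<and> ?le (f q) (f p) \<and> ?le (f p) (?P y)"
  proof (rule merge_step_interval_dual[of "{1..k+1}" "NC_perms (k+1)" "?P x" "?P y" k "Suc k"])
    show "\<forall>p\<in>NC_perms (k+1). p permutes {1..k+1}" using NC_perms_permutes by blast
    show "\<forall>q\<in>NC_perms (k + 1). \<forall>a\<in>{1..k + 1}. \<forall>b\<in>{1..k + 1}.
        b \<notin> orbit (q \<circ> swap a b) a \<longrightarrow> q \<circ> swap a b \<in> NC_perms (k + 1)"
      using NC_perms_split by blast
  qed (use restr_perm_in x y in auto)
  \<comment> \<open>Reversal in both factors: \<open>f\<close> on permutations, and on links the
    complement relative to the Boolean interval from \<open>?L x\<close> to
    \<open>?L y\<close>.\<close>
  define F where "F z = assemble_perm n k (f (?P z)) (?L x \<union> (?L y - ?L z))" for z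
  have I: "z \<in> upper_NC n k" "?le (?P x) (?P z)" "?le (?P z) (?P y)" "?L x \<subseteq> ?L z" "?L z \<subseteq> ?L y"
    if z: "z \<in> I" for z
  proof -
    show zu: "z \<in> upper_NC n k" using z good_covers_upper_NC[OF _ x] unfolding I_def by blast
    show "?le (?P x) (?P z)" "?le (?P z) (?P y)" "?L x \<subseteq> ?L z" "?L z \<subseteq> ?L y"
      using z good_covers_iff[OF x zu] good_covers_iff[OF zu y] unfolding I_def by blast+
  qed
  have Iy: "z \<in> I" if "z \<in> upper_NC n k" "?le (?P x) (?P z)" "?le (?P z) (?P y)" "?L x \<subseteq> ?L z"
    "?L z \<subseteq> ?L y" for z
    unfolding I_def using good_covers_iff[OF x that(1)] good_covers_iff[OF that(1) y] that by blast
  have FP: "F z \<in> upper_NC n k" "?P (F z) = f (?P z)" "?L (F z) = ?L x \<union> (?L y - ?L z)"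
    if z: "z \<in> I" for z
  proof -
    \<comment> \<open>Using \<open>f\<close> with equal arguments shows that it maps the interval of
      permutations to itself.\<close>
    have "?le (f (?P z)) (?P y)" using f[of "?P z" "?P z"] I[OF z] by blast
    then have "f (?P z) \<in> NC_perms (k + 1)" using merge_steps_mem restr_perm_in[OF y] by metis
    moreover have "?L x \<union> (?L y - ?L z) \<subseteq> {k+1..n}"
      using links_subset[OF k, of x] links_subset[OF k, of y] by blast
    ultimately show "F z \<in> upper_NC n k" "?P (F z) = f (?P z)" "?L (F z) = ?L x \<union> (?L y - ?L z)"
      unfolding F_def using assemble_perm by blast+
  qed
  have FI: "F z \<in> I" if z: "z \<in> I" for z
  proof (rule Iy[OF FP(1)[OF z]])
    show "?le (?P x) (?P (F z))" "?le (?P (F z)) (?P y)"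
      using f[of "?P z" "?P z"] I[OF z] FP(2)[OF z] by auto
    show "?L x \<subseteq> ?L (F z)" "?L (F z) \<subseteq> ?L y" using I(4,5)[OF z] FP(3)[OF z] by auto
  qed
  show thesis
  proof (rule that[of F])
    fix z assume z: "z \<in> I"
    show "F z \<in> I" by (rule FI[OF z])
    have "?L x \<union> (?L y - (?L x \<union> (?L y - ?L z))) = ?L z" using I(4,5)[OF z] by blast
    then have "F (F z) = assemble_perm n k (?P z) (?L z)"
      unfolding F_def[of "F z"] FP(2,3)[OF z] ff by simp
    then show "F (F z) = z" using assemble_perm_restr_perm[OF I(1)[OF z]] by simp
  next
    fix z z' assume z: "z \<in> I" "z' \<in> I" and le: "(good_cover n k)\<^sup>*\<^sup>* z z'"
    have "?le (?P z) (?P z')" "?L z \<subseteq> ?L z'" using good_covers_iff[OF I(1)[OF z(1)] I(1)[OF z(2)]] le by auto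
    then have "?le (f (?P z')) (f (?P z))" "?L (F z') \<subseteq> ?L (F z)"
      using f[OF I(2)[OF z(1)] _ I(3)[OF z(2)]] FP(3)[OF z(1)] FP(3)[OF z(2)] by auto
    then show "(good_cover n k)\<^sup>*\<^sup>* (F z') (F z)"
      unfolding good_covers_iff[OF FP(1)[OF z(2)] FP(1)[OF z(1)]] FP(2)[OF z(1)] FP(2)[OF z(2)] by blast
  qed
qed

end

lemma NC_bot_upper_NC: "NC_bot (n + 1) \<in> upper_NC n k"
  unfolding upper_NC_def upper_intervals_def using NC_bot_in[of "n + 1"] by (auto simp: same_NC_bot)

theorem theorem2:
  fixes n k :: nat
  assumes "1 < k" and "k \<le> n"
  shows "locally_self_dual (Poset_carrier n k) (Poset_le n k)"
  unfolding locally_self_dual_def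
proof (intro ballI impI)
  fix x y assume x: "x \<in> Poset_carrier n k" and y: "y \<in> Poset_carrier n k"
  have kn: "1 \<le> k" "k \<le> n" "1 \<le> n" using assms by auto
  have up: "z \<in> upper_NC n k" if "z \<in> Poset_carrier n k" for z
    using that good_covers_upper_NC[OF kn(1,2) _ NC_bot_upper_NC] Poset_carrier_iff[OF kn(2,3)] by blast
  define I where "I = interval (Poset_carrier n k) (Poset_le n k) x y"
  have I: "I = {z. (good_cover n k)\<^sup>*\<^sup>* x z \<and> (good_cover n k)\<^sup>*\<^sup>* z y}"
    unfolding I_def by (rule interval_Poset[OF kn(2,3) x y])
  obtain F where F: "\<And>z. z \<in> I \<Longrightarrow> F z \<in> I" "\<And>z. z \<in> I \<Longrightarrow> F (F z) = z"
    and anti: "\<And>z z'. z \<in> I \<Longrightarrow> z' \<in> I \<Longrightarrow> (good_cover n k)\<^sup>*\<^sup>* z z' \<Longrightarrow> (good_cover n k)\<^sup>*\<^sup>* (F z') (F z)"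
    using good_covers_interval_dual[OF kn(1,2) up[OF x] up[OF y]] unfolding I[symmetric] by blast
  have le: "Poset_le n k z z' \<longleftrightarrow> (good_cover n k)\<^sup>*\<^sup>* z z'" if "z \<in> I" "z' \<in> I" for z z'
    using that Poset_le_iff[OF kn(2,3)] unfolding I_def interval_def by blast
  have "bij_betw F I I"
    by (rule bij_betw_byWitness[where f' = F]) (use F in auto)
  \<comment> \<open>\<open>F\<close> is its own inverse, so reversing the order in one direction
    already gives the equivalence.\<close>
  moreover have "Poset_le n k z z' \<longleftrightarrow> (Poset_le n k)\<inverse>\<inverse> (F z) (F z')" if "z \<in> I" "z' \<in> I" for z z'
    using le[OF that] le[OF F(1)[OF that(2)] F(1)[OF that(1)]] anti[OF that]
      anti[OF F(1)[OF that(2)] F(1)[OF that(1)]] F(2)[OF that(1)] F(2)[OF that(2)] by auto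
  ultimately show "order_isomorphic (interval (Poset_carrier n k) (Poset_le n k) x y) (Poset_le n k)
      (interval (Poset_carrier n k) (Poset_le n k) x y) ((Poset_le n k)\<inverse>\<inverse>)"
    unfolding order_isomorphic_def I_def by blast
qed

end
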